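(* Let $d\ge2$ and let $\xi$ be a Dawson--Watanabe superprocess (DW-process) in $\mathbb{R}^d$ with associated clusters $\eta_t$. Then for any $t>0$ and bounded $\mu$, as $\varepsilon\to0$, with $\|\cdot\|$ the supremum norm over $x\in\mathbb{R}^d$: (i) if $d\ge3$, then $\bigl\|\varepsilon^{2-d}P_\mu\{\xi_tB_{\,\cdot}^\varepsilon>0\}-c_d(\mu*p_t)\bigr\|\to0$; (ii) if $d=2$, then $\bigl\||\log\varepsilon|\,P_\mu\{\xi_tB_{\,\cdot}^\varepsilon>0\}-m(\varepsilon)(\mu*p_t)\bigr\|\to0$; and similarly for the clusters $\eta_t$ with $p_t$ replaced by $t\,p_t$. These results (for $\xi_t$ and for $\eta_t$) hold locally, i.e. with $\|\cdot\|$ replaced by the supremum over $x\in B$ for every bounded Borel set $B\subset\mathbb{R}^d$, whenever $\xi$ is locally finite under $P_\mu$.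
   Context: Notation: $\lambda^d$ is Lebesgue measure on $\mathbb{R}^d$, $\mu f=\int f\,d\mu$, $B_x^r$ is the open ball of radius $r$ around $x$, $P_\mu\{\xi_tB^\varepsilon_{\,\cdot}>0\}$ is the function $x\mapsto P_\mu\{\xi_tB_x^\varepsilon>0\}$, $p_t(x)=(2\pi t)^{-d/2}e^{-|x|^2/2t}$, $(\mu*f)(x)=\int f(x-u)\,\mu(du)$. A DW-process in $\mathbb{R}^d$ is a vaguely continuous measure-valued Markov process $\xi=(\xi_t)_{t\ge0}$ with $E_\mu\exp(-\xi_tf)=\exp(-\mu v_t)$ for all continuous compactly supported $f\ge0$, where $v$ is the unique solution of $\dot v=\frac12\Delta v-v^2$ on $\mathbb{R}_+\times\mathbb{R}^d$ with $v_0=f$; $P_\mu,E_\mu$ refer to the initial measure $\mu$. For $\sigma$-finite $\mu=\sum_n\mu_n$ with bounded $\mu_n$, $\xi$ is defined as the sum of independent DW-processes started at the $\mu_n$. $\xi$ is locally finite under $P_\mu$ if $\xi_t$ is $P_\mu$-a.s. locally finite for every $t>0$ (equivalently $\mu p_t<\infty$ for all $t>0$). Clusters: for fixed $t>0$, $\xi_t$ under $P_\mu$ is a Poisson sum of independent clusters of age $t$ whose roots form a Poisson process of intensity $t^{-1}\mu$. $P_x\{\eta_t\in\cdot\}$ denotes the law of a cluster $\eta_t$ rooted at $x$; it is the probability measure on nonzero finite measures determined by $E_\mu e^{-\xi_tf}=\exp\bigl(-t^{-1}\int\mu(dx)\,E_x[1-e^{-\eta_tf}]\bigr)$. Put $P_\mu\{\eta_t\in\cdot\}=\int\mu(dx)P_x\{\eta_t\in\cdot\}$.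 For $d\ge3$, $c_d>0$ is the constant depending only on $d$ such that $\varepsilon^{2-d}P_\mu\{\xi_tB_x^\varepsilon>0\}\to c_d(\mu*p_t)(x)$ as $\varepsilon\to0$ for all bounded $\mu$, $t>0$, $x\in\mathbb{R}^d$ (Dawson--Iscoe--Perkins). For $d=2$, $m(\varepsilon)=|\log\varepsilon|\,P_{\lambda^2}\{\eta_1B_0^\varepsilon>0\}=|\log\varepsilon|\int_{\mathbb{R}^2}P_x\{\eta_1B_0^\varepsilon>0\}\,dx$. *)

theory Defs
  imports "HOL-Probability.Probability"
begin

text \<open>Bounded Borel measures with the \<open>\<sigma>\<close>-algebra generated by the evaluations
  \<open>\<nu> \<mapsto> \<nu> B\<close>, built in the same way as \<^const>\<open>subprob_algebra\<close>.\<close>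

definition fin_measures :: "'a::euclidean_space measure measure" where
  "fin_measures =
     (SUP B \<in> sets borel. vimage_algebra {\<nu>. finite_measure \<nu> \<and> sets \<nu> = sets borel}
                            (\<lambda>\<nu>. emeasure \<nu> B) borel)"

lemma space_fin_measures:
  "space fin_measures = {\<nu>::'a::euclidean_space measure. finite_measure \<nu> \<and> sets \<nu> = sets borel}"
  unfolding fin_measures_def by (subst space_Sup_eq_UN) auto

lemma measurable_emeasure_fin_measures:
  "B \<in> sets borel \<Longrightarrow> (\<lambda>\<nu>. emeasure \<nu> B) \<in> borel_measurable (fin_measures :: 'a::euclidean_space measure measure)"
  unfolding fin_measures_def by (rule measurable_SUP1, assumption, rule measurable_vimage_algebra1) auto

definition sum_measure :: "(nat \<Rightarrow> 'a::euclidean_space measure) \<Rightarrow> 'a measure" where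
  "sum_measure \<nu> = measure_of UNIV (sets borel) (\<lambda>B. \<Sum>n. emeasure (\<nu> n) B)"

definition locally_finite_measure :: "'a::euclidean_space measure \<Rightarrow> bool" where
  "locally_finite_measure \<nu> \<longleftrightarrow> (\<forall>B\<in>sets borel. bounded B \<longrightarrow> emeasure \<nu> B < \<infinity>)"

definition cc_functions :: "('a::euclidean_space \<Rightarrow> real) set" where
  "cc_functions = {f. continuous_on UNIV f \<and> compact (closure {x. f x \<noteq> 0})}"

text \<open>Classical solutions of \<open>dv/dt = (1/2) \<Delta>v - v\<^sup>2\<close> on \<open>[0,\<infinity>) \<times> \<real>\<^sup>d\<close> with \<open>v 0 = f\<close>, in the class
  of bounded nonnegative functions, where they are unique. \<open>D1 t x b\<close> and \<open>D2 t x b\<close> are the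
  first and second partial derivatives of \<open>v t\<close> at \<open>x\<close> in the coordinate direction \<open>b\<close>.\<close>

definition DW_evolution :: "('a::euclidean_space \<Rightarrow> real) \<Rightarrow> (real \<Rightarrow> 'a \<Rightarrow> real) \<Rightarrow> bool" where
  "DW_evolution f v \<longleftrightarrow>
     (\<forall>t\<ge>0. \<forall>x. 0 \<le> v t x) \<and> (\<exists>C. \<forall>t\<ge>0. \<forall>x. v t x \<le> C) \<and>
     continuous_on ({0..} \<times> UNIV) (\<lambda>(t, x). v t x) \<and>
     (\<forall>x. v 0 x = f x) \<and>
     (\<exists>D1 D2 :: real \<Rightarrow> 'a \<Rightarrow> 'a \<Rightarrow> real.
        (\<forall>b\<in>Basis. continuous_on ({0<..} \<times> UNIV) (\<lambda>(t, x). D1 t x b) \<and>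
                   continuous_on ({0<..} \<times> UNIV) (\<lambda>(t, x). D2 t x b)) \<and>
        (\<forall>t>0. \<forall>x.
           (\<forall>b\<in>Basis.
              ((\<lambda>h. v t (x + h *\<^sub>R b)) has_real_derivative D1 t x b) (at 0) \<and>
              ((\<lambda>h. D1 t (x + h *\<^sub>R b) b) has_real_derivative D2 t x b) (at 0)) \<and>
           ((\<lambda>s. v s x) has_real_derivative (1/2 * (\<Sum>b\<in>Basis. D2 t x b) - (v t x)\<^sup>2)) (at t)))"

definition natural_filtration ::
    "'w measure \<Rightarrow> (real \<Rightarrow> 'w \<Rightarrow> 'a::euclidean_space measure) \<Rightarrow> real \<Rightarrow> 'w measure" where
  "natural_filtration W \<xi> s =
     sigma (space W) {\<xi> r -` C \<inter> space W | r C. 0 \<le> r \<and> r \<le> s \<and> C \<in> sets fin_measures}"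

text \<open>The Markov family \<open>(P \<mu>)\<close>, indexed by the bounded initial measures \<open>\<mu>\<close>, on the measurable
  space \<open>W\<close> (only the \<open>\<sigma>\<close>-algebra of \<open>W\<close> matters).\<close>

locale DW_process =
  fixes W :: "'w measure"
    and P :: "'a::euclidean_space measure \<Rightarrow> 'w measure"
    and \<xi> :: "real \<Rightarrow> 'w \<Rightarrow> 'a measure"
  assumes prob: "\<mu> \<in> space fin_measures \<Longrightarrow> prob_space (P \<mu>)"
    and sets_P: "\<mu> \<in> space fin_measures \<Longrightarrow> sets (P \<mu>) = sets W"
    and measurable_\<xi>: "0 \<le> t \<Longrightarrow> \<xi> t \<in> W \<rightarrow>\<^sub>M fin_measures"
    and initial: "\<mu> \<in> space fin_measures \<Longrightarrow> AE \<omega> in P \<mu>. \<xi> 0 \<omega> = \<mu>"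
    and vaguely_continuous: "\<mu> \<in> space fin_measures \<Longrightarrow>
      AE \<omega> in P \<mu>. \<forall>f\<in>cc_functions. continuous_on {0..} (\<lambda>t. \<integral>x. f x \<partial>\<xi> t \<omega>)"
    and Markov: "\<mu> \<in> space fin_measures \<Longrightarrow> 0 \<le> s \<Longrightarrow> 0 \<le> t \<Longrightarrow> C \<in> sets fin_measures \<Longrightarrow>
      AE \<omega> in P \<mu>.
        real_cond_exp (P \<mu>) (natural_filtration W \<xi> s)
          (indicator {\<omega>' \<in> space W. \<xi> (s + t) \<omega>' \<in> C}) \<omega>
        = measure (P (\<xi> s \<omega>)) {\<omega>' \<in> space W. \<xi> t \<omega>' \<in> C}"
    and Laplace: "f \<in> cc_functions \<Longrightarrow> (\<forall>x. 0 \<le> f x) \<Longrightarrow>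
      \<exists>v. DW_evolution f v \<and>
        (\<forall>\<mu>\<in>space fin_measures. \<forall>t\<ge>0.
           (\<integral>\<omega>. exp (- (\<integral>x. f x \<partial>\<xi> t \<omega>)) \<partial>P \<mu>) = exp (- (\<integral>x. v t x \<partial>\<mu>)))"

text \<open>For an unbounded initial measure \<open>\<mu> = (\<Sum>n. \<mu>s n)\<close> with bounded \<open>\<mu>s n\<close>, the process is the sum
  of independent DW-processes started at the \<open>\<mu>s n\<close>, realized on a product space.\<close>

definition sum_prob ::
    "('a::euclidean_space measure \<Rightarrow> 'w measure) \<Rightarrow> (nat \<Rightarrow> 'a measure) \<Rightarrow> (nat \<Rightarrow> 'w) measure" where
  "sum_prob P \<mu>s = PiM UNIV (\<lambda>n. P (\<mu>s n))"

definition sum_process ::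
    "(real \<Rightarrow> 'w \<Rightarrow> 'a::euclidean_space measure) \<Rightarrow> real \<Rightarrow> (nat \<Rightarrow> 'w) \<Rightarrow> 'a measure" where
  "sum_process \<xi> t \<omega> = sum_measure (\<lambda>n. \<xi> t (\<omega> n))"

definition locally_finite_DW ::
    "('a::euclidean_space measure \<Rightarrow> 'w measure) \<Rightarrow> (real \<Rightarrow> 'w \<Rightarrow> 'a measure) \<Rightarrow> (nat \<Rightarrow> 'a measure) \<Rightarrow> bool" where
  "locally_finite_DW P \<xi> \<mu>s \<longleftrightarrow>
     (\<forall>t>0. AE \<omega> in sum_prob P \<mu>s. locally_finite_measure (sum_process \<xi> t \<omega>))"

text \<open>\<open>H t x\<close> is the law of a cluster of age \<open>t\<close> rooted at \<open>x\<close>, so that \<open>\<mu> \<bind> H t\<close> is the (not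
  necessarily normalized or finite) mixture \<open>\<integral>\<mu>(dx) H t x\<close>.\<close>

locale DW_clusters = DW_process W P \<xi>
  for W :: "'w measure"
    and P :: "'a::euclidean_space measure \<Rightarrow> 'w measure"
    and \<xi> :: "real \<Rightarrow> 'w \<Rightarrow> 'a measure" +
  fixes H :: "real \<Rightarrow> 'a \<Rightarrow> 'a measure measure"
  assumes cluster_kernel: "0 < t \<Longrightarrow> H t \<in> borel \<rightarrow>\<^sub>M prob_algebra fin_measures"
    and cluster_nonzero: "0 < t \<Longrightarrow> AE \<nu> in H t x. emeasure \<nu> UNIV > 0"
    and cluster_Laplace: "\<mu> \<in> space fin_measures \<Longrightarrow> 0 < t \<Longrightarrow> f \<in> cc_functions \<Longrightarrow> (\<forall>x. 0 \<le> f x) \<Longrightarrow>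
      (\<integral>\<omega>. exp (- (\<integral>x. f x \<partial>\<xi> t \<omega>)) \<partial>P \<mu>)
      = exp (- (1 / t) * (\<integral>x. (\<integral>\<nu>. 1 - exp (- (\<integral>y. f y \<partial>\<nu>)) \<partial>H t x) \<partial>\<mu>))"

text \<open>\<open>P{X has mass in the ball}\<close> and \<open>\<mu> * p\<^sub>t\<close> are extended nonnegative reals, as they may be infinite for general
  \<open>\<sigma>\<close>-finite initial measures.\<close>

definition hitting :: "'w measure \<Rightarrow> ('w \<Rightarrow> 'a::euclidean_space measure) \<Rightarrow> real \<Rightarrow> 'a \<Rightarrow> ennreal" where
  "hitting M X \<epsilon> x = emeasure M {\<omega> \<in> space M. emeasure (X \<omega>) (ball x \<epsilon>) > 0}"

definition heat_kernel :: "real \<Rightarrow> 'a::euclidean_space \<Rightarrow> real" where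
  "heat_kernel t x = (2 * pi * t) powr (- real DIM('a) / 2) * exp (- (norm x)\<^sup>2 / (2 * t))"

definition heat_conv :: "'a::euclidean_space measure \<Rightarrow> real \<Rightarrow> 'a \<Rightarrow> ennreal" where
  "heat_conv \<mu> t x = (\<integral>\<^sup>+u. ennreal (heat_kernel t (x - u)) \<partial>\<mu>)"

text \<open>For \<open>d \<ge> 3\<close> this determines \<open>c\<close> uniquely (Dawson--Iscoe--Perkins); for \<open>d = 2\<close> no such \<open>c\<close>
  exists, so the property must only be used for \<open>d \<ge> 3\<close>.\<close>

definition DIP_constant ::
    "('a::euclidean_space measure \<Rightarrow> 'w measure) \<Rightarrow> (real \<Rightarrow> 'w \<Rightarrow> 'a measure) \<Rightarrow> real \<Rightarrow> bool" where
  "DIP_constant P \<xi> c \<longleftrightarrow> 0 < c \<and>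
     (\<forall>\<mu>\<in>space fin_measures. \<forall>t>0. \<forall>x.
        ((\<lambda>\<epsilon>. ennreal (\<epsilon> powr (2 - real DIM('a))) * hitting (P \<mu>) (\<xi> t) \<epsilon> x)
          \<longlongrightarrow> ennreal c * heat_conv \<mu> t x) (at_right 0))"

definition log_norm :: "(real \<Rightarrow> 'a::euclidean_space \<Rightarrow> 'a measure measure) \<Rightarrow> real \<Rightarrow> ennreal" where
  "log_norm H \<epsilon> = ennreal \<bar>ln \<epsilon>\<bar> * hitting (lborel \<bind> H 1) (\<lambda>\<nu>. \<nu>) \<epsilon> 0"

text \<open>\<open>sup_B |F \<epsilon> - G \<epsilon>| \<rightarrow> 0\<close> as \<open>\<epsilon> \<rightarrow> 0+\<close>. The difference is taken in \<^typ>\<open>ereal\<close>, where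
  \<open>\<bar>\<infinity> - \<infinity>\<bar> = \<infinity>\<close>, so the property includes finiteness of both functions on \<open>B\<close> for small \<open>\<epsilon>\<close>;
  the supremum is taken in \<^typ>\<open>ennreal\<close>, so that it is \<open>0\<close> for empty \<open>B\<close>.\<close>

definition unif_close_on ::
    "'a set \<Rightarrow> (real \<Rightarrow> 'a \<Rightarrow> ennreal) \<Rightarrow> (real \<Rightarrow> 'a \<Rightarrow> ennreal) \<Rightarrow> bool" where
  "unif_close_on B F G \<longleftrightarrow>
     ((\<lambda>\<epsilon>. SUP x\<in>B. e2ennreal \<bar>enn2ereal (F \<epsilon> x) - enn2ereal (G \<epsilon> x)\<bar>) \<longlongrightarrow> 0) (at_right 0)"

end

theory Submission
  imports Defs
begin

text \<open>
  Everything reduces to one function. Let \<open>u\<^sub>\<epsilon>(t,x)\<close> be \<open>1/t\<close> times the probability that a cluster of age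
  \<open>t\<close> rooted at \<open>x\<close> charges the ball of radius \<open>\<epsilon>\<close> around \<open>0\<close> (\<open>cluster_density\<close>), and put
  \<open>\<Phi>(y) = \<integral> u\<^sub>\<epsilon>(t,x-y) \<mu>(dx)\<close>. Then the clusters hit the ball around \<open>y\<close> with mass \<open>t \<Phi>(y)\<close>
  (\<open>hitting_clusters\<close>) and the process hits it with probability \<open>1 - exp (-\<Phi>(y))\<close>
  (\<open>hitting_process\<close>, \<open>hitting_sum_process\<close>). As \<open>\<Phi>\<close> turns out to be of the order of \<open>1/r\<close>, where
  \<open>r = r(\<epsilon>) \<rightarrow> \<infinity>\<close> is the normalization \<open>\<epsilon>\<^bsup>2-d\<^esup>\<close> or \<open>\<bar>ln \<epsilon>\<bar>\<close>, the difference between \<open>\<Phi>\<close> and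
  \<open>1 - exp (-\<Phi>)\<close> is negligible, and all claims follow once \<open>r u\<^sub>\<epsilon>(t,\<cdot>) - m(\<epsilon>) p\<^sub>t\<close> is small in a sense that
  survives integration against \<open>\<mu>\<close>. Here \<open>m(\<epsilon>) = r \<integral> u\<^sub>\<epsilon>(1,x) dx\<close>, in every dimension.

  By the Laplace functionals, \<open>u\<^sub>\<epsilon>\<close> is the limit of solutions of \<open>\<partial>\<^sub>t v = \<Delta>v/2 - v\<^sup>2\<close> whose
  initial values grow to infinity on the ball and vanish off it. Two properties of such \<open>v\<close> are needed,
  and both follow from the maximum principle (\<open>parabolic_maximum_principle\<close>).

  \<^item> Upper bound: \<open>r v(t,x) \<le> A p\<^bsub>4t\<^esub>(x)\<close> for all small \<open>\<epsilon>\<close>, with \<open>A\<close> independent of the initial value and of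
    \<open>t\<close> (\<open>DW_upper_bound\<close>). After scaling to \<open>\<epsilon> = 1\<close> this is comparison with explicit supersolutions; in
    the plane the supersolution \<open>A / (T ln T) exp (-(1 - 1 / ln T) \<bar>x\<bar>\<^sup>2 / (2T))\<close> supplies the logarithm.

  \<^item> Heat flow: as \<open>0 \<le> v\<^sup>2 \<le> \<delta> v\<close> with \<open>\<delta> = sup v = O(1/r)\<close> after a fixed time \<open>s\<close>, the function \<open>v(t)\<close>
    lies between \<open>e\<^bsup>-\<delta>(t-s)\<^esup> P\<^bsub>t-s\<^esub> v(s)\<close> and \<open>P\<^bsub>t-s\<^esub> v(s)\<close>, with \<open>P\<close> the heat semigroup (\<open>cluster_density_flow\<close>).

  Now fix a small \<open>s\<close>. By the upper bound \<open>r u\<^sub>\<epsilon>(s,\<cdot>)\<close> has bounded mass concentrated within \<open>O(\<surd>s)\<close> of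
  the origin, so \<open>P\<^bsub>t-s\<^esub>\<close> turns it into nearly its mass times \<open>p\<^sub>t\<close> (\<open>heat_flow_concentrated\<close>). As \<open>\<epsilon> \<rightarrow> 0\<close>
  also \<open>\<delta> \<rightarrow> 0\<close>, so the mass at time \<open>s\<close> is nearly the mass \<open>m(\<epsilon>)\<close> at time \<open>1\<close>, and \<open>r u\<^sub>\<epsilon>(t,\<cdot>)\<close> is
  uniformly close to \<open>m(\<epsilon>) p\<^sub>t\<close>. Interpolation with the Gaussian upper bound makes the error at most
  \<open>\<eta> exp (-\<bar>x\<bar>\<^sup>2 / (16t))\<close> (\<open>cluster_density_gaussian_limit\<close>). This can be integrated against every
  bounded \<open>\<mu>\<close>, uniformly in \<open>y\<close>, and, uniformly for \<open>y\<close> in a bounded set, against every \<open>\<mu>\<close> with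
  locally finite process, as local finiteness forces all Gaussian integrals of \<open>\<mu>\<close> to be finite
  (\<open>locally_finite_imp_gaussian_integrable\<close>). For \<open>d \<ge> 3\<close>, the pointwise limit that defines \<open>c\<close>,
  used at a single point and for a single initial measure, gives \<open>m(\<epsilon>) \<rightarrow> c\<close>.
\<close>

section \<open>The heat operator and the parabolic maximum principle\<close>

text \<open>\<open>l\<close> is the value of \<open>\<partial>\<^sub>t w - \<Delta>w/2\<close> at \<open>(t,x)\<close>, with the Laplacian formed from one-dimensional
  derivatives. The first space derivative is only required close to \<open>x\<close>, so that functions which blow up at
  the boundary of a ball are admitted.\<close>

definition has_heat_op :: "(real \<Rightarrow> 'a::euclidean_space \<Rightarrow> real) \<Rightarrow> real \<Rightarrow> 'a \<Rightarrow> real \<Rightarrow> bool" where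
  "has_heat_op w t x l \<longleftrightarrow>
     (\<exists>w' D2. ((\<lambda>s. w s x) has_real_derivative w') (at t) \<and>
        (\<forall>b\<in>Basis. \<exists>D1.
           (\<forall>\<^sub>F h in nhds 0. ((\<lambda>h. w t (x + h *\<^sub>R b)) has_real_derivative D1 h) (at h)) \<and>
           (D1 has_real_derivative D2 b) (at 0)) \<and>
        l = w' - (\<Sum>b\<in>Basis. D2 b) / 2)"

lemma has_heat_opI:
  assumes "((\<lambda>s. w s x) has_real_derivative w') (at t)"
    and "\<And>b. b \<in> Basis \<Longrightarrow> \<forall>\<^sub>F h in nhds 0. ((\<lambda>h. w t (x + h *\<^sub>R b)) has_real_derivative D1 b h) (at h)"
    and "\<And>b. b \<in> Basis \<Longrightarrow> (D1 b has_real_derivative D2 b) (at 0)"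
    and "l = w' - (\<Sum>b\<in>Basis. D2 b) / 2"
  shows "has_heat_op w t x l"
  unfolding has_heat_op_def using assms by (intro exI[of _ w'] exI[of _ D2]) blast

lemma has_heat_op_add:
  assumes "has_heat_op v t x k" "has_heat_op w t x l"
  shows "has_heat_op (\<lambda>t x. v t x + w t x) t x (k + l)"
proof -
  from assms(1) obtain v' V2 where v: "((\<lambda>s. v s x) has_real_derivative v') (at t)"
    "\<And>b. b \<in> Basis \<Longrightarrow> \<exists>D1. (\<forall>\<^sub>F h in nhds 0. ((\<lambda>h. v t (x + h *\<^sub>R b)) has_real_derivative D1 h) (at h))
       \<and> (D1 has_real_derivative V2 b) (at 0)"
    "k = v' - (\<Sum>b\<in>Basis. V2 b) / 2" unfolding has_heat_op_def by blast
  from assms(2) obtain w' W2 where w: "((\<lambda>s. w s x) has_real_derivative w') (at t)"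
    "\<And>b. b \<in> Basis \<Longrightarrow> \<exists>D1. (\<forall>\<^sub>F h in nhds 0. ((\<lambda>h. w t (x + h *\<^sub>R b)) has_real_derivative D1 h) (at h))
       \<and> (D1 has_real_derivative W2 b) (at 0)"
    "l = w' - (\<Sum>b\<in>Basis. W2 b) / 2" unfolding has_heat_op_def by blast
  have "\<exists>D1. (\<forall>\<^sub>F h in nhds 0. ((\<lambda>h. v t (x + h *\<^sub>R b) + w t (x + h *\<^sub>R b)) has_real_derivative D1 h) (at h))
       \<and> (D1 has_real_derivative V2 b + W2 b) (at 0)" if b: "b \<in> Basis" for b
  proof -
    from v(2)[OF b] obtain A where A: "\<forall>\<^sub>F h in nhds 0. ((\<lambda>h. v t (x + h *\<^sub>R b)) has_real_derivative A h) (at h)"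
       "(A has_real_derivative V2 b) (at 0)" by blast
    from w(2)[OF b] obtain B where B: "\<forall>\<^sub>F h in nhds 0. ((\<lambda>h. w t (x + h *\<^sub>R b)) has_real_derivative B h) (at h)"
       "(B has_real_derivative W2 b) (at 0)" by blast
    show ?thesis
    proof (intro exI conjI)
      show "\<forall>\<^sub>F h in nhds 0. ((\<lambda>h. v t (x + h *\<^sub>R b) + w t (x + h *\<^sub>R b)) has_real_derivative A h + B h) (at h)"
        using A(1) B(1) by eventually_elim (rule DERIV_add)
      show "((\<lambda>h. A h + B h) has_real_derivative V2 b + W2 b) (at 0)"
        using A(2) B(2) by (rule DERIV_add)
    qed
  qed
  moreover have "((\<lambda>s. v s x + w s x) has_real_derivative v' + w') (at t)"
    using v(1) w(1) by (rule DERIV_add)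
  moreover have "k + l = v' + w' - (\<Sum>b\<in>Basis. V2 b + W2 b) / 2"
    using v(3) w(3) by (simp add: sum.distrib add_divide_distrib)
  ultimately show ?thesis unfolding has_heat_op_def by (intro exI[of _ "v' + w'"] exI[of _ "\<lambda>b. V2 b + W2 b"]) auto
qed

lemma has_heat_op_time_mult:
  assumes "has_heat_op w t x l" "(k has_real_derivative k') (at t)"
  shows "has_heat_op (\<lambda>t x. k t * w t x) t x (k' * w t x + k t * l)"
proof -
  from assms(1) obtain w' W2 where w: "((\<lambda>s. w s x) has_real_derivative w') (at t)"
    "\<And>b. b \<in> Basis \<Longrightarrow> \<exists>D1. (\<forall>\<^sub>F h in nhds 0. ((\<lambda>h. w t (x + h *\<^sub>R b)) has_real_derivative D1 h) (at h))
       \<and> (D1 has_real_derivative W2 b) (at 0)"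
    "l = w' - (\<Sum>b\<in>Basis. W2 b) / 2" unfolding has_heat_op_def by blast
  have "\<exists>D1. (\<forall>\<^sub>F h in nhds 0. ((\<lambda>h. k t * w t (x + h *\<^sub>R b)) has_real_derivative D1 h) (at h))
       \<and> (D1 has_real_derivative k t * W2 b) (at 0)" if b: "b \<in> Basis" for b
  proof -
    from w(2)[OF b] obtain B where B: "\<forall>\<^sub>F h in nhds 0. ((\<lambda>h. w t (x + h *\<^sub>R b)) has_real_derivative B h) (at h)"
       "(B has_real_derivative W2 b) (at 0)" by blast
    show ?thesis
    proof (intro exI conjI)
      show "\<forall>\<^sub>F h in nhds 0. ((\<lambda>h. k t * w t (x + h *\<^sub>R b)) has_real_derivative k t * B h) (at h)"
        using B(1) by eventually_elim (rule DERIV_cmult)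
      show "((\<lambda>h. k t * B h) has_real_derivative k t * W2 b) (at 0)"
        using B(2) by (rule DERIV_cmult)
    qed
  qed
  moreover have "((\<lambda>s. k s * w s x) has_real_derivative k' * w t x + k t * w') (at t)"
    using DERIV_mult[OF assms(2) w(1)] by (simp add: algebra_simps)
  moreover have "k' * w t x + k t * l = k' * w t x + k t * w' - (\<Sum>b\<in>Basis. k t * W2 b) / 2"
    unfolding w(3) by (simp add: sum_distrib_left[symmetric] right_diff_distrib)
  ultimately show ?thesis unfolding has_heat_op_def
    by (intro exI[of _ "k' * w t x + k t * w'"] exI[of _ "\<lambda>b. k t * W2 b"]) auto
qed

lemma has_heat_op_diff:
  assumes "has_heat_op v t x k" "has_heat_op w t x l"
  shows "has_heat_op (\<lambda>t x. v t x - w t x) t x (k - l)"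
  using has_heat_op_add[OF assms(1) has_heat_op_time_mult[OF assms(2), of "\<lambda>_. -1" 0]] by simp

lemma has_heat_op_time:
  assumes "(k has_real_derivative k') (at t)"
  shows "has_heat_op (\<lambda>t x. k t) t x k'"
proof -
  have "(\<forall>\<^sub>F h in nhds 0. ((\<lambda>h. k t) has_real_derivative (\<lambda>_. 0) h) (at h)) \<and> ((\<lambda>_::real. 0) has_real_derivative (0::real)) (at 0)"
    by simp
  then show ?thesis unfolding has_heat_op_def using assms
    by (intro exI[of _ k'] exI[of _ "\<lambda>_. 0"]) (auto intro!: exI[of _ "\<lambda>_. 0"])
qed

lemma DW_evolution_heat_op:
  assumes "DW_evolution f v" "0 < t"
  shows "has_heat_op v t x (- (v t x)\<^sup>2)"
proof -
  from assms obtain D1 D2 :: "real \<Rightarrow> 'a \<Rightarrow> 'a \<Rightarrow> real" where D: "\<And>t x b. t > 0 \<Longrightarrow> b\<in>Basis \<Longrightarrow>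
              ((\<lambda>h. v t (x + h *\<^sub>R b)) has_real_derivative D1 t x b) (at 0)"
              "\<And>t x b. t > 0 \<Longrightarrow> b\<in>Basis \<Longrightarrow> ((\<lambda>h. D1 t (x + h *\<^sub>R b) b) has_real_derivative D2 t x b) (at 0)"
    and T: "\<And>t x. t>0 \<Longrightarrow> ((\<lambda>s. v s x) has_real_derivative (1/2 * (\<Sum>b\<in>Basis. D2 t x b) - (v t x)\<^sup>2)) (at t)"
    unfolding DW_evolution_def by blast
  have "((\<lambda>h. v t (x + h *\<^sub>R b)) has_real_derivative D1 t (x + h *\<^sub>R b) b) (at h)" if "b \<in> Basis" for h b
    using D(1)[OF assms(2) that, of "x + h *\<^sub>R b"]
    by (subst DERIV_shift[of "\<lambda>h. v t (x + h *\<^sub>R b)" _ 0 h, simplified]) (simp add: algebra_simps)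
  then show ?thesis using T[OF assms(2), of x] D(2)[OF assms(2), of _ x]
    by (intro has_heat_opI[where w' = "1/2 * (\<Sum>b\<in>Basis. D2 t x b) - (v t x)\<^sup>2" and ?D2.0 = "D2 t x"
          and ?D1.0 = "\<lambda>b h. D1 t (x + h *\<^sub>R b) b"]) auto
qed

lemma second_derivative_nonpos_at_max:
  fixes f :: "real \<Rightarrow> real"
  assumes d: "\<forall>\<^sub>F h in nhds 0. (f has_real_derivative D1 h) (at h)"
    and d2: "(D1 has_real_derivative D2) (at 0)"
    and max: "\<forall>\<^sub>F h in nhds 0. f h \<le> f 0"
  shows "D2 \<le> 0"
proof (rule ccontr)
  assume "\<not> D2 \<le> 0"
  then have pos: "D2 > 0" by simp
  from d max have "\<forall>\<^sub>F h in nhds 0. (f has_real_derivative D1 h) (at h) \<and> f h \<le> f 0" by eventually_elim auto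
  then obtain r where r: "r > 0" "\<And>h. \<bar>h\<bar> < r \<Longrightarrow> (f has_real_derivative D1 h) (at h) \<and> f h \<le> f 0"
    unfolding eventually_nhds_metric by (auto simp: dist_real_def)
  have 0: "D1 0 = 0" using r by (intro DERIV_local_max[of f _ 0 r]) auto
  from DERIV_pos_inc_right[OF d2 pos] 0 obtain e where e: "e > 0" "\<And>h. h > 0 \<Longrightarrow> h < e \<Longrightarrow> 0 < D1 h" by auto
  define h where "h = min r e / 2"
  have h: "0 < h" "h < r" "h < e" using r(1) e(1) by (auto simp: h_def)
  from MVT2[OF h(1), of f D1] r(2) h obtain z where z: "0 < z" "z < h" "f h - f 0 = (h - 0) * D1 z"
    by auto
  have "f h - f 0 > 0" unfolding z(3) using e(2)[of z] z h by simp
  then show False using r(2)[of h] h by simp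
qed

text \<open>At a maximum in space the second derivatives are nonpositive; at a maximum over the past the time derivative
  is nonnegative.\<close>

lemma has_heat_op_nonneg_at_max:
  fixes z :: "real \<Rightarrow> 'a::euclidean_space \<Rightarrow> real"
  assumes "has_heat_op z t x l"
    and space: "\<forall>\<^sub>F y in nhds x. z t y \<le> z t x"
    and time: "\<And>s. a \<le> s \<Longrightarrow> s \<le> t \<Longrightarrow> z s x \<le> z t x" "a < t"
  shows "0 \<le> l"
proof -
  from assms(1) obtain w' W2 where w: "((\<lambda>s. z s x) has_real_derivative w') (at t)"
    "\<And>b. b \<in> Basis \<Longrightarrow> \<exists>D1. (\<forall>\<^sub>F h in nhds 0. ((\<lambda>h. z t (x + h *\<^sub>R b)) has_real_derivative D1 h) (at h))
       \<and> (D1 has_real_derivative W2 b) (at 0)"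
    "l = w' - (\<Sum>b\<in>Basis. W2 b) / 2" unfolding has_heat_op_def by blast
  have "0 \<le> w'"
  proof (rule ccontr)
    assume "\<not> 0 \<le> w'"
    then obtain e where e: "e > 0" "\<And>h. h > 0 \<Longrightarrow> h < e \<Longrightarrow> z t x < z (t - h) x"
      using DERIV_neg_dec_left[OF w(1)] by auto
    define h where "h = min e (t - a) / 2"
    have h: "h > 0" "h < e" "h < t - a" using e(1) time(2) by (auto simp: h_def min_def)
    show False using e(2)[OF h(1,2)] time(1)[of "t - h"] h by simp
  qed
  moreover have "W2 b \<le> 0" if b: "b \<in> Basis" for b
  proof -
    from w(2)[OF b] obtain D1 where D1: "\<forall>\<^sub>F h in nhds 0. ((\<lambda>h. z t (x + h *\<^sub>R b)) has_real_derivative D1 h) (at h)"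
       "(D1 has_real_derivative W2 b) (at 0)" by blast
    have "((\<lambda>h. x + h *\<^sub>R b) \<longlongrightarrow> x + 0 *\<^sub>R b) (nhds 0)" by (intro tendsto_intros filterlim_ident)
    then have "filterlim (\<lambda>h. x + h *\<^sub>R b) (nhds x) (nhds 0)" by simp
    then have "\<forall>\<^sub>F h in nhds 0. z t (x + h *\<^sub>R b) \<le> z t x"
      using space by (rule eventually_compose_filterlim[rotated])
    then show ?thesis using second_derivative_nonpos_at_max[OF D1] by simp
  qed
  then have "(\<Sum>b\<in>Basis. W2 b) \<le> 0" by (simp add: sum_nonpos)
  ultimately show ?thesis using w(3) by simp
qed

text \<open>A positive value of \<open>w\<close> survives the subtraction of a small multiple of \<open>\<bar>x\<bar>\<^sup>2 + (d+1)(t-a)\<close>, on which the heat operator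
  equals \<open>1\<close>. The difference is negative far out, hence attains its maximum at an
  interior point, and there the heat operator would be both nonnegative and negative. The differential inequality enters only
  where \<open>w\<close> is positive, which is what comparison for the nonlinear equation needs; a general closed \<open>D\<close> allows local barriers.\<close>

lemma parabolic_maximum_principle:
  fixes w :: "real \<Rightarrow> 'a::euclidean_space \<Rightarrow> real"
  assumes D: "closed D"
    and cont: "continuous_on ({a..b} \<times> D) (\<lambda>(t, x). w t x)"
    and bounded: "\<And>t x. a \<le> t \<Longrightarrow> t \<le> b \<Longrightarrow> x \<in> D \<Longrightarrow> w t x \<le> C"
    and initial: "\<And>x. x \<in> D \<Longrightarrow> w a x \<le> 0"
    and side: "\<And>t x. a \<le> t \<Longrightarrow> t \<le> b \<Longrightarrow> x \<in> D - interior D \<Longrightarrow> w t x \<le> 0"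
    and sub: "\<And>t x. a < t \<Longrightarrow> t \<le> b \<Longrightarrow> x \<in> interior D \<Longrightarrow> 0 < w t x \<Longrightarrow>
                \<exists>l\<le>0. has_heat_op w t x l"
    and tx: "a \<le> t" "t \<le> b" "x \<in> D"
  shows "w t x \<le> 0"
proof (rule ccontr)
  assume "\<not> w t x \<le> 0"
  then have pos: "w t x > 0" by simp
  define q where "q = (\<lambda>t (x::'a). (norm x)\<^sup>2 + (real DIM('a) + 1) * (t - a))"
  define \<theta> where "\<theta> = w t x / (2 * (q t x + 1))"
  define z where "z = (\<lambda>t x. w t x - \<theta> * q t x)"
  have q0: "0 \<le> q s y" if "a \<le> s" for s y using that by (simp add: q_def)
  have \<theta>: "\<theta> > 0" using pos q0[OF tx(1), of x] by (simp add: \<theta>_def)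
  have "0 \<le> q t x * w t x" using pos q0[OF tx(1), of x] by simp
  then have "0 < 2 * w t x + q t x * w t x" using pos by linarith
  then have "\<theta> * q t x < w t x" using pos q0[OF tx(1), of x] by (simp add: \<theta>_def field_simps)
  then have zpos: "z t x > 0" by (simp add: z_def)
  define R where "R = sqrt (\<bar>C\<bar> / \<theta>) + 1"
  have R: "\<bar>C\<bar> < \<theta> * R\<^sup>2" 
  proof -
    have "R\<^sup>2 = \<bar>C\<bar> / \<theta> + 2 * sqrt (\<bar>C\<bar> / \<theta>) + 1" using \<theta> by (simp add: R_def power2_sum)
    moreover have "sqrt (\<bar>C\<bar> / \<theta>) \<ge> 0" using \<theta> by simp
    ultimately have "R\<^sup>2 > \<bar>C\<bar> / \<theta>" by linarith
    then show ?thesis using \<theta> by (simp add: field_simps)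
  qed
  have far: "norm y < R" if "a \<le> s" "s \<le> b" "y \<in> D" "0 < z s y" for s y
  proof (rule ccontr)
    assume "\<not> norm y < R"
    then have "R\<^sup>2 \<le> (norm y)\<^sup>2" using \<theta> by (intro power_mono) (auto simp: R_def intro!: add_nonneg_nonneg)
    then have "\<theta> * R\<^sup>2 \<le> \<theta> * q s y" using \<theta> that(1) by (intro mult_left_mono) (auto simp: q_def intro: add_increasing2)
    then show False using R bounded[OF that(1-3)] that(4) by (simp add: z_def)
  qed
  define K where "K = {a..b} \<times> (D \<inter> cball 0 R)"
  have "compact K" unfolding K_def using D by (intro compact_Times closed_Int_compact) auto
  moreover have "(t, x) \<in> K" using tx far[OF tx zpos] by (simp add: K_def)
  moreover have "continuous_on K (\<lambda>(t, x). z t x)"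
    unfolding z_def q_def K_def split_beta
    by (intro continuous_intros continuous_on_subset[OF cont[unfolded split_beta]]) auto
  ultimately obtain p where p: "p \<in> K" "\<And>p'. p' \<in> K \<Longrightarrow> (case p' of (t, x) \<Rightarrow> z t x) \<le> (case p of (t, x) \<Rightarrow> z t x)"
    using continuous_attains_sup[of K "\<lambda>(t, x). z t x"] by blast
  obtain s y where sy: "p = (s, y)" by fastforce
  have s: "a \<le> s" "s \<le> b" "y \<in> D" using p(1) by (auto simp: sy K_def)
  have max: "z s' y' \<le> z s y" if "a \<le> s'" "s' \<le> b" "y' \<in> D" "norm y' \<le> R" for s' y'
    using p(2)[of "(s', y')"] that by (simp add: sy K_def)
  have zs: "z s y > 0" using p(2)[OF \<open>(t, x) \<in> K\<close>] zpos by (simp add: sy)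
  have ws: "w s y > 0" using zs \<theta> mult_nonneg_nonneg[OF less_imp_le[OF \<theta>] q0[OF s(1), of y]] by (simp add: z_def)
  have sa: "a < s" using initial[OF s(3)] ws s(1) by (cases "a = s") auto
  have int: "y \<in> interior D" using side[OF s(1,2), of y] ws s(3) by auto
  obtain l where l: "l \<le> 0" "has_heat_op w s y l" using sub[OF sa s(2) int ws] by blast
  have hq: "has_heat_op q s y 1"
  proof (rule has_heat_opI[where ?D1.0 = "\<lambda>c h. 2 * (y \<bullet> c) + 2 * h" and ?D2.0 = "\<lambda>_. 2"])
    show "\<forall>\<^sub>F h in nhds 0. ((\<lambda>h. q s (y + h *\<^sub>R c)) has_real_derivative 2 * (y \<bullet> c) + 2 * h) (at h)"
      if "c \<in> Basis" for c
      unfolding q_def power2_norm_eq_inner inner_add_left inner_add_right using that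
      by (auto intro!: derivative_eq_intros always_eventually simp: inner_commute)
    show "((\<lambda>h. 2 * (y \<bullet> c) + 2 * h) has_real_derivative 2) (at 0)" for c
      by (auto intro!: derivative_eq_intros)
    show "((\<lambda>s. q s y) has_real_derivative real DIM('a) + 1) (at s)"
      unfolding q_def by (auto intro!: derivative_eq_intros)
  qed simp
  have "has_heat_op z s y (l - (0 * q s y + \<theta> * 1))"
    unfolding z_def by (rule has_heat_op_diff[OF l(2) has_heat_op_time_mult[OF hq]]) simp
  moreover have "\<forall>\<^sub>F y' in nhds y. z s y' \<le> z s y"
  proof -
    have "open (interior D \<inter> ball 0 R)" "y \<in> interior D \<inter> ball 0 R" using int far[OF s zs] by auto
    then have "\<forall>\<^sub>F y' in nhds y. y' \<in> interior D \<inter> ball 0 R" by (rule eventually_nhds_in_open)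
    then show ?thesis by eventually_elim (use s interior_subset in \<open>auto intro!: max\<close>)
  qed
  moreover have "z r y \<le> z s y" if "a \<le> r" "r \<le> s" for r
    using far[OF s zs] s that by (intro max) auto
  ultimately have "0 \<le> l - (0 * q s y + \<theta> * 1)" using sa by (rule has_heat_op_nonneg_at_max)
  then show False using l(1) \<theta> by simp
qed

lemma DW_evolution_nonneg: "DW_evolution f v \<Longrightarrow> 0 \<le> t \<Longrightarrow> 0 \<le> v t x"
  by (simp add: DW_evolution_def)

lemma DW_evolution_initial: "DW_evolution f v \<Longrightarrow> v 0 x = f x"
  by (simp add: DW_evolution_def)

lemma DW_evolution_bounded:
  assumes "DW_evolution f v"
  obtains C where "0 < C" "\<And>t x. 0 \<le> t \<Longrightarrow> v t x \<le> C"
proof -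
  obtain C where C: "\<And>t x. 0 \<le> t \<Longrightarrow> v t x \<le> C" using assms unfolding DW_evolution_def by blast
  show ?thesis by (rule that[of "max C 1"]) (use C in \<open>auto simp: le_max_iff_disj\<close>)
qed

lemma DW_evolution_continuous:
  "DW_evolution f v \<Longrightarrow> 0 \<le> a \<Longrightarrow> continuous_on ({a..b} \<times> D) (\<lambda>(t, x). v t x)"
  unfolding DW_evolution_def by (elim conjE, erule continuous_on_subset) auto

lemma DW_evolution_continuous_space:
  assumes "DW_evolution f v" "0 \<le> t"
  shows "continuous_on UNIV (v t)"
proof -
  have "continuous_on UNIV ((\<lambda>(t, x). v t x) \<circ> (\<lambda>x. (t, x)))"
    by (rule continuous_on_compose) 
      (auto intro!: continuous_intros continuous_on_subset[OF DW_evolution_continuous[OF assms, of t UNIV]])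
  then show ?thesis by (simp add: o_def)
qed

text \<open>Where \<open>v\<close> exceeds \<open>W \<ge> 0\<close> it also has the larger square, so the quadratic terms have the favourable sign.\<close>

lemma DW_comparison:
  fixes v :: "real \<Rightarrow> 'a::euclidean_space \<Rightarrow> real"
  assumes v: "DW_evolution f v"
    and D: "closed D"
    and cont: "continuous_on ({a..b} \<times> D) (\<lambda>(t, x). W t x)"
    and nonneg: "\<And>t x. a \<le> t \<Longrightarrow> t \<le> b \<Longrightarrow> x \<in> D \<Longrightarrow> 0 \<le> W t x"
    and initial: "\<And>x. x \<in> D \<Longrightarrow> v a x \<le> W a x"
    and side: "\<And>t x. a \<le> t \<Longrightarrow> t \<le> b \<Longrightarrow> x \<in> D - interior D \<Longrightarrow> v t x \<le> W t x"
    and super: "\<And>t x. a < t \<Longrightarrow> t \<le> b \<Longrightarrow> x \<in> interior D \<Longrightarrow>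
                \<exists>l. has_heat_op W t x l \<and> - (W t x)\<^sup>2 \<le> l"
    and tx: "0 \<le> a" "a \<le> t" "t \<le> b" "x \<in> D"
  shows "v t x \<le> W t x"
proof -
  obtain C where C: "0 < C" "\<And>t x. 0 \<le> t \<Longrightarrow> v t x \<le> C" using DW_evolution_bounded[OF v] by blast
  have "v t x - W t x \<le> 0"
  proof (rule parabolic_maximum_principle[of D a b "\<lambda>t x. v t x - W t x" C t x])
    show "continuous_on ({a..b} \<times> D) (\<lambda>(t, x). v t x - W t x)"
      using continuous_on_diff[OF DW_evolution_continuous[OF v tx(1), of b D] cont]
      by (simp add: split_beta)
    show "v t x - W t x \<le> C" if "a \<le> t" "t \<le> b" "x \<in> D" for t x
      using C(2)[of t x] nonneg[OF that] that(1) tx(1) by linarith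
    show "\<exists>l\<le>0. has_heat_op (\<lambda>t x. v t x - W t x) t x l"
      if h: "a < t" "t \<le> b" "x \<in> interior D" "0 < v t x - W t x" for t x
    proof -
      obtain l where l: "has_heat_op W t x l" "- (W t x)\<^sup>2 \<le> l" using super[OF h(1-3)] by blast
      have "x \<in> D" using h(3) interior_subset by blast
      then have "(W t x)\<^sup>2 \<le> (v t x)\<^sup>2" using nonneg[of t x] h by (intro power_mono) auto
      then show ?thesis using has_heat_op_diff[OF DW_evolution_heat_op[OF v, of t x] l(1)] l(2) h tx(1)
        by (intro exI[of _ "- (v t x)\<^sup>2 - l"]) auto
    qed
  qed (use D initial side tx in force)+
  then show ?thesis by simp
qed

lemma DW_evolution_unique:
  fixes v v' :: "real \<Rightarrow> 'a::euclidean_space \<Rightarrow> real"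
  assumes "DW_evolution f v" "DW_evolution f v'" "0 \<le> t"
  shows "v t x = v' t x"
proof -
  have "v t x \<le> v' t x" if v: "DW_evolution f v" "DW_evolution f v'" for v v' :: "real \<Rightarrow> 'a \<Rightarrow> real"
  proof (rule DW_comparison[OF v(1), of UNIV 0 t v'])
    show "\<exists>l. has_heat_op v' s y l \<and> - (v' s y)\<^sup>2 \<le> l" if "0 < s" for s y
      using DW_evolution_heat_op[OF v(2) that] by blast
  qed (use v assms(3) DW_evolution_continuous[OF v(2)] in
        \<open>auto simp: DW_evolution_nonneg DW_evolution_initial\<close>)
  then show ?thesis using assms by (intro antisym) auto
qed

section \<open>Explicit supersolutions of the evolution equation\<close>

text \<open>All space derivatives below are taken of functions of \<open>\<bar>x - c\<bar>\<^sup>2\<close> along coordinate directions, where this is a quadratic polynomial in \<open>h\<close>.\<close>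

lemma power2_norm_add_Basis:
  fixes x c :: "'a::euclidean_space"
  assumes "b \<in> Basis"
  shows "(norm (x + h *\<^sub>R b - c))\<^sup>2 = (norm (x - c))\<^sup>2 + 2 * h * ((x - c) \<bullet> b) + h\<^sup>2"
proof -
  have e: "x + h *\<^sub>R b - c = (x - c) + h *\<^sub>R b" by simp
  show ?thesis unfolding e power2_norm_eq_inner using assms
    by (simp only: inner_add_left inner_add_right inner_scaleR_left inner_scaleR_right
          inner_commute[of b "x - c"] inner_same_Basis power2_eq_square) (simp add: algebra_simps)
qed

lemma has_heat_op_gaussian:
  fixes x c :: "'a::euclidean_space"
  assumes "(\<alpha> has_real_derivative \<alpha>') (at t)" "(\<beta> has_real_derivative \<beta>') (at t)"
  defines "q \<equiv> (norm (x - c))\<^sup>2"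
  shows "has_heat_op (\<lambda>t x. \<alpha> t * exp (- (\<beta> t * (norm (x - c))\<^sup>2))) t x
     ((\<alpha>' - \<alpha> t * \<beta>' * q - 2 * \<alpha> t * (\<beta> t)\<^sup>2 * q + real DIM('a) * \<alpha> t * \<beta> t) * exp (- (\<beta> t * q)))"
proof (rule has_heat_opI[where w' = "(\<alpha>' - \<alpha> t * \<beta>' * q) * exp (- (\<beta> t * q))"
    and ?D1.0 = "\<lambda>b h. - 2 * \<alpha> t * \<beta> t * ((x - c) \<bullet> b + h) * exp (- (\<beta> t * (norm (x + h *\<^sub>R b - c))\<^sup>2))"
    and ?D2.0 = "\<lambda>b. (4 * \<alpha> t * (\<beta> t)\<^sup>2 * ((x - c) \<bullet> b)\<^sup>2 - 2 * \<alpha> t * \<beta> t) * exp (- (\<beta> t * q))"])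
  show "((\<lambda>s. \<alpha> s * exp (- (\<beta> s * (norm (x - c))\<^sup>2))) has_real_derivative (\<alpha>' - \<alpha> t * \<beta>' * q) * exp (- (\<beta> t * q))) (at t)"
    unfolding q_def by (rule derivative_eq_intros assms refl)+ (simp add: algebra_simps)
  note n = power2_norm_add_Basis[of _ x _ c, folded q_def]
  show "\<forall>\<^sub>F h in nhds 0. ((\<lambda>h. \<alpha> t * exp (- (\<beta> t * (norm (x + h *\<^sub>R b - c))\<^sup>2))) has_real_derivative
       - 2 * \<alpha> t * \<beta> t * ((x - c) \<bullet> b + h) * exp (- (\<beta> t * (norm (x + h *\<^sub>R b - c))\<^sup>2))) (at h)"
    if b: "b \<in> Basis" for b
    unfolding n[OF b] by (intro always_eventually allI, (rule derivative_eq_intros refl)+)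
       (simp add: algebra_simps)
  show "((\<lambda>h. - 2 * \<alpha> t * \<beta> t * ((x - c) \<bullet> b + h) * exp (- (\<beta> t * (norm (x + h *\<^sub>R b - c))\<^sup>2))) has_real_derivative
       (4 * \<alpha> t * (\<beta> t)\<^sup>2 * ((x - c) \<bullet> b)\<^sup>2 - 2 * \<alpha> t * \<beta> t) * exp (- (\<beta> t * q))) (at 0)"
    if b: "b \<in> Basis" for b
    unfolding n[OF b] by (rule derivative_eq_intros refl)+ (simp add: algebra_simps power2_eq_square)
  have "(\<Sum>b\<in>Basis. ((x - c) \<bullet> b)\<^sup>2) = q"
    unfolding q_def power2_norm_eq_inner by (subst euclidean_inner) (simp add: power2_eq_square)
  then have "(\<Sum>b\<in>Basis. (4 * \<alpha> t * (\<beta> t)\<^sup>2 * ((x - c) \<bullet> b)\<^sup>2 - 2 * \<alpha> t * \<beta> t) * exp (- (\<beta> t * q)))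
     = (4 * \<alpha> t * (\<beta> t)\<^sup>2 * q - 2 * real DIM('a) * \<alpha> t * \<beta> t) * exp (- (\<beta> t * q))"
    unfolding sum_distrib_right[symmetric] sum_subtractf sum_distrib_left[symmetric] by simp
  then show "(\<alpha>' - \<alpha> t * \<beta>' * q - 2 * \<alpha> t * (\<beta> t)\<^sup>2 * q + real DIM('a) * \<alpha> t * \<beta> t) * exp (- (\<beta> t * q)) =
    (\<alpha>' - \<alpha> t * \<beta>' * q) * exp (- (\<beta> t * q)) -
    (\<Sum>b\<in>Basis. (4 * \<alpha> t * (\<beta> t)\<^sup>2 * ((x - c) \<bullet> b)\<^sup>2 - 2 * \<alpha> t * \<beta> t) * exp (- (\<beta> t * q))) / 2"
    by (simp add: field_simps)
qed

text \<open>The heat kernel, shifted in time; this exact solution serves as supersolution at large distance and at large times.\<close>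

lemma has_heat_op_heat_profile:
  fixes x c :: "'a::euclidean_space"
  assumes t: "0 < t + k"
  shows "has_heat_op (\<lambda>t x. B * (t + k) powr (- real DIM('a) / 2) * exp (- (1 / (2 * (t + k)) * (norm (x - c))\<^sup>2))) t x 0"
proof -
  define d where "d = real DIM('a)"
  define p where "p = (t + k) powr (- d / 2)"
  define q where "q = (norm (x - c))\<^sup>2"
  have "((\<lambda>t. B * (t + k) powr (- d / 2)) has_real_derivative B * (- d / 2 * (p / (t + k)))) (at t)"
    using t by (auto intro!: derivative_eq_intros simp: p_def powr_diff)
  moreover have "((\<lambda>t. 1 / (2 * (t + k))) has_real_derivative - 1 / (2 * (t + k)\<^sup>2)) (at t)"
    using t by (auto intro!: derivative_eq_intros) (simp add: power2_eq_square divide_simps, simp add: algebra_simps)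
  ultimately have "has_heat_op (\<lambda>t x. B * (t + k) powr (- d / 2) * exp (- (1 / (2 * (t + k)) * (norm (x - c))\<^sup>2))) t x
      ((B * (- d / 2 * (p / (t + k))) - B * (t + k) powr (- d / 2) * (- 1 / (2 * (t + k)\<^sup>2)) * q
        - 2 * (B * (t + k) powr (- d / 2)) * (1 / (2 * (t + k)))\<^sup>2 * q
        + d * (B * (t + k) powr (- d / 2)) * (1 / (2 * (t + k)))) * exp (- (1 / (2 * (t + k)) * q)))"
    unfolding d_def q_def by (rule has_heat_op_gaussian)
  also have "B * (- d / 2 * (p / (t + k))) - B * (t + k) powr (- d / 2) * (- 1 / (2 * (t + k)\<^sup>2)) * q
        - 2 * (B * (t + k) powr (- d / 2)) * (1 / (2 * (t + k)))\<^sup>2 * q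
        + d * (B * (t + k) powr (- d / 2)) * (1 / (2 * (t + k))) = 0"
  proof -
    obtain u where u: "u = t + k" by simp
    have p: "u powr - (d / 2) = p" by (simp add: p_def u)
    show ?thesis using t p unfolding p_def[symmetric] u[symmetric]
      by (simp add: divide_simps power2_eq_square)
  qed
  finally show ?thesis by (simp add: d_def)
qed

text \<open>The space-independent solution \<open>1 / (t + 1/C)\<close> dominates every initial value below \<open>C\<close>. The bound does not remember \<open>C\<close>,
  which is why initial values tending to infinity can be handled.\<close>

lemma DW_le_inverse_time:
  fixes v :: "real \<Rightarrow> 'a::euclidean_space \<Rightarrow> real"
  assumes v: "DW_evolution f v" and t: "0 < t"
  shows "v t x \<le> 1 / t"
proof -
  obtain C where C: "0 < C" "\<And>t x. 0 \<le> t \<Longrightarrow> v t x \<le> C" using DW_evolution_bounded[OF v] by blast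
  have "v t x \<le> 1 / (t + 1 / C)"
  proof (rule DW_comparison[OF v, of UNIV 0 t])
    show "continuous_on ({0..t} \<times> UNIV) (\<lambda>(s, x::'a). 1 / (s + 1 / C))"
      unfolding split_beta using C(1) by (intro continuous_intros) (auto simp: add_nonneg_eq_0_iff)
    show "\<exists>l. has_heat_op (\<lambda>s x. 1 / (s + 1 / C)) s x l \<and> - (1 / (s + 1 / C))\<^sup>2 \<le> l" if "0 < s" for s and x :: 'a
    proof -
      have "((\<lambda>s. 1 / (s + 1 / C)) has_real_derivative - (1 / (s + 1 / C))\<^sup>2) (at s)"
        using that C(1) by (auto intro!: derivative_eq_intros simp: power2_eq_square add_nonneg_eq_0_iff)
      then show ?thesis using has_heat_op_time by blast
    qed
  qed (use C t in auto)
  also have "\<dots> \<le> 1 / t" using t C(1) by (intro frac_le) auto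
  finally show ?thesis .
qed

lemma DERIV_divide_power2:
  fixes g :: "real \<Rightarrow> real"
  assumes "(g has_real_derivative g') (at h)" "g h \<noteq> 0"
  shows "((\<lambda>h. K / (g h)\<^sup>2) has_real_derivative - 2 * K * g' / (g h) ^ 3) (at h)"
proof -
  have "((\<lambda>h. K / (g h)\<^sup>2) has_real_derivative
      (0 * (g h)\<^sup>2 - K * (of_nat 2 * (g' * g h ^ (2 - Suc 0)))) / ((g h)\<^sup>2 * (g h)\<^sup>2)) (at h)"
    using assms by (intro DERIV_divide DERIV_power DERIV_const) auto
  moreover have "(0 * (g h)\<^sup>2 - K * (of_nat 2 * (g' * g h ^ (2 - Suc 0)))) / ((g h)\<^sup>2 * (g h)\<^sup>2) = - 2 * K * g' / (g h) ^ 3"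
    using assms(2) by (simp add: power2_eq_square power3_eq_cube mult_ac)
  ultimately show ?thesis by (simp only:)
qed

lemma DERIV_divide_power3:
  fixes g :: "real \<Rightarrow> real"
  assumes "(g has_real_derivative g') (at h)" "(N has_real_derivative N') (at h)" "g h \<noteq> 0"
  shows "((\<lambda>h. N h / (g h) ^ 3) has_real_derivative N' / (g h) ^ 3 - 3 * N h * g' / (g h) ^ 4) (at h)"
proof -
  have "((\<lambda>h. N h / (g h) ^ 3) has_real_derivative
      (N' * (g h) ^ 3 - N h * (of_nat 3 * (g' * g h ^ (3 - Suc 0)))) / ((g h) ^ 3 * (g h) ^ 3)) (at h)"
    using assms by (intro DERIV_divide DERIV_power) auto
  moreover have "(N' * (g h) ^ 3 - N h * (of_nat 3 * (g' * g h ^ (3 - Suc 0)))) / ((g h) ^ 3 * (g h) ^ 3)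
      = N' / (g h) ^ 3 - 3 * N h * g' / (g h) ^ 4"
    using assms(3) by (simp add: field_simps eval_nat_numeral)
  ultimately show ?thesis by (simp only:)
qed

lemma has_heat_op_ball_barrier:
  fixes x c :: "'a::euclidean_space"
  assumes x: "norm (x - c) < 1"
  defines "\<psi> \<equiv> 1 - (norm (x - c))\<^sup>2"
  shows "has_heat_op (\<lambda>t x. K / (1 - (norm (x - c))\<^sup>2)\<^sup>2) t x
     (- 2 * real DIM('a) * K / \<psi> ^ 3 - 12 * K * (norm (x - c))\<^sup>2 / \<psi> ^ 4)"
proof (rule has_heat_opI[where w' = 0
    and ?D1.0 = "\<lambda>b h. 4 * K * ((x - c) \<bullet> b + h) / (1 - (norm (x + h *\<^sub>R b - c))\<^sup>2) ^ 3"
    and ?D2.0 = "\<lambda>b. 4 * K / \<psi> ^ 3 + 24 * K * ((x - c) \<bullet> b)\<^sup>2 / \<psi> ^ 4"])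
  have "(norm (x - c))\<^sup>2 < 1" using x by (simp add: power_less_one_iff abs_square_less_1)
  then have \<psi>: "\<psi> > 0" by (simp add: \<psi>_def)
  have n: "1 - (norm (x + h *\<^sub>R b - c))\<^sup>2 = \<psi> - 2 * h * ((x - c) \<bullet> b) - h\<^sup>2" if "b \<in> Basis" for b h
    using power2_norm_add_Basis[OF that, of x h c] by (simp add: \<psi>_def)
  show "\<forall>\<^sub>F h in nhds 0. ((\<lambda>h. K / (1 - (norm (x + h *\<^sub>R b - c))\<^sup>2)\<^sup>2) has_real_derivative
       4 * K * ((x - c) \<bullet> b + h) / (1 - (norm (x + h *\<^sub>R b - c))\<^sup>2) ^ 3) (at h)"
    if b: "b \<in> Basis" for b
  proof -
    have "((\<lambda>h. \<psi> - 2 * h * ((x - c) \<bullet> b) - h\<^sup>2) \<longlongrightarrow> \<psi> - 2 * 0 * ((x - c) \<bullet> b) - 0\<^sup>2) (nhds 0)"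
      by (intro tendsto_intros filterlim_ident)
    then have "\<forall>\<^sub>F h in nhds 0. 0 < \<psi> - 2 * h * ((x - c) \<bullet> b) - h\<^sup>2"
      using \<psi> by (intro order_tendstoD(1)) auto
    then show ?thesis unfolding n[OF b]
    proof eventually_elim
      case (elim h)
      have "((\<lambda>h. \<psi> - 2 * h * ((x - c) \<bullet> b) - h\<^sup>2) has_real_derivative - 2 * ((x - c) \<bullet> b) - 2 * h) (at h)"
        by (rule derivative_eq_intros refl)+ simp
      from DERIV_divide_power2[OF this, of K] elim show ?case by (simp add: algebra_simps)
    qed
  qed
  show "((\<lambda>h. 4 * K * ((x - c) \<bullet> b + h) / (1 - (norm (x + h *\<^sub>R b - c))\<^sup>2) ^ 3) has_real_derivative
       4 * K / \<psi> ^ 3 + 24 * K * ((x - c) \<bullet> b)\<^sup>2 / \<psi> ^ 4) (at 0)"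
    if b: "b \<in> Basis" for b
  proof -
    have "((\<lambda>h. \<psi> - 2 * h * ((x - c) \<bullet> b) - h\<^sup>2) has_real_derivative - 2 * ((x - c) \<bullet> b) - 2 * 0) (at 0)"
      by (rule derivative_eq_intros refl)+ simp
    moreover have "((\<lambda>h. 4 * K * ((x - c) \<bullet> b + h)) has_real_derivative 4 * K) (at 0)"
      by (rule derivative_eq_intros refl)+ simp
    ultimately have "((\<lambda>h. 4 * K * ((x - c) \<bullet> b + h) / (\<psi> - 2 * h * ((x - c) \<bullet> b) - h\<^sup>2) ^ 3) has_real_derivative
        4 * K / \<psi> ^ 3 - 3 * (4 * K * ((x - c) \<bullet> b)) * (- 2 * ((x - c) \<bullet> b)) / \<psi> ^ 4) (at 0)"
      using DERIV_divide_power3[of "\<lambda>h. \<psi> - 2 * h * ((x - c) \<bullet> b) - h\<^sup>2" "- 2 * ((x - c) \<bullet> b) - 2 * 0" 0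
         "\<lambda>h. 4 * K * ((x - c) \<bullet> b + h)" "4 * K"] \<psi> by simp
    moreover have "4 * K / \<psi> ^ 3 - 3 * (4 * K * ((x - c) \<bullet> b)) * (- 2 * ((x - c) \<bullet> b)) / \<psi> ^ 4
       = 4 * K / \<psi> ^ 3 + 24 * K * ((x - c) \<bullet> b)\<^sup>2 / \<psi> ^ 4"
      by (simp add: power2_eq_square)
    ultimately show ?thesis unfolding n[OF b] by (simp only:)
  qed
  have "(\<Sum>b\<in>Basis. ((x - c) \<bullet> b)\<^sup>2) = (norm (x - c))\<^sup>2"
    unfolding power2_norm_eq_inner by (subst (2) euclidean_inner) (simp add: power2_eq_square)
  then have "(\<Sum>b\<in>Basis. 4 * K / \<psi> ^ 3 + 24 * K * ((x - c) \<bullet> b)\<^sup>2 / \<psi> ^ 4) =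
     real DIM('a) * (4 * K / \<psi> ^ 3) + 24 * K * (norm (x - c))\<^sup>2 / \<psi> ^ 4"
    unfolding sum.distrib sum_divide_distrib[symmetric] sum_distrib_left[symmetric] by simp
  then show "- 2 * real DIM('a) * K / \<psi> ^ 3 - 12 * K * (norm (x - c))\<^sup>2 / \<psi> ^ 4 =
    0 - (\<Sum>b\<in>Basis. 4 * K / \<psi> ^ 3 + 24 * K * ((x - c) \<bullet> b)\<^sup>2 / \<psi> ^ 4) / 2"
    by (simp add: field_simps)
qed simp

text \<open>The stationary function \<open>K / (1 - \<bar>y - x\<bar>\<^sup>2)\<^sup>2\<close> with \<open>K = 2 d + 12\<close> satisfies \<open>\<Delta>\<phi>/2 \<le> \<phi>\<^sup>2\<close> in the unit ball around \<open>x\<close>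
  and is infinite on its boundary, so it dominates every solution that starts from \<open>0\<close> in this ball, whatever happens outside.\<close>

lemma DW_bounded_off_support:
  fixes v :: "real \<Rightarrow> 'a::euclidean_space \<Rightarrow> real"
  assumes v: "DW_evolution f v" and f: "\<And>x. 1 \<le> norm x \<Longrightarrow> f x = 0"
    and t: "0 \<le> t" and x: "2 \<le> norm x"
  shows "v t x \<le> 2 * real DIM('a) + 12"
proof -
  obtain C where C: "0 < C" "\<And>t x. 0 \<le> t \<Longrightarrow> v t x \<le> C" using DW_evolution_bounded[OF v] by blast
  define K where "K = 2 * real DIM('a) + 12"
  \<comment> \<open>A radius below \<open>1\<close> at which the barrier already exceeds the bound \<open>C\<close> of this particular solution.\<close>
  define r where "r = sqrt (1 - 1 / (1 + C))"
  have r2: "r\<^sup>2 = 1 - 1 / (1 + C)" using C(1) unfolding r_def by (subst real_sqrt_pow2) auto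
  have "0 < r\<^sup>2" "r\<^sup>2 < 1" using C(1) unfolding r2 by (auto simp: field_simps)
  moreover have "0 \<le> r" using C(1) by (simp add: r_def)
  ultimately have r: "0 < r" "r < 1" using power2_less_imp_less[of r 1] by (auto simp: less_le)
  have lt1: "(norm (y - x))\<^sup>2 < 1" if "y \<in> cball x r" for y
    using that r by (auto simp: abs_square_less_1 dist_norm norm_minus_commute)
  have K: "K > 0" by (simp add: K_def add_pos_pos)
  have "v t x \<le> K / (1 - (norm (x - x))\<^sup>2)\<^sup>2"
  proof (rule DW_comparison[OF v, of "cball x r" 0 t "\<lambda>t y. K / (1 - (norm (y - x))\<^sup>2)\<^sup>2"])
    show "continuous_on ({0..t} \<times> cball x r) (\<lambda>(t, y). K / (1 - (norm (y - x))\<^sup>2)\<^sup>2)"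
      unfolding split_beta by (intro continuous_intros) (use lt1 in force)
    show "v 0 y \<le> K / (1 - (norm (y - x))\<^sup>2)\<^sup>2" if "y \<in> cball x r" for y
    proof -
      have "norm x \<le> norm y + norm (y - x)" by (metis norm_minus_commute norm_triangle_sub)
      then have "1 \<le> norm y" using that x r(2) by (simp add: dist_norm norm_minus_commute)
      then show ?thesis using K by (simp add: DW_evolution_initial[OF v] f)
    qed
    show "v s y \<le> K / (1 - (norm (y - x))\<^sup>2)\<^sup>2" if "0 \<le> s" "y \<in> cball x r - interior (cball x r)" for s y
    proof -
      have "norm (y - x) = r" using that(2) by (auto simp: interior_cball dist_norm norm_minus_commute)
      then have "K / (1 - (norm (y - x))\<^sup>2)\<^sup>2 = K * (1 + C)\<^sup>2" using C(1) by (simp add: r2 power_divide)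
      also have "\<dots> \<ge> 1 * (1 + C)\<^sup>2" by (intro mult_right_mono) (auto simp: K_def)
      also have "1 * (1 + C)\<^sup>2 \<ge> C" using C(1) by (simp add: power2_eq_square algebra_simps)
      finally show ?thesis using C(2)[OF that(1), of y] by simp
    qed
    show "\<exists>l. has_heat_op (\<lambda>t y. K / (1 - (norm (y - x))\<^sup>2)\<^sup>2) s y l \<and> - (K / (1 - (norm (y - x))\<^sup>2)\<^sup>2)\<^sup>2 \<le> l"
      if "y \<in> interior (cball x r)" for s y
    proof (intro exI conjI)
      define \<psi> where "\<psi> = 1 - (norm (y - x))\<^sup>2"
      have \<psi>: "0 < \<psi>" "\<psi> \<le> 1" using lt1[of y] that interior_subset[of "cball x r"] by (auto simp: \<psi>_def)
      show "has_heat_op (\<lambda>t y. K / (1 - (norm (y - x))\<^sup>2)\<^sup>2) s y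
          (- 2 * real DIM('a) * K / \<psi> ^ 3 - 12 * K * (norm (y - x))\<^sup>2 / \<psi> ^ 4)"
        unfolding \<psi>_def by (rule has_heat_op_ball_barrier)
          (use that interior_subset[of "cball x r"] r in \<open>auto simp: dist_norm norm_minus_commute\<close>)
      have "2 * real DIM('a) * K / \<psi> ^ 3 \<le> 2 * real DIM('a) * K / \<psi> ^ 4"
        using \<psi> K by (intro divide_left_mono power_decreasing) auto
      moreover have "12 * K * (norm (y - x))\<^sup>2 / \<psi> ^ 4 \<le> 12 * K * 1 / \<psi> ^ 4"
        using \<psi> K by (intro divide_right_mono mult_left_mono) (auto simp: \<psi>_def)
      moreover have "2 * real DIM('a) * K / \<psi> ^ 4 + 12 * K * 1 / \<psi> ^ 4 = (K / \<psi>\<^sup>2)\<^sup>2"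
        by (simp add: K_def power_divide add_divide_distrib[symmetric] eval_nat_numeral algebra_simps)
      ultimately show "- (K / (1 - (norm (y - x))\<^sup>2)\<^sup>2)\<^sup>2 \<le> - 2 * real DIM('a) * K / \<psi> ^ 3 - 12 * K * (norm (y - x))\<^sup>2 / \<psi> ^ 4"
        unfolding \<psi>_def[symmetric] by simp
    qed
  qed (use K r t in auto)
  then show ?thesis by (simp add: K_def)
qed

text \<open>The initial layer. Up to radius \<open>2\<close> the bound \<open>1/t\<close> suffices. Outside, the solution starts from \<open>0\<close> and is bounded by \<open>2 d + 12\<close> on the
  sphere of radius \<open>2\<close>, so it stays below a multiple of the heat kernel at time \<open>t + 1\<close>. The constant depends only on the dimension.\<close>

lemma DW_gaussian_bound_at_1:
  obtains A where "0 < A"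
    "\<And>f v (x::'a::euclidean_space). DW_evolution f v \<Longrightarrow> (\<And>x. 1 \<le> norm x \<Longrightarrow> f x = 0) \<Longrightarrow>
       v 1 x \<le> A * exp (- (norm x)\<^sup>2 / 4)"
proof -
  define d where "d = real DIM('a)"
  define A where "A = (2 * d + 12) * 2 powr (d / 2) * exp 2"
  have d: "d \<ge> 1" by (simp add: d_def Suc_leI)
  have A: "0 < A" using d by (simp add: A_def)
  have "v 1 x \<le> A * exp (- (norm x)\<^sup>2 / 4)"
    if v: "DW_evolution f v" and f: "\<And>x. 1 \<le> norm x \<Longrightarrow> f x = 0" for f v and x :: 'a
  proof (cases "norm x \<le> 2")
    case True
    then have n: "(norm x)\<^sup>2 \<le> 2\<^sup>2" by (intro power_mono) auto
    have "v 1 x \<le> 1" using DW_le_inverse_time[OF v, of 1 x] by simp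
    also have "\<dots> \<le> 1 * exp 1 * exp (- (norm x)\<^sup>2 / 4)" using n by (simp flip: exp_add)
    also have "\<dots> \<le> A * exp (- (norm x)\<^sup>2 / 4)"
    proof (intro mult_right_mono)
      have "1 * 1 * exp 1 \<le> (2 * d + 12) * 2 powr (d / 2) * exp 2"
        using d by (intro mult_mono ge_one_powr_ge_zero) auto
      then show "1 * exp 1 \<le> A" by (simp add: A_def)
    qed auto
    finally show ?thesis .
  next
    case False
    define W where "W = (\<lambda>t (x::'a). A * (t + 1) powr (- d / 2) * exp (- (1 / (2 * (t + 1)) * (norm (x - 0))\<^sup>2)))"
    define D where "D = - ball (0::'a) 2"
    have D: "closed D" "\<And>y. y \<in> D \<longleftrightarrow> 2 \<le> norm y" by (auto simp: D_def)
    have edge: "2 * d + 12 \<le> W s y" if "0 \<le> s" "s \<le> 1" "norm y = 2" for s y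
    proof -
      have "2 * d + 12 = A * (2 powr (- d / 2) * exp (- 2))"
        by (simp add: A_def exp_minus powr_minus field_simps)
      also have "\<dots> \<le> A * ((s + 1) powr (- d / 2) * exp (- (1 / (2 * (s + 1)) * (norm (y - 0))\<^sup>2)))"
        using A that d by (intro mult_left_mono mult_mono powr_mono2') (auto simp: field_simps)
      finally show ?thesis by (simp add: W_def)
    qed
    have "v 1 x \<le> W 1 x"
    proof (rule DW_comparison[OF v D(1), of 0 1 W])
      show "continuous_on ({0..1} \<times> D) (\<lambda>(t, x). W t x)"
        unfolding W_def split_beta by (intro continuous_intros) auto
      show "0 \<le> W s y" for s y using A by (simp add: W_def)
      then show "v 0 y \<le> W 0 y" if "y \<in> D" for y
        using that by (simp add: DW_evolution_initial[OF v] f D(2))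
      show "v s y \<le> W s y" if "0 \<le> s" "s \<le> 1" "y \<in> D - interior D" for s y
      proof -
        have "norm y = 2" using that(3) by (auto simp: D_def interior_complement closure_ball)
        then show ?thesis using edge[OF that(1,2), of y] DW_bounded_off_support[OF v f that(1), of y]
          by (simp add: d_def)
      qed
      show "\<exists>l. has_heat_op W s y l \<and> - (W s y)\<^sup>2 \<le> l" if "0 < s" for s y
      proof -
        have "has_heat_op W s y 0" unfolding W_def d_def using that by (intro has_heat_op_heat_profile) simp
        then show ?thesis by force
      qed
    qed (use False in \<open>auto simp: D(2)\<close>)
    also have "W 1 x = A * 2 powr (- d / 2) * exp (- (norm x)\<^sup>2 / 4)" by (simp add: W_def)
    also have "\<dots> \<le> A * 1 * exp (- (norm x)\<^sup>2 / 4)"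
    proof (intro mult_right_mono mult_left_mono)
      show "2 powr (- d / 2) \<le> 1" using d powr_mono[of "- d / 2" 0 2] by simp
    qed (use A in auto)
    finally show ?thesis by simp
  qed
  then show ?thesis using A that by blast
qed

text \<open>Invariance of the equation under translations and under the scaling \<open>r\<^sup>2 v(r\<^sup>2 t, r x)\<close>.\<close>

lemma DW_evolution_affine:
  fixes v :: "real \<Rightarrow> 'a::euclidean_space \<Rightarrow> real" and y :: 'a
  assumes v: "DW_evolution f v" and r: "0 < r"
  shows "DW_evolution (\<lambda>x. r\<^sup>2 * f (r *\<^sub>R x + y)) (\<lambda>t x. r\<^sup>2 * v (r\<^sup>2 * t) (r *\<^sub>R x + y))"
proof -
  obtain C where C: "0 < C" "\<And>t x. 0 \<le> t \<Longrightarrow> v t x \<le> C" using DW_evolution_bounded[OF v] by blast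
  from v have cont: "continuous_on ({0..} \<times> UNIV) (\<lambda>(t, x). v t x)" by (simp add: DW_evolution_def)
  from v obtain D1 D2 :: "real \<Rightarrow> 'a \<Rightarrow> 'a \<Rightarrow> real" where
    c: "\<And>b. b\<in>Basis \<Longrightarrow> continuous_on ({0<..} \<times> UNIV) (\<lambda>(t, x). D1 t x b)"
       "\<And>b. b\<in>Basis \<Longrightarrow> continuous_on ({0<..} \<times> UNIV) (\<lambda>(t, x). D2 t x b)"
    and D: "\<And>t x b. t > 0 \<Longrightarrow> b\<in>Basis \<Longrightarrow> ((\<lambda>h. v t (x + h *\<^sub>R b)) has_real_derivative D1 t x b) (at 0)"
           "\<And>t x b. t > 0 \<Longrightarrow> b\<in>Basis \<Longrightarrow> ((\<lambda>h. D1 t (x + h *\<^sub>R b) b) has_real_derivative D2 t x b) (at 0)"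
    and T: "\<And>t x. t>0 \<Longrightarrow> ((\<lambda>s. v s x) has_real_derivative (1/2 * (\<Sum>b\<in>Basis. D2 t x b) - (v t x)\<^sup>2)) (at t)"
    unfolding DW_evolution_def by blast
  have sc: "continuous_on (S \<times> UNIV) (\<lambda>(t, x::'a). k * g (r\<^sup>2 * t) (r *\<^sub>R x + y))"
    if "continuous_on (S \<times> UNIV) (\<lambda>(t, x). g t x)" "\<And>t. t \<in> S \<Longrightarrow> r\<^sup>2 * t \<in> S" for S k and g :: "real \<Rightarrow> 'a \<Rightarrow> real"
  proof -
    have "continuous_on (S \<times> UNIV) ((\<lambda>(t, x). g t x) \<circ> (\<lambda>(t, x). (r\<^sup>2 * t, r *\<^sub>R x + y)))"
      unfolding split_beta
      by (rule continuous_on_compose) (use that in \<open>auto intro!: continuous_intros continuous_on_subset[OF that(1)[unfolded split_beta]]\<close>)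
    then show ?thesis by (auto simp: split_beta o_def intro!: continuous_intros)
  qed
  have ch: "((\<lambda>h. k * g (r *\<^sub>R (x + h *\<^sub>R b) + y)) has_real_derivative k * (r * g')) (at 0)"
    if "((\<lambda>h. g (r *\<^sub>R x + y + h *\<^sub>R b)) has_real_derivative g') (at 0)" for k g' b x and g :: "'a \<Rightarrow> real"
  proof -
    have "((\<lambda>h. g (r *\<^sub>R x + y + h *\<^sub>R b)) has_real_derivative g') (at (r * 0))" using that by simp
    then have "((\<lambda>h. g (r *\<^sub>R x + y + (r * h) *\<^sub>R b)) has_real_derivative g' * r) (at 0)"
      by (rule DERIV_chain2) (auto intro!: derivative_eq_intros)
    from DERIV_cmult[OF this, of k] show ?thesis by (simp add: scaleR_add_right add_ac mult_ac)
  qed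
  let ?v = "\<lambda>t x. r\<^sup>2 * v (r\<^sup>2 * t) (r *\<^sub>R x + y)"
  let ?D1 = "\<lambda>t x b. r ^ 3 * D1 (r\<^sup>2 * t) (r *\<^sub>R x + y) b" and ?D2 = "\<lambda>t x b. r ^ 4 * D2 (r\<^sup>2 * t) (r *\<^sub>R x + y) b"
  have ex: "(\<forall>b\<in>Basis. continuous_on ({0<..} \<times> UNIV) (\<lambda>(t, x). ?D1 t x b) \<and>
                   continuous_on ({0<..} \<times> UNIV) (\<lambda>(t, x). ?D2 t x b)) \<and>
        (\<forall>t>0. \<forall>x.
           (\<forall>b\<in>Basis.
              ((\<lambda>h. ?v t (x + h *\<^sub>R b)) has_real_derivative ?D1 t x b) (at 0) \<and>
              ((\<lambda>h. ?D1 t (x + h *\<^sub>R b) b) has_real_derivative ?D2 t x b) (at 0)) \<and>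
           ((\<lambda>s. ?v s x) has_real_derivative (1/2 * (\<Sum>b\<in>Basis. ?D2 t x b) - (?v t x)\<^sup>2)) (at t))"
  proof (intro conjI allI impI ballI)
    show "((\<lambda>h. r\<^sup>2 * v (r\<^sup>2 * t) (r *\<^sub>R (x + h *\<^sub>R b) + y)) has_real_derivative r ^ 3 * D1 (r\<^sup>2 * t) (r *\<^sub>R x + y) b) (at 0)"
      if "0 < t" "b \<in> Basis" for t x b
      using ch[OF D(1)[of "r\<^sup>2 * t" b "r *\<^sub>R x + y"], of "r\<^sup>2"] that r by (simp add: eval_nat_numeral mult_ac)
    show "((\<lambda>h. r ^ 3 * D1 (r\<^sup>2 * t) (r *\<^sub>R (x + h *\<^sub>R b) + y) b) has_real_derivative r ^ 4 * D2 (r\<^sup>2 * t) (r *\<^sub>R x + y) b) (at 0)"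
      if "0 < t" "b \<in> Basis" for t x b
      using ch[where g = "\<lambda>y. D1 (r\<^sup>2 * t) y b", OF D(2)[of "r\<^sup>2 * t" b "r *\<^sub>R x + y"], of "r ^ 3"] that r
      by (simp add: eval_nat_numeral mult_ac)
    show "((\<lambda>s. r\<^sup>2 * v (r\<^sup>2 * s) (r *\<^sub>R x + y)) has_real_derivative
        1 / 2 * (\<Sum>b\<in>Basis. r ^ 4 * D2 (r\<^sup>2 * t) (r *\<^sub>R x + y) b) - (r\<^sup>2 * v (r\<^sup>2 * t) (r *\<^sub>R x + y))\<^sup>2) (at t)"
      if "0 < t" for t x
    proof -
      have "((\<lambda>s. v (r\<^sup>2 * s) (r *\<^sub>R x + y)) has_real_derivative
         (1/2 * (\<Sum>b\<in>Basis. D2 (r\<^sup>2 * t) (r *\<^sub>R x + y) b) - (v (r\<^sup>2 * t) (r *\<^sub>R x + y))\<^sup>2) * r\<^sup>2) (at t)"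
        by (rule DERIV_chain2[OF T]) (use that r in \<open>auto intro!: derivative_eq_intros\<close>)
      from DERIV_cmult[OF this, of "r\<^sup>2"] show ?thesis
        by (rule back_subst) (simp add: sum_distrib_left[symmetric] eval_nat_numeral algebra_simps)
    qed
  qed (use r c in \<open>auto intro!: sc\<close>)
  have bd: "\<forall>t\<ge>0. \<forall>x. ?v t x \<le> r\<^sup>2 * C" using C r by auto
  show ?thesis
    unfolding DW_evolution_def
  proof (intro conjI)
    show "continuous_on ({0..} \<times> UNIV) (\<lambda>(t, x). ?v t x)" using cont r by (auto intro!: sc)
  qed ((use bd DW_evolution_nonneg[OF v] DW_evolution_initial[OF v] in auto)[3],
      rule exI[of _ ?D1], rule exI[of _ ?D2], rule ex)
qed

text \<open>The nonlinearity only helps, so a solution stays below the heat flow. For \<open>d \<ge> 3\<close> this has the correct order after scaling; in the plane a logarithm is missing.\<close>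

lemma DW_late_bound_high_dim:
  fixes v :: "real \<Rightarrow> 'a::euclidean_space \<Rightarrow> real"
  assumes v: "DW_evolution f v" and A: "0 < A"
    and v1: "\<And>x. v 1 x \<le> A * exp (- (norm x)\<^sup>2 / 4)" and t: "1 \<le> t"
  shows "v t x \<le> A * 2 powr (real DIM('a) / 2) * t powr (- real DIM('a) / 2) * exp (- (norm x)\<^sup>2 / (8 * t))"
proof -
  define d where "d = real DIM('a)"
  have d: "d \<ge> 1" by (simp add: d_def Suc_leI)
  define B where "B = A * 2 powr (d / 2)"
  have B: "B > 0" using A by (simp add: B_def)
  define W where "W = (\<lambda>t (x::'a). B * (t + 1) powr (- d / 2) * exp (- (1 / (2 * (t + 1)) * (norm (x - 0))\<^sup>2)))"
  have "v t x \<le> W t x"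
  proof (rule DW_comparison[OF v closed_UNIV, of 1 t W])
    show "continuous_on ({1..t} \<times> UNIV) (\<lambda>(t, x). W t x)"
      unfolding W_def split_beta by (intro continuous_intros) auto
    show "0 \<le> W s y" for s y using B by (simp add: W_def)
    have "B * 2 powr (- d / 2) = A" by (simp add: B_def powr_minus)
    then show "v 1 y \<le> W 1 y" for y using v1[of y] by (simp add: W_def)
    show "\<exists>l. has_heat_op W s y l \<and> - (W s y)\<^sup>2 \<le> l" if "1 < s" for s y
    proof -
      have "has_heat_op W s y 0" unfolding W_def d_def using that by (intro has_heat_op_heat_profile) simp
      then show ?thesis by force
    qed
  qed (use t in auto)
  also have "W t x \<le> B * t powr (- d / 2) * exp (- (norm x)\<^sup>2 / (8 * t))"
    unfolding W_def
  proof (intro mult_mono mult_left_mono powr_mono2')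
    have "(norm x)\<^sup>2 * (1 + t) \<le> (norm x)\<^sup>2 * (t * 4)" using t by (intro mult_left_mono) auto
    then show "exp (- (1 / (2 * (t + 1)) * (norm (x - 0))\<^sup>2)) \<le> exp (- (norm x)\<^sup>2 / (8 * t))"
      using t by (simp add: field_simps)
  qed (use d B t in auto)
  finally show ?thesis by (simp add: B_def d_def)
qed

lemma exp_4_bounds: "exp 4 \<le> (65::real)"
proof -
  have "exp (4::real) = exp 1 ^ 4" by (simp flip: exp_of_nat_mult)
  also have "\<dots> \<le> (2.8::real) ^ 4"
    using e_less_272 by (intro power_mono) auto
  also have "\<dots> \<le> 65" by (simp add: eval_nat_numeral)
  finally show ?thesis .
qed

text \<open>The gain of \<open>1 / ln t\<close> comes from the quadratic term: the mass \<open>M\<close> of a spread-out solution satisfies \<open>M' \<approx> - const M\<^sup>2 / t\<close>.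
  The supersolution is a heat profile with amplitude \<open>B / (T ln T)\<close> in which the exponent is also weakened by the factor \<open>1 - 1 / ln T\<close>. With
  \<open>q = \<bar>x\<bar>\<^sup>2 / T\<close>, this profile misses a supersolution of the heat equation by about \<open>2\<close> at the centre (in units of
  \<open>amplitude / (T ln T)\<close>). The weakened exponent repays at least \<open>q/4\<close>, enough when \<open>q > 8\<close>; the quadratic term repays at least \<open>B e\<^bsup>-q/2\<^esup>\<close>,
  enough when \<open>q \<le> 8\<close>.\<close>

lemma DW_late_bound_planar:
  fixes v :: "real \<Rightarrow> 'a::euclidean_space \<Rightarrow> real"
  assumes v: "DW_evolution f v" and d2: "DIM('a) = 2" and A: "0 < A"
    and v1: "\<And>x. v 1 x \<le> A * exp (- (norm x)\<^sup>2 / 4)" and t: "64 \<le> t"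
  shows "v t x \<le> (4 * A + 2) * exp 4 / (ln t * t) * exp (- (norm x)\<^sup>2 / (8 * t))"
proof -
  define B where "B = (4 * A + 2) * exp (4::real)"
  have B: "B > 0" "B \<ge> 2 * exp 4" using A by (auto simp: B_def)
  \<comment> \<open>The time shift makes \<open>ln T \<ge> 4\<close> throughout and widens the profile at time \<open>1\<close> so that it dominates \<open>exp (-\<bar>x\<bar>\<^sup>2 / 4)\<close>.\<close>
  define T where "T = (\<lambda>s::real. s - 1 + exp 4)"
  have e4: "exp (4::real) \<ge> 1" by simp
  have T: "T s \<ge> exp 4" "T s > 0" "T s \<ge> 1" "ln (T s) \<ge> 4" "(T has_real_derivative 1) (at s)" if "1 \<le> s" for s
  proof -
    show 1: "T s \<ge> exp 4" using that by (simp add: T_def)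
    show 2: "T s \<ge> 1" using that by (simp add: T_def add_increasing)
    then show "T s > 0" by simp
    then show "ln (T s) \<ge> 4" using 1 by (simp add: ln_ge_iff)
    show "(T has_real_derivative 1) (at s)" unfolding T_def by (auto intro!: derivative_eq_intros)
  qed
  define W where "W = (\<lambda>t (x::'a). B / (ln (T t) * T t) * exp (- ((1 - 1 / ln (T t)) / (2 * T t) * (norm (x - 0))\<^sup>2)))"
  have "v t x \<le> W t x"
  proof (rule DW_comparison[OF v closed_UNIV, of 1 t W])
    have "continuous_on ({1..t} \<times> UNIV) (\<lambda>p::real \<times> 'a. T (fst p))" unfolding T_def by (intro continuous_intros)
    then show "continuous_on ({1..t} \<times> UNIV) (\<lambda>(t, x). W t x)"
      unfolding W_def split_beta using T(2,4) by (intro continuous_intros) force+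
    show "0 \<le> W s y" if "1 \<le> s" for s y unfolding W_def
      using B(1) T(2,3,4)[OF that] by (intro mult_nonneg_nonneg divide_nonneg_nonneg) simp_all
    show "v 1 y \<le> W 1 y" for y
    proof -
      have "(1 - 1 / 4) / (2 * exp 4) * (norm y)\<^sup>2 \<le> 1 / 4 * (norm y)\<^sup>2" using exp_ge_add_one_self[of 4]
        by (intro mult_right_mono) (auto simp: field_simps)
      moreover have "A \<le> B / (4 * exp 4)" by (simp add: B_def)
      ultimately have "A * exp (- (norm y)\<^sup>2 / 4) \<le> B / (4 * exp 4) * exp (- ((1 - 1 / 4) / (2 * exp 4) * (norm y)\<^sup>2))"
        using A B(1) by (intro mult_mono) auto
      then show ?thesis using v1[of y] by (simp add: W_def T_def)
    qed
    show "\<exists>l. has_heat_op W s y l \<and> - (W s y)\<^sup>2 \<le> l" if "1 < s" for s y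
    proof -
      note T = T[OF less_imp_le[OF that]]
      define \<tau> where "\<tau> = T s"
      define L where "L = ln \<tau>"
      have \<tau>: "\<tau> > 0" and L: "L \<ge> 4" using T by (auto simp: \<tau>_def L_def)
      define n where "n = (norm y)\<^sup>2"
      define a where "a = B / (L * \<tau>)"
      define b where "b = (1 - 1 / L) / (2 * \<tau>)"
      define a' where "a' = - a * (1 + 1 / L) / \<tau>"
      define b' where "b' = 1 / (2 * L\<^sup>2 * \<tau>\<^sup>2) - b / \<tau>"
      have "((\<lambda>s. B / (ln (T s) * T s)) has_real_derivative a') (at s)"
        by (rule derivative_eq_intros T refl | use T(2,4) in force)+
          (use \<tau> L in \<open>simp add: a'_def a_def \<tau>_def[symmetric] L_def[symmetric] divide_simps; simp add: algebra_simps\<close>)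
      moreover have "((\<lambda>s. (1 - 1 / ln (T s)) / (2 * T s)) has_real_derivative b') (at s)"
        by (rule derivative_eq_intros T refl | use T(2,4) in force)+
          (use \<tau> L in \<open>simp add: b'_def b_def \<tau>_def[symmetric] L_def[symmetric] divide_simps power2_eq_square; simp add: algebra_simps\<close>)
      ultimately have h: "has_heat_op W s y ((a' - a * b' * n - 2 * a * b\<^sup>2 * n + 2 * a * b) * exp (- (b * n)))"
        using has_heat_op_gaussian[of "\<lambda>s. B / (ln (T s) * T s)" a' s "\<lambda>s. (1 - 1 / ln (T s)) / (2 * T s)" b' 0 y]
        by (simp add: W_def d2 a_def b_def n_def \<tau>_def L_def)
      define E where "E = exp (- (b * n))"
      have W: "W s y = a * E" by (simp add: W_def a_def b_def n_def \<tau>_def L_def E_def)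
      have a: "a > 0" using B \<tau> L by (simp add: a_def)
      define q where "q = n / \<tau>"
      have q: "q \<ge> 0" using \<tau> by (simp add: q_def n_def)
      have "- (a' - a * b' * n - 2 * a * b\<^sup>2 * n + 2 * a * b) = a / (\<tau> * L) * (2 - q / 2 * (1 - 2 / L))"
        using \<tau> L by (simp add: a'_def b'_def b_def q_def divide_simps power2_eq_square) algebra
      also have "\<dots> \<le> a / (\<tau> * L) * (2 - q / 4)"
      proof (intro mult_left_mono)
        have "q / 2 * (1 / 2) \<le> q / 2 * (1 - 2 / L)" using q L by (intro mult_left_mono) (auto simp: field_simps)
        then show "2 - q / 2 * (1 - 2 / L) \<le> 2 - q / 4" by simp
      qed (use a \<tau> L in auto)
      also have "\<dots> \<le> a / (\<tau> * L) * (B * E)"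
      proof (intro mult_left_mono)
        show "2 - q / 4 \<le> B * E"
        proof (cases "q \<le> 8")
          case True
          have "b * n = (1 - 1 / L) * q / 2" using \<tau> by (simp add: b_def q_def)
          also have "\<dots> \<le> 1 * q / 2" using q L by (intro divide_right_mono mult_right_mono) auto
          finally have "exp (- 4) \<le> E" using True by (simp add: E_def)
          then have "2 * exp 4 * exp (- 4) \<le> B * E" using B by (intro mult_mono) auto
          moreover have "exp 4 * exp (- 4) = (1::real)" by (simp flip: exp_add)
          ultimately show ?thesis using q by (simp add: mult.assoc)
        next
          case False
          then have "2 - q / 4 \<le> 0" by simp
          also have "0 \<le> B * E" using B by (simp add: E_def)
          finally show ?thesis .
        qed
      qed (use a \<tau> L in auto)
      also have "\<dots> = a\<^sup>2 * E" by (simp add: a_def power2_eq_square mult_ac)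
      finally have "- (a' - a * b' * n - 2 * a * b\<^sup>2 * n + 2 * a * b) * E \<le> a\<^sup>2 * E * E"
        by (intro mult_right_mono) (auto simp: E_def)
      then have "- (W s y)\<^sup>2 \<le> (a' - a * b' * n - 2 * a * b\<^sup>2 * n + 2 * a * b) * E"
        unfolding W power_mult_distrib mult_minus_left by (simp add: power2_eq_square mult.assoc)
      then show ?thesis using h unfolding E_def[symmetric] by blast
    qed
  qed (use t in auto)
  also have "W t x \<le> B / (ln t * t) * exp (- (norm x)\<^sup>2 / (8 * t))"
    unfolding W_def
  proof (intro mult_mono)
    have Tt: "t \<le> T t" "T t \<le> 2 * t" using t e4 exp_4_bounds by (auto simp: T_def)
    then show "B / (ln (T t) * T t) \<le> B / (ln t * t)"
      using t B(1) by (intro divide_left_mono mult_mono) (auto intro!: mult_pos_pos)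
    have l: "ln (T t) \<ge> 4" using T(4) t by simp
    have "(norm x)\<^sup>2 / (8 * t) = (1 / 2) / (2 * (2 * t)) * (norm x)\<^sup>2" by simp
    also have "\<dots> \<le> (1 - 1 / ln (T t)) / (2 * T t) * (norm x)\<^sup>2"
      using Tt t l by (intro mult_right_mono frac_le) (auto simp: field_simps)
    finally show "exp (- ((1 - 1 / ln (T t)) / (2 * T t) * (norm (x - 0))\<^sup>2)) \<le> exp (- (norm x)\<^sup>2 / (8 * t))" by simp
  qed (use B t in auto)
  finally show ?thesis by (simp add: B_def)
qed

definition hit_rate :: "nat \<Rightarrow> real \<Rightarrow> real" where
  "hit_rate d \<epsilon> = (if d = 2 then \<bar>ln \<epsilon>\<bar> else \<epsilon> powr (2 - real d))"

text \<open>Scaling turns initial values supported in the ball of radius \<open>\<epsilon>\<close> into ones supported in the unit ball, and time \<open>t\<close> into \<open>T = t / \<epsilon>\<^sup>2 \<ge> 64\<close>.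
  In the plane, \<open>\<epsilon> \<le> t\<close> gives \<open>T \<ge> 1/\<epsilon>\<close>, so the factor \<open>1 / ln T\<close> is at most \<open>1 / \<bar>ln \<epsilon>\<bar>\<close>.\<close>

lemma DW_upper_bound:
  assumes d: "2 \<le> DIM('a)"
  obtains A where "0 < A"
    "\<And>f v \<epsilon> t (x::'a::euclidean_space). DW_evolution f v \<Longrightarrow> (\<And>x. \<epsilon> \<le> norm x \<Longrightarrow> f x = 0) \<Longrightarrow>
       0 < \<epsilon> \<Longrightarrow> \<epsilon> < 1 \<Longrightarrow> \<epsilon> \<le> t \<Longrightarrow> 64 * \<epsilon>\<^sup>2 \<le> t \<Longrightarrow>
       hit_rate DIM('a) \<epsilon> * v t x \<le> A * t powr (- real DIM('a) / 2) * exp (- (norm x)\<^sup>2 / (8 * t))"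
proof -
  obtain A0 where A0: "0 < A0"
    "\<And>f v (x::'a). DW_evolution f v \<Longrightarrow> (\<And>x. 1 \<le> norm x \<Longrightarrow> f x = 0) \<Longrightarrow> v 1 x \<le> A0 * exp (- (norm x)\<^sup>2 / 4)"
    using DW_gaussian_bound_at_1 by blast
  define \<delta> where "\<delta> = real DIM('a)"
  define A where "A = max (A0 * 2 powr (\<delta> / 2)) ((4 * A0 + 2) * exp 4)"
  have A: "A > 0" using A0(1) by (simp add: A_def less_max_iff_disj)
  show ?thesis
  proof (rule that[OF A])
    fix f :: "'a \<Rightarrow> real" and v \<epsilon> t and x :: 'a
    assume v: "DW_evolution f v" and f: "\<And>x. \<epsilon> \<le> norm x \<Longrightarrow> f x = 0"
      and e: "0 < \<epsilon>" "\<epsilon> < 1" "\<epsilon> \<le> t" "64 * \<epsilon>\<^sup>2 \<le> t"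
    define v1 where "v1 = (\<lambda>t x. \<epsilon>\<^sup>2 * v (\<epsilon>\<^sup>2 * t) (\<epsilon> *\<^sub>R x))"
    define T where "T = t / \<epsilon>\<^sup>2"
    define y where "y = x /\<^sub>R \<epsilon>"
    have DW1: "DW_evolution (\<lambda>x. \<epsilon>\<^sup>2 * f (\<epsilon> *\<^sub>R x)) v1" unfolding v1_def using DW_evolution_affine[OF v e(1), of 0] by simp
    have b1: "v1 1 x \<le> A0 * exp (- (norm x)\<^sup>2 / 4)" for x
      by (rule A0(2)[OF DW1]) (use f e in auto)
    have T: "64 \<le> T" using e by (simp add: T_def field_simps)
    have t0: "0 < t" using e by simp
    have e2: "0 < \<epsilon>\<^sup>2" using e(1) by simp
    have vT: "v t x = v1 T y / \<epsilon>\<^sup>2" using e by (simp add: v1_def T_def y_def)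
    have ex: "exp (- (norm y)\<^sup>2 / (8 * T)) = exp (- (norm x)\<^sup>2 / (8 * t))"
      using e by (simp add: y_def T_def power_divide field_simps)
    show "hit_rate DIM('a) \<epsilon> * v t x \<le> A * t powr (- real DIM('a) / 2) * exp (- (norm x)\<^sup>2 / (8 * t))"
    proof (cases "DIM('a) = 2")
      case True
      have l: "\<bar>ln \<epsilon>\<bar> \<le> ln T"
      proof -
        have "1 / \<epsilon> = \<epsilon> / \<epsilon>\<^sup>2" by (simp add: power2_eq_square)
        also have "\<dots> \<le> T" unfolding T_def using e by (intro divide_right_mono) auto
        finally have "1 / \<epsilon> \<le> T" .
        then have "ln (1 / \<epsilon>) \<le> ln T" using e by (intro ln_mono) auto
        then show ?thesis using e by (simp add: ln_div)
      qed
      have lp: "ln T > 0" using T by simp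
      have "v1 T y \<le> (4 * A0 + 2) * exp 4 / (ln T * T) * exp (- (norm y)\<^sup>2 / (8 * T))"
        by (rule DW_late_bound_planar[OF DW1 True A0(1) b1 T])
      also have "\<dots> \<le> A / (ln T * T) * exp (- (norm y)\<^sup>2 / (8 * T))"
        using lp T by (intro mult_right_mono divide_right_mono) (auto simp: A_def)
      finally have "v t x \<le> A / (ln T * T) * exp (- (norm y)\<^sup>2 / (8 * T)) / \<epsilon>\<^sup>2"
        unfolding vT using e2 by (intro divide_right_mono) auto
      also have "\<dots> = A / t * exp (- (norm x)\<^sup>2 / (8 * t)) / ln T"
        unfolding ex using e2 t0 by (simp add: T_def)
      finally have "\<bar>ln \<epsilon>\<bar> * v t x \<le> ln T * (A / t * exp (- (norm x)\<^sup>2 / (8 * t)) / ln T)"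
        using l lp DW_evolution_nonneg[OF v, of t x] t0 by (intro mult_mono) auto
      also have "\<dots> = A / t * exp (- (norm x)\<^sup>2 / (8 * t))" using lp by simp
      also have "A / t = A * t powr (- real DIM('a) / 2)" using True t0 by (simp add: powr_minus_divide)
      finally show ?thesis using True by (simp add: hit_rate_def)
    next
      case False
      have "v1 T y \<le> A0 * 2 powr (\<delta> / 2) * T powr (- \<delta> / 2) * exp (- (norm y)\<^sup>2 / (8 * T))"
        unfolding \<delta>_def by (rule DW_late_bound_high_dim[OF DW1 A0(1) b1]) (use T in simp)
      also have "\<dots> \<le> A * T powr (- \<delta> / 2) * exp (- (norm y)\<^sup>2 / (8 * T))"
        by (intro mult_right_mono) (auto simp: A_def)
      finally have "v t x \<le> A * T powr (- \<delta> / 2) * exp (- (norm y)\<^sup>2 / (8 * T)) / \<epsilon>\<^sup>2"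
        unfolding vT using e2 by (intro divide_right_mono) auto
      also have "\<dots> = A * t powr (- \<delta> / 2) * exp (- (norm x)\<^sup>2 / (8 * t)) / \<epsilon> powr (2 - \<delta>)"
      proof -
        have e2p: "\<epsilon>\<^sup>2 = \<epsilon> powr 2" using e by simp
        have "T powr (- \<delta> / 2) = t powr (- \<delta> / 2) / \<epsilon> powr (- \<delta>)"
          using e t0 unfolding T_def e2p by (simp add: powr_divide powr_powr del: powr_numeral)
        moreover have "\<epsilon> powr (- \<delta>) * \<epsilon>\<^sup>2 = \<epsilon> powr (2 - \<delta>)"
          unfolding e2p by (simp add: powr_add[symmetric] del: powr_numeral)
        ultimately show ?thesis unfolding ex by simp
      qed
      finally have "\<epsilon> powr (2 - \<delta>) * v t x \<le> A * t powr (- \<delta> / 2) * exp (- (norm x)\<^sup>2 / (8 * t))"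
        using e by (simp add: field_simps)
      then show ?thesis using False by (simp add: hit_rate_def \<delta>_def)
    qed
  qed
qed

section \<open>The heat semigroup\<close>

lemma nn_integral_lborel_affine:
  fixes x :: "'a::euclidean_space"
  assumes [measurable]: "f \<in> borel_measurable borel" and c: "c \<noteq> 0"
  shows "(\<integral>\<^sup>+y. f y \<partial>lborel) = ennreal (\<bar>c\<bar> ^ DIM('a)) * (\<integral>\<^sup>+y. f (x + c *\<^sub>R y) \<partial>lborel)"
  by (subst lborel_affine[OF c, of x]) (simp add: nn_integral_density nn_integral_distr nn_integral_cmult)

lemma integral_lborel_affine:
  fixes x :: "'a::euclidean_space" and f :: "'a \<Rightarrow> real"
  assumes [measurable]: "f \<in> borel_measurable borel" and c: "c \<noteq> 0"
  shows "(\<integral>y. f y \<partial>lborel) = \<bar>c\<bar> ^ DIM('a) * (\<integral>y. f (x + c *\<^sub>R y) \<partial>lborel)"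
  by (subst lborel_affine[OF c, of x]) (simp add: integral_density integral_distr)

lemma heat_kernel_nonneg[simp]: "0 \<le> heat_kernel t x"
  by (simp add: heat_kernel_def)

lemma heat_kernel_le: "0 < t \<Longrightarrow> heat_kernel t x \<le> (2 * pi * t) powr (- real DIM('a) / 2)" for x :: "'a::euclidean_space"
  by (simp add: heat_kernel_def mult_left_le)

lemma heat_kernel_minus_commute: "heat_kernel t (x - y) = heat_kernel t (y - x)"
  by (simp add: heat_kernel_def norm_minus_commute)

lemma heat_kernel_uminus[simp]: "heat_kernel t (- x) = heat_kernel t x"
  by (simp add: heat_kernel_def)

lemma heat_kernel_measurable[measurable]: "heat_kernel t \<in> borel_measurable borel"
  unfolding heat_kernel_def by measurable

lemma heat_kernel_profile:
  "0 < t \<Longrightarrow> heat_kernel t x = (2 * pi) powr (- real DIM('a) / 2) * t powr (- real DIM('a) / 2) * exp (- (1 / (2 * t) * (norm x)\<^sup>2))"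
  for x :: "'a::euclidean_space"
  by (simp add: heat_kernel_def powr_mult)

lemma nn_integral_heat_kernel:
  fixes x :: "'a::euclidean_space"
  assumes t: "0 < t"
  shows "(\<integral>\<^sup>+y. ennreal (heat_kernel t (x - y)) \<partial>lborel) = 1"
proof -
  have "heat_kernel t y = (\<Prod>b\<in>Basis. normal_density 0 (sqrt t) (y \<bullet> b))" for y :: 'a
  proof -
    have "(norm y)\<^sup>2 = (\<Sum>b\<in>Basis. (y \<bullet> b)\<^sup>2)"
      unfolding power2_norm_eq_inner by (subst euclidean_inner) (simp add: power2_eq_square)
    then have "exp (- (norm y)\<^sup>2 / (2 * t)) = (\<Prod>b\<in>Basis. exp (- (y \<bullet> b)\<^sup>2 / (2 * t)))"
      by (simp add: exp_sum[symmetric] sum_negf sum_divide_distrib)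
    moreover have "(2 * pi * t) powr (- real DIM('a) / 2) = (\<Prod>b\<in>(Basis::'a set). 1 / sqrt (2 * pi * t))"
    proof -
      define c where "c = 2 * pi * t"
      have c: "c > 0" using t by (simp add: c_def)
      have "c powr (- real DIM('a) / 2) = (c powr (- 1 / 2)) powr real DIM('a)" by (simp add: powr_powr)
      also have "c powr (- 1 / 2) = 1 / sqrt c"
        using c powr_minus_divide[of c "1 / 2"] by (simp add: powr_half_sqrt)
      also have "(1 / sqrt c) powr real DIM('a) = (1 / sqrt c) ^ DIM('a)" using c by (intro powr_realpow) simp
      finally show ?thesis by (simp add: c_def[symmetric])
    qed
    ultimately have "heat_kernel t y = (\<Prod>b\<in>(Basis::'a set). 1 / sqrt (2 * pi * t)) * (\<Prod>b\<in>Basis. exp (- (y \<bullet> b)\<^sup>2 / (2 * t)))"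
      by (simp only: heat_kernel_def)
    also have "\<dots> = (\<Prod>b\<in>Basis. 1 / sqrt (2 * pi * t) * exp (- (y \<bullet> b)\<^sup>2 / (2 * t)))"
      by (rule prod.distrib[symmetric])
    also have "\<dots> = (\<Prod>b\<in>Basis. normal_density 0 (sqrt t) (y \<bullet> b))"
      using t by (intro prod.cong) (auto simp: normal_density_def)
    finally show ?thesis .
  qed
  then have "(\<integral>\<^sup>+y. ennreal (heat_kernel t y) \<partial>(lborel :: 'a measure))
      = (\<integral>\<^sup>+y. (\<Prod>b\<in>Basis. ennreal (normal_density 0 (sqrt t) (y \<bullet> b))) \<partial>(lborel :: 'a measure))"
    by (simp add: prod_ennreal)
  also have "\<dots> = (\<Prod>b\<in>(Basis::'a set). \<integral>\<^sup>+u. ennreal (normal_density 0 (sqrt t) u) \<partial>lborel)"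
    by (rule nn_integral_lborel_prod) auto
  also have "\<dots> = 1"
    using t by (simp add: nn_integral_eq_integral)
  finally show ?thesis
    by (subst (asm) nn_integral_lborel_affine[where c = "- 1" and x = x]) auto
qed

lemma
  fixes x :: "'a::euclidean_space"
  assumes t: "0 < t"
  shows integrable_heat_kernel: "integrable lborel (\<lambda>y. heat_kernel t (x - y))"
    and integral_heat_kernel: "(\<integral>y. heat_kernel t (x - y) \<partial>lborel) = 1"
proof -
  have "has_bochner_integral lborel (\<lambda>y. heat_kernel t (x - y)) 1"
    by (rule has_bochner_integral_nn_integral) (use nn_integral_heat_kernel[OF t, of x] heat_kernel_nonneg in auto)
  then show "integrable lborel (\<lambda>y. heat_kernel t (x - y))" "(\<integral>y. heat_kernel t (x - y) \<partial>lborel) = 1"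
    by (auto simp: has_bochner_integral_iff)
qed

lemma integrable_heat_kernel_times:
  fixes x :: "'a::euclidean_space" and g :: "'a \<Rightarrow> real"
  assumes t: "0 < t" and [measurable]: "g \<in> borel_measurable borel" and g: "\<And>y. \<bar>g y\<bar> \<le> C"
  shows "integrable lborel (\<lambda>y. heat_kernel t (x - y) * g y)"
proof (rule Bochner_Integration.integrable_bound[of _ "\<lambda>y. C * heat_kernel t (x - y)"])
  show "AE y in lborel. norm (heat_kernel t (x - y) * g y) \<le> norm (C * heat_kernel t (x - y))"
    using order_trans[OF g abs_ge_self] by (auto simp: abs_mult mult.commute intro!: mult_right_mono)
qed (use integrable_heat_kernel[OF t] in auto)

lemma DERIV_heat_kernel_time:
  fixes z :: "'a::euclidean_space"
  assumes "0 < s"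
  shows "((\<lambda>s. heat_kernel s z) has_real_derivative
    heat_kernel s z * ((norm z)\<^sup>2 / (2 * s\<^sup>2) - real DIM('a) / (2 * s))) (at s)"
proof -
  have "((\<lambda>s. (2 * pi) powr (- real DIM('a) / 2) * s powr (- real DIM('a) / 2) * exp (- (1 / (2 * s) * (norm z)\<^sup>2)))
      has_real_derivative heat_kernel s z * ((norm z)\<^sup>2 / (2 * s\<^sup>2) - real DIM('a) / (2 * s))) (at s)"
    using assms
    apply (auto intro!: derivative_eq_intros simp: heat_kernel_profile powr_diff)
    apply (simp add: field_simps power2_eq_square)
    done
  moreover have "\<forall>\<^sub>F s in nhds s. (0::real) < s"
    using assms by (intro order_tendstoD(1)[OF filterlim_ident])
  then have "\<forall>\<^sub>F s in nhds s. heat_kernel s z =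
     (2 * pi) powr (- real DIM('a) / 2) * s powr (- real DIM('a) / 2) * exp (- (1 / (2 * s) * (norm z)\<^sup>2))"
    by eventually_elim (rule heat_kernel_profile)
  ultimately show ?thesis by (simp add: DERIV_cong_ev[OF refl _ refl])
qed

lemma DERIV_heat_kernel_space:
  fixes z :: "'a::euclidean_space"
  assumes "0 < s" "b \<in> Basis"
  shows "((\<lambda>h. heat_kernel s (z + h *\<^sub>R b)) has_real_derivative
      - ((z + h *\<^sub>R b) \<bullet> b) / s * heat_kernel s (z + h *\<^sub>R b)) (at h)"
proof -
  have n: "(norm (z + h *\<^sub>R b))\<^sup>2 = (norm z)\<^sup>2 + 2 * h * (z \<bullet> b) + h\<^sup>2" for h
    using power2_norm_add_Basis[OF assms(2), of z h 0] by simp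
  have e: "(z + h *\<^sub>R b) \<bullet> b = z \<bullet> b + h" using assms(2) by (simp add: inner_add_left)
  show ?thesis unfolding heat_kernel_def n e
    using assms(1) by (auto intro!: derivative_eq_intros) (simp add: field_simps)
qed

lemma DERIV2_heat_kernel_space:
  fixes z :: "'a::euclidean_space"
  assumes "0 < s" "b \<in> Basis"
  shows "((\<lambda>h. - ((z + h *\<^sub>R b) \<bullet> b) / s * heat_kernel s (z + h *\<^sub>R b)) has_real_derivative
      (((z + h *\<^sub>R b) \<bullet> b)\<^sup>2 / s\<^sup>2 - 1 / s) * heat_kernel s (z + h *\<^sub>R b)) (at h)"
proof -
  have "((\<lambda>h. - ((z + h *\<^sub>R b) \<bullet> b) / s) has_real_derivative - 1 / s) (at h)"
    using assms by (auto intro!: derivative_eq_intros simp: inner_add_left)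
  from DERIV_mult[OF this DERIV_heat_kernel_space[OF assms]] show ?thesis
    by (rule back_subst) (simp add: field_simps power2_eq_square)
qed

text \<open>The heat kernel solves the heat equation.\<close>

lemma heat_op_integrand:
  fixes z :: "'a::euclidean_space"
  assumes "0 < s"
  shows "heat_kernel s z * ((norm z)\<^sup>2 / (2 * s\<^sup>2) - real DIM('a) / (2 * s))
     = (\<Sum>b\<in>Basis. ((z \<bullet> b)\<^sup>2 / s\<^sup>2 - 1 / s) * heat_kernel s z) / 2"
proof -
  have "(norm z)\<^sup>2 = (\<Sum>b\<in>Basis. (z \<bullet> b)\<^sup>2)"
    unfolding power2_norm_eq_inner by (subst euclidean_inner) (simp add: power2_eq_square)
  then have e: "(\<Sum>b\<in>Basis. ((z \<bullet> b)\<^sup>2 / s\<^sup>2 - 1 / s)) = (norm z)\<^sup>2 / s\<^sup>2 - real DIM('a) / s"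
    by (simp add: sum_subtractf sum_divide_distrib)
  show ?thesis unfolding sum_distrib_right[symmetric] e using assms by (simp add: field_simps)
qed

text \<open>For compactly supported \<open>g\<close> the integral extends over a box, where differentiation under the integral sign needs only continuity.\<close>

lemma has_heat_op_heat_flow:
  fixes g :: "'a::euclidean_space \<Rightarrow> real"
  assumes g: "continuous_on UNIV g" "\<And>x. R < norm x \<Longrightarrow> g x = 0" and t: "0 < t"
  shows "has_heat_op (\<lambda>t x. \<integral>y. heat_kernel t (x - y) * g y \<partial>lborel) t x 0"
proof -
  obtain a b :: 'a where ab: "cball 0 R \<subseteq> cbox a b"
    using bounded_subset_cbox_symmetric[OF bounded_cball] by blast
  have off: "g y = 0" if "y \<notin> cbox a b" for y using that ab g(2)[of y] by force
  have contk: "continuous_on ({0<..} \<times> UNIV) (\<lambda>p. heat_kernel (fst p) (snd p :: 'a))"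
    unfolding heat_kernel_def by (intro continuous_intros) auto
  have K: "continuous_on S (\<lambda>p. heat_kernel (k p) (l p :: 'a))"
    if "continuous_on S k" "continuous_on S l" "\<And>p. p \<in> S \<Longrightarrow> 0 < k p" for S :: "('c::topological_space) set" and k l
    using that continuous_on_compose2[OF contk, of S "\<lambda>p. (k p, l p)"] by (auto intro!: continuous_intros)
  have gc: "continuous_on S (\<lambda>p. g (l p))" if "continuous_on S l" for S :: "('c::topological_space) set" and l
    using that continuous_on_compose2[OF g(1)] by auto
  have eq: "(\<integral>y. heat_kernel s (x - y) * g y \<partial>lborel) = integral (cbox a b) (\<lambda>y. heat_kernel s (x - y) * g y)"
    if "0 < s" for s x
  proof -
    have "continuous_on (cbox a b) (\<lambda>y. heat_kernel s (x - y) * g y)"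
      using that by (intro continuous_intros K gc) auto
    then have "set_integrable lborel (cbox a b) (\<lambda>y. heat_kernel s (x - y) * g y)"
      unfolding set_integrable_def by (intro borel_integrable_compact compact_cbox)
    moreover have "(\<lambda>y. indicator (cbox a b) y *\<^sub>R (heat_kernel s (x - y) * g y)) = (\<lambda>y. heat_kernel s (x - y) * g y)"
      using off by (auto simp: fun_eq_iff indicator_def)
    ultimately show ?thesis
      using set_borel_integral_eq_integral(2)[of "cbox a b" "\<lambda>y. heat_kernel s (x - y) * g y"]
      by (simp add: set_lebesgue_integral_def)
  qed
  have int: "(\<lambda>y. h y) integrable_on cbox a b" if "continuous_on (cbox a b) h" for h :: "'a \<Rightarrow> real"
    using that by (rule integrable_continuous)
  have tk: "\<forall>\<^sub>F s in nhds t. 0 < s" using t by (intro order_tendstoD(1)[OF filterlim_ident])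
  define I where "I = (\<lambda>s x. integral (cbox a b) (\<lambda>y. heat_kernel s (x - y) * g y))"
  define w' where "w' = integral (cbox a b) (\<lambda>y. heat_kernel t (x - y) * ((norm (x - y))\<^sup>2 / (2 * t\<^sup>2) - real DIM('a) / (2 * t)) * g y)"
  define D1 where "D1 = (\<lambda>c h. integral (cbox a b) (\<lambda>y. - ((x - y + h *\<^sub>R c) \<bullet> c) / t * heat_kernel t (x - y + h *\<^sub>R c) * g y))"
  define D2 where "D2 = (\<lambda>c. integral (cbox a b) (\<lambda>y. (((x - y) \<bullet> c)\<^sup>2 / t\<^sup>2 - 1 / t) * heat_kernel t (x - y) * g y))"
  show ?thesis
  proof (rule has_heat_opI)
    have "((\<lambda>s. I s x) has_real_derivative w') (at t within {0<..})"
      unfolding I_def w'_def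
    proof (rule leibniz_rule_field_derivative)
      show "((\<lambda>s. heat_kernel s (x - y) * g y) has_real_derivative
          heat_kernel s (x - y) * ((norm (x - y))\<^sup>2 / (2 * s\<^sup>2) - real DIM('a) / (2 * s)) * g y) (at s within {0<..})"
        if "s \<in> {0<..}" for s y
        using that by (intro DERIV_cmult_right has_field_derivative_at_within[OF DERIV_heat_kernel_time]) auto
      show "(\<lambda>y. heat_kernel s (x - y) * g y) integrable_on cbox a b" if "s \<in> {0<..}" for s
        using that by (intro int continuous_intros K gc) auto
      show "continuous_on ({0<..} \<times> cbox a b) (\<lambda>(s, y). heat_kernel s (x - y) * ((norm (x - y))\<^sup>2 / (2 * s\<^sup>2) - real DIM('a) / (2 * s)) * g y)"
        unfolding split_beta by (intro continuous_intros K gc) auto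
    qed (use t in auto)
    then have "((\<lambda>s. I s x) has_real_derivative w') (at t)"
      using t at_within_open[of t "{0<..}"] by simp
    moreover have "\<forall>\<^sub>F s in nhds t. (\<integral>y. heat_kernel s (x - y) * g y \<partial>lborel) = I s x"
      using tk by eventually_elim (simp add: eq I_def)
    ultimately show "((\<lambda>s. \<integral>y. heat_kernel s (x - y) * g y \<partial>lborel) has_real_derivative w') (at t)"
      by (simp add: DERIV_cong_ev[OF refl _ refl])
    show "\<forall>\<^sub>F h in nhds 0. ((\<lambda>h. \<integral>y. heat_kernel t (x + h *\<^sub>R c - y) * g y \<partial>lborel) has_real_derivative D1 c h) (at h)"
      if c: "c \<in> Basis" for c
    proof (intro always_eventually allI)
      fix h :: real
      have e: "x + h *\<^sub>R c - y = x - y + h *\<^sub>R c" for h y by simp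
      have "(\<integral>y. heat_kernel t (x + h *\<^sub>R c - y) * g y \<partial>lborel) =
          integral (cbox a b) (\<lambda>y. heat_kernel t (x - y + h *\<^sub>R c) * g y)" for h unfolding eq[OF t] by (simp only: e)
      moreover have "((\<lambda>h. integral (cbox a b) (\<lambda>y. heat_kernel t (x - y + h *\<^sub>R c) * g y)) has_real_derivative D1 c h) (at h within UNIV)"
        unfolding D1_def
      proof (rule leibniz_rule_field_derivative)
        show "((\<lambda>h. heat_kernel t (x - y + h *\<^sub>R c) * g y) has_real_derivative
            - ((x - y + h *\<^sub>R c) \<bullet> c) / t * heat_kernel t (x - y + h *\<^sub>R c) * g y) (at h within UNIV)" for h y
          by (intro DERIV_cmult_right DERIV_heat_kernel_space t c)
        show "(\<lambda>y. heat_kernel t (x - y + h *\<^sub>R c) * g y) integrable_on cbox a b" for h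
          using t by (intro int continuous_intros K gc) auto
        show "continuous_on (UNIV \<times> cbox a b) (\<lambda>(h, y). - ((x - y + h *\<^sub>R c) \<bullet> c) / t * heat_kernel t (x - y + h *\<^sub>R c) * g y)"
          unfolding split_beta using t by (intro continuous_intros K gc) auto
      qed auto
      ultimately show "((\<lambda>h. \<integral>y. heat_kernel t (x + h *\<^sub>R c - y) * g y \<partial>lborel) has_real_derivative D1 c h) (at h)"
        by simp
    qed
    show "(D1 c has_real_derivative D2 c) (at 0)" if c: "c \<in> Basis" for c
    proof -
      have "((\<lambda>h. integral (cbox a b) (\<lambda>y. - ((x - y + h *\<^sub>R c) \<bullet> c) / t * heat_kernel t (x - y + h *\<^sub>R c) * g y))
         has_real_derivative integral (cbox a b) (\<lambda>y. (((x - y + 0 *\<^sub>R c) \<bullet> c)\<^sup>2 / t\<^sup>2 - 1 / t) * heat_kernel t (x - y + 0 *\<^sub>R c) * g y)) (at 0 within UNIV)"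
      proof (rule leibniz_rule_field_derivative)
        show "((\<lambda>h. - ((x - y + h *\<^sub>R c) \<bullet> c) / t * heat_kernel t (x - y + h *\<^sub>R c) * g y) has_real_derivative
            (((x - y + h *\<^sub>R c) \<bullet> c)\<^sup>2 / t\<^sup>2 - 1 / t) * heat_kernel t (x - y + h *\<^sub>R c) * g y) (at h within UNIV)" for h y
          by (intro DERIV_cmult_right DERIV2_heat_kernel_space t c)
        show "(\<lambda>y. - ((x - y + h *\<^sub>R c) \<bullet> c) / t * heat_kernel t (x - y + h *\<^sub>R c) * g y) integrable_on cbox a b" for h
          using t by (intro int continuous_intros K gc) auto
        show "continuous_on (UNIV \<times> cbox a b) (\<lambda>(h, y). (((x - y + h *\<^sub>R c) \<bullet> c)\<^sup>2 / t\<^sup>2 - 1 / t) * heat_kernel t (x - y + h *\<^sub>R c) * g y)"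
          unfolding split_beta using t by (intro continuous_intros K gc) auto
      qed auto
      then show ?thesis unfolding D1_def D2_def by simp
    qed
    have "w' = integral (cbox a b) (\<lambda>y. (\<Sum>c\<in>Basis. (((x - y) \<bullet> c)\<^sup>2 / t\<^sup>2 - 1 / t) * heat_kernel t (x - y) * g y) / 2)"
      unfolding w'_def heat_op_integrand[OF t] by (simp add: sum_distrib_right)
    also have "\<dots> = (\<Sum>c\<in>Basis. D2 c) / 2"
      unfolding D2_def integral_divide by (subst integral_sum) (use t in \<open>auto intro!: int continuous_intros K gc\<close>)
    finally show "0 = w' - (\<Sum>c\<in>Basis. D2 c) / 2" by simp
  qed
qed

text \<open>The expectation of \<open>g(x - \<surd>t Z)\<close> for a standard Gaussian \<open>Z\<close>. Unlike the convolution with the heat kernel, this form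
  makes sense and is continuous at \<open>t = 0\<close>.\<close>

definition heat_flow :: "('a::euclidean_space \<Rightarrow> real) \<Rightarrow> real \<Rightarrow> 'a \<Rightarrow> real" where
  "heat_flow g t x = (\<integral>z. heat_kernel 1 z * g (x - sqrt t *\<^sub>R z) \<partial>lborel)"

lemma heat_flow_eq:
  fixes g :: "'a::euclidean_space \<Rightarrow> real"
  assumes [measurable]: "g \<in> borel_measurable borel" and t: "0 < t"
  shows "heat_flow g t x = (\<integral>y. heat_kernel t (x - y) * g y \<partial>lborel)"
proof -
  have s: "(sqrt t) ^ DIM('a) * t powr (- real DIM('a) / 2) = 1"
  proof -
    have "sqrt t ^ DIM('a) = sqrt t powr real DIM('a)" using t by (subst powr_realpow) auto
    also have "\<dots> = t powr (real DIM('a) / 2)" using t by (simp add: powr_half_sqrt[symmetric] powr_powr)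
    finally show ?thesis using t by (simp flip: powr_add)
  qed
  have "(\<integral>y. heat_kernel t (x - y) * g y \<partial>lborel)
     = \<bar>- sqrt t\<bar> ^ DIM('a) * (\<integral>z. heat_kernel t (x - (x + (- sqrt t) *\<^sub>R z)) * g (x + (- sqrt t) *\<^sub>R z) \<partial>lborel)"
    using t by (intro integral_lborel_affine) auto
  also have "(\<lambda>z. heat_kernel t (x - (x + (- sqrt t) *\<^sub>R z)) * g (x + (- sqrt t) *\<^sub>R z)) =
     (\<lambda>z. t powr (- real DIM('a) / 2) * (heat_kernel 1 z * g (x - sqrt t *\<^sub>R z)))"
    using t by (auto simp: fun_eq_iff heat_kernel_profile power_mult_distrib field_simps)
  also have "\<bar>- sqrt t\<bar> ^ DIM('a) * (\<integral>z. t powr (- real DIM('a) / 2) * (heat_kernel 1 z * g (x - sqrt t *\<^sub>R z)) \<partial>lborel)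
     = (sqrt t ^ DIM('a) * t powr (- real DIM('a) / 2)) * heat_flow g t x"
    using t by (simp add: heat_flow_def)
  finally show ?thesis unfolding s by simp
qed

lemma integrable_heat_flow:
  fixes g :: "'a::euclidean_space \<Rightarrow> real"
  assumes [measurable]: "g \<in> borel_measurable borel" and "\<And>x. \<bar>g x\<bar> \<le> C"
  shows "integrable lborel (\<lambda>z. heat_kernel 1 z * g (x - sqrt t *\<^sub>R z))"
  using integrable_heat_kernel_times[of 1 "\<lambda>z. g (x - sqrt t *\<^sub>R z)" C 0] assms(2)
  by (simp add: heat_kernel_def)

lemma abs_heat_flow_le:
  fixes g :: "'a::euclidean_space \<Rightarrow> real"
  assumes [measurable]: "g \<in> borel_measurable borel" and g: "\<And>x. \<bar>g x\<bar> \<le> C"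
  shows "\<bar>heat_flow g t x\<bar> \<le> C"
proof -
  have "\<bar>heat_flow g t x\<bar> \<le> (\<integral>z. \<bar>heat_kernel 1 z * g (x - sqrt t *\<^sub>R z)\<bar> \<partial>lborel)"
    unfolding heat_flow_def by (rule integral_abs_bound)
  also have "\<dots> \<le> (\<integral>z. C * heat_kernel 1 (0 - z :: 'a) \<partial>lborel)"
  proof (rule Bochner_Integration.integral_mono)
    show "\<bar>heat_kernel 1 z * g (x - sqrt t *\<^sub>R z)\<bar> \<le> C * heat_kernel 1 (0 - z)" for z
      using mult_right_mono[OF g[of "x - sqrt t *\<^sub>R z"] heat_kernel_nonneg[of 1 z]]
      by (simp add: abs_mult mult.commute)
    show "integrable lborel (\<lambda>z. \<bar>heat_kernel 1 z * g (x - sqrt t *\<^sub>R z)\<bar>)"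
      by (intro integrable_abs integrable_heat_flow[OF assms])
  qed (intro integrable_mult_right integrable_heat_kernel, simp)
  also have "\<dots> = C" using integral_heat_kernel[of 1 "0::'a"] by simp
  finally show ?thesis .
qed

lemma heat_flow_0: "heat_flow g 0 x = g x"
  using integral_heat_kernel[of 1 "0::'a::euclidean_space"]
  by (simp add: heat_flow_def heat_kernel_def)

lemma continuous_on_heat_flow:
  fixes g :: "'a::euclidean_space \<Rightarrow> real"
  assumes c: "continuous_on UNIV g" and g: "\<And>x. \<bar>g x\<bar> \<le> C"
  shows "continuous_on S (\<lambda>(t, x). heat_flow g t x)"
proof (rule continuous_on_sequentiallyI)
  fix u :: "nat \<Rightarrow> real \<times> 'a" and p
  assume u: "\<forall>n. u n \<in> S" "p \<in> S" "u \<longlonglongrightarrow> p"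
  have [measurable]: "g \<in> borel_measurable borel" using c by (rule borel_measurable_continuous_onI)
  have "(\<lambda>n. heat_flow g (fst (u n)) (snd (u n))) \<longlonglongrightarrow> heat_flow g (fst p) (snd p)"
    unfolding heat_flow_def
  proof (rule integral_dominated_convergence[where w = "\<lambda>z. C * heat_kernel 1 (0 - z)"])
    show "AE z in lborel. (\<lambda>n. heat_kernel 1 z * g (snd (u n) - sqrt (fst (u n)) *\<^sub>R z))
        \<longlonglongrightarrow> heat_kernel 1 z * g (snd p - sqrt (fst p) *\<^sub>R z)"
    proof (intro AE_I2 tendsto_intros)
      fix z
      have "(\<lambda>n. snd (u n) - sqrt (fst (u n)) *\<^sub>R z) \<longlonglongrightarrow> snd p - sqrt (fst p) *\<^sub>R z"
        using u(3) by (intro tendsto_intros)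
      then show "(\<lambda>n. g (snd (u n) - sqrt (fst (u n)) *\<^sub>R z)) \<longlonglongrightarrow> g (snd p - sqrt (fst p) *\<^sub>R z)"
        using c by (intro continuous_on_tendsto_compose[OF c]) auto
    qed
    show "AE z in lborel. norm (heat_kernel 1 z * g (snd (u n) - sqrt (fst (u n)) *\<^sub>R z)) \<le> C * heat_kernel 1 (0 - z)" for n
      using mult_right_mono[OF g heat_kernel_nonneg[of 1]]
      by (intro AE_I2) (simp add: abs_mult mult.commute)
  qed (use integrable_heat_kernel[of 1 "0::'a"] in auto)
  then show "(\<lambda>n. case u n of (t, x) \<Rightarrow> heat_flow g t x) \<longlonglongrightarrow> (case p of (t, x) \<Rightarrow> heat_flow g t x)"
    by (simp add: split_beta)
qed

lemma has_heat_op_shift: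
  assumes "has_heat_op w (t - a) x l"
  shows "has_heat_op (\<lambda>t x. w (t - a) x) t x l"
proof -
  have "((\<lambda>s. w (s - a) x) has_real_derivative w') (at t)"
    if "((\<lambda>s. w s x) has_real_derivative w') (at (t - a))" for w'
    using DERIV_chain2[where f = "\<lambda>s. w s x" and g = "\<lambda>s. s - a" and Db = 1 and s = UNIV, OF that]
    by (simp add: DERIV_diff[OF DERIV_ident DERIV_const, simplified])
  then show ?thesis using assms unfolding has_heat_op_def by blast
qed

lemma bounded_of_compact_support:
  fixes g :: "'a::euclidean_space \<Rightarrow> real"
  assumes c: "continuous_on UNIV g" and R: "\<And>x. R < norm x \<Longrightarrow> g x = 0"
  obtains C where "\<And>x. \<bar>g x\<bar> \<le> C"
proof -
  have "compact (g ` cball 0 R)" by (intro compact_continuous_image continuous_on_subset[OF c]) auto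
  then obtain C where C: "\<And>x. x \<in> cball 0 R \<Longrightarrow> \<bar>g x\<bar> \<le> C"
    using compact_imp_bounded bounded_iff by (metis imageI real_norm_def)
  have "\<bar>g x\<bar> \<le> max C 0" for x
    using C[of x] R[of x] by (cases "norm x \<le> R") auto
  then show ?thesis by (rule that)
qed

lemma has_heat_op_heat_flow':
  fixes g :: "'a::euclidean_space \<Rightarrow> real"
  assumes g: "continuous_on UNIV g" "\<And>x. R < norm x \<Longrightarrow> g x = 0" and t: "a < t"
  shows "has_heat_op (\<lambda>t x. heat_flow g (t - a) x) t x 0"
proof (rule has_heat_op_shift)
  have [measurable]: "g \<in> borel_measurable borel" using g(1) by (rule borel_measurable_continuous_onI)
  have "has_heat_op (\<lambda>t x. \<integral>y. heat_kernel t (x - y) * g y \<partial>lborel) (t - a) x 0"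
    by (rule has_heat_op_heat_flow[OF g]) (use t in auto)
  then   obtain w' D2 where w: "((\<lambda>t. \<integral>y. heat_kernel t (x - y) * g y \<partial>lborel) has_real_derivative w') (at (t - a))"
    "\<forall>b\<in>Basis. \<exists>D1. (\<forall>\<^sub>F h in nhds 0. ((\<lambda>h. \<integral>y. heat_kernel (t - a) (x + h *\<^sub>R b - y) * g y \<partial>lborel) has_real_derivative D1 h) (at h)) \<and>
           (D1 has_real_derivative D2 b) (at 0)" "0 = w' - (\<Sum>b\<in>Basis. D2 b) / 2"
    unfolding has_heat_op_def by blast
  have "\<forall>\<^sub>F s in nhds (t - a). 0 < s" using t by (intro order_tendstoD(1)[OF filterlim_ident]) auto
  then have "\<forall>\<^sub>F s in nhds (t - a). heat_flow g s x = (\<integral>y. heat_kernel s (x - y) * g y \<partial>lborel)"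
    by eventually_elim (simp add: heat_flow_eq)
  then have "((\<lambda>s. heat_flow g s x) has_real_derivative w') (at (t - a))"
    using w(1) by (simp add: DERIV_cong_ev[OF refl _ refl])
  moreover have "(\<integral>y. heat_kernel (t - a) (z - y) * g y \<partial>lborel) = heat_flow g (t - a) z" for z
    using t by (simp add: heat_flow_eq)
  ultimately show "has_heat_op (heat_flow g) (t - a) x 0"
    unfolding has_heat_op_def using w(2,3) by (intro exI[of _ w'] exI[of _ D2]) auto
qed

lemma DW_le_heat_flow_plus:
  fixes g :: "'a::euclidean_space \<Rightarrow> real"
  assumes v: "DW_evolution f v" and a: "0 \<le> a" "a \<le> t"
    and g: "continuous_on UNIV g" "\<And>x. R < norm x \<Longrightarrow> g x = 0" "\<And>x. 0 \<le> g x"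
    and le: "\<And>x. v a x \<le> g x + c" and c: "0 \<le> c"
  shows "v t x \<le> heat_flow g (t - a) x + c"
proof -
  obtain C where C: "\<And>x. \<bar>g x\<bar> \<le> C" using bounded_of_compact_support[OF g(1,2)] by blast
  show ?thesis
  proof (rule DW_comparison[OF v closed_UNIV, of a t "\<lambda>t x. heat_flow g (t - a) x + c"])
    have "continuous_on ({a..t} \<times> UNIV) ((\<lambda>(t, x). heat_flow g t x) \<circ> (\<lambda>(t, x). (t - a, x)))"
      by (intro continuous_on_compose continuous_on_heat_flow[OF g(1) C]) (auto simp: split_beta intro!: continuous_intros)
    then show "continuous_on ({a..t} \<times> UNIV) (\<lambda>(s, x). heat_flow g (s - a) x + c)"
      by (auto simp: split_beta o_def intro!: continuous_intros)
    show "0 \<le> heat_flow g (s - a) y + c" for s y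
      unfolding heat_flow_def using c g(3) heat_kernel_nonneg by (intro add_nonneg_nonneg integral_nonneg_AE AE_I2 mult_nonneg_nonneg) auto
    show "\<exists>l. has_heat_op (\<lambda>t x. heat_flow g (t - a) x + c) s y l \<and> - (heat_flow g (s - a) y + c)\<^sup>2 \<le> l" if "a < s" for s y
      using has_heat_op_add[OF has_heat_op_heat_flow'[OF g(1,2) that] has_heat_op_time[of "\<lambda>_. c" 0 s]] by force
  qed (use le a in \<open>auto simp: heat_flow_0\<close>)
qed

text \<open>Where \<open>v \<le> \<delta>\<close>, the nonlinear loss \<open>v\<^sup>2\<close> is at most the linear loss \<open>\<delta> v\<close>, whose effect on the heat flow is the factor \<open>e\<^bsup>-\<delta>(t-a)\<^esup>\<close>.\<close>

lemma heat_flow_damped_le_DW: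
  fixes g :: "'a::euclidean_space \<Rightarrow> real"
  assumes v: "DW_evolution f v" and a: "0 \<le> a" "a \<le> t"
    and g: "continuous_on UNIV g" "\<And>x. R < norm x \<Longrightarrow> g x = 0"
    and le: "\<And>x. g x \<le> v a x"
    and \<delta>: "\<And>s x. a \<le> s \<Longrightarrow> s \<le> t \<Longrightarrow> v s x \<le> \<delta>"
  shows "exp (- \<delta> * (t - a)) * heat_flow g (t - a) x \<le> v t x"
proof -
  obtain C where C: "\<And>x. \<bar>g x\<bar> \<le> C" using bounded_of_compact_support[OF g(1,2)] by blast
  have [measurable]: "g \<in> borel_measurable borel" using g(1) by (rule borel_measurable_continuous_onI)
  have \<delta>0: "0 \<le> \<delta>" using \<delta>[of a 0] DW_evolution_nonneg[OF v a(1), of 0] a(2) by linarith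
  define W where "W = (\<lambda>s x. exp (- \<delta> * (s - a)) * heat_flow g (s - a) x)"
  have "W t x - v t x \<le> 0"
  proof (rule parabolic_maximum_principle[of UNIV a t "\<lambda>t x. W t x - v t x" "1 * C"])
    have "continuous_on ({a..t} \<times> UNIV) ((\<lambda>(t, x). heat_flow g t x) \<circ> (\<lambda>(t, x). (t - a, x)))"
      by (intro continuous_on_compose continuous_on_heat_flow[OF g(1) C]) (auto simp: split_beta intro!: continuous_intros)
    then show "continuous_on ({a..t} \<times> UNIV) (\<lambda>(s, x). W s x - v s x)"
      using DW_evolution_continuous[OF v a(1), of t UNIV]
      by (auto simp: W_def split_beta o_def intro!: continuous_intros)
    show "W s y - v s y \<le> 1 * C" if "a \<le> s" for s y
    proof -
      have "W s y \<le> \<bar>exp (- \<delta> * (s - a))\<bar> * \<bar>heat_flow g (s - a) y\<bar>" unfolding W_def by (metis abs_ge_self abs_mult)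
      also have "\<dots> \<le> 1 * C" using that \<delta>0 by (intro mult_mono abs_heat_flow_le C) auto
      finally show ?thesis using DW_evolution_nonneg[OF v, of s y] that a by simp
    qed
    show "\<exists>l\<le>0. has_heat_op (\<lambda>t x. W t x - v t x) s y l" if s: "a < s" "s \<le> t" "0 < W s y - v s y" for s y
    proof -
      have "((\<lambda>s. exp (- \<delta> * (s - a))) has_real_derivative - \<delta> * exp (- \<delta> * (s - a))) (at s)"
        by (auto intro!: derivative_eq_intros)
      from has_heat_op_time_mult[OF has_heat_op_heat_flow'[OF g s(1)] this]
      have "has_heat_op W s y (- \<delta> * W s y)" unfolding W_def by (simp add: mult_ac)
      from has_heat_op_diff[OF this DW_evolution_heat_op[OF v]]
      have h: "has_heat_op (\<lambda>t x. W t x - v t x) s y (- \<delta> * W s y - - (v s y)\<^sup>2)" using s(1) a by simp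
      have v0: "0 \<le> v s y" using DW_evolution_nonneg[OF v] s a by simp
      have "(v s y)\<^sup>2 \<le> \<delta> * v s y" unfolding power2_eq_square using \<delta>[of s y] s v0 by (intro mult_right_mono) auto
      also have "\<dots> \<le> \<delta> * W s y" using \<delta>0 s(3) by (intro mult_left_mono) auto
      finally show ?thesis using h by (intro exI[of _ "- \<delta> * W s y - - (v s y)\<^sup>2"]) auto
    qed
  qed (use le a in \<open>auto simp: W_def heat_flow_0\<close>)
  then show ?thesis by (simp add: W_def)
qed

definition ball_cutoff :: "real \<Rightarrow> 'a::euclidean_space \<Rightarrow> real" where
  "ball_cutoff R x = max 0 (min 1 (R + 1 - norm x))"

lemma ball_cutoff:
  shows continuous_on_ball_cutoff: "continuous_on UNIV (ball_cutoff R)"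
    and ball_cutoff_nonneg: "0 \<le> ball_cutoff R x"
    and ball_cutoff_le_1: "ball_cutoff R x \<le> 1"
    and ball_cutoff_eq_1: "norm x \<le> R \<Longrightarrow> ball_cutoff R x = 1"
    and ball_cutoff_eq_0: "R + 1 < norm x \<Longrightarrow> ball_cutoff R x = 0"
  by (auto simp: ball_cutoff_def[abs_def] intro!: continuous_intros)

lemma ball_cutoff_tendsto_1: "(\<lambda>n. ball_cutoff (real n) x) \<longlonglongrightarrow> 1"
proof (rule tendsto_eventually)
  have "\<forall>\<^sub>F n in sequentially. nat \<lceil>norm x\<rceil> \<le> n" by (rule eventually_ge_at_top)
  then show "\<forall>\<^sub>F n in sequentially. ball_cutoff (real n) x = 1"
    by eventually_elim (auto intro!: ball_cutoff_eq_1 simp: nat_le_iff ceiling_le_iff)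
qed

text \<open>The heat flow of \<open>v a\<close> itself is reached by truncation at a large radius: what is cut off is at most a constant \<open>\<eta>\<close>, and constants
  can be added to supersolutions.\<close>

lemma DW_le_heat_flow:
  fixes v :: "real \<Rightarrow> 'a::euclidean_space \<Rightarrow> real"
  assumes v: "DW_evolution f v" and a: "0 \<le> a" "a < t"
    and int: "integrable lborel (v a)"
    and van: "\<And>\<eta>. 0 < \<eta> \<Longrightarrow> \<exists>R. \<forall>x. R < norm x \<longrightarrow> v a x \<le> \<eta>"
  shows "v t x \<le> (\<integral>y. heat_kernel (t - a) (x - y) * v a y \<partial>lborel)"
proof (rule field_le_epsilon)
  fix \<eta> :: real assume \<eta>: "0 < \<eta>"
  obtain C where C: "0 < C" "\<And>t x. 0 \<le> t \<Longrightarrow> v t x \<le> C" using DW_evolution_bounded[OF v] by blast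
  have v0: "0 \<le> v a y" for y by (rule DW_evolution_nonneg[OF v a(1)])
  have vc: "continuous_on UNIV (v a)" by (rule DW_evolution_continuous_space[OF v a(1)])
  then have [measurable]: "v a \<in> borel_measurable borel" by (rule borel_measurable_continuous_onI)
  obtain R where R: "\<And>x. R < norm x \<Longrightarrow> v a x \<le> \<eta>" using van[OF \<eta>] by blast
  define g where "g = (\<lambda>y. v a y * ball_cutoff R y)"
  have g: "continuous_on UNIV g" "\<And>y. R + 1 < norm y \<Longrightarrow> g y = 0" "\<And>y. 0 \<le> g y" "\<And>y. g y \<le> v a y"
    unfolding g_def using vc v0
    by (auto intro!: continuous_intros continuous_on_ball_cutoff mult_nonneg_nonneg mult_left_le ball_cutoff_nonneg ball_cutoff_le_1 simp: ball_cutoff_eq_0)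
  have [measurable]: "g \<in> borel_measurable borel" using g(1) by (rule borel_measurable_continuous_onI)
  have "v t x \<le> heat_flow g (t - a) x + \<eta>"
  proof (rule DW_le_heat_flow_plus[OF v a(1) _ g(1,2,3)])
    show "v a y \<le> g y + \<eta>" for y
      using R[of y] ball_cutoff_eq_1[of y R] g(3)[of y] \<eta> by (cases "norm y \<le> R") (auto simp: g_def)
  qed (use a \<eta> in auto)
  also have "heat_flow g (t - a) x \<le> (\<integral>y. heat_kernel (t - a) (x - y) * v a y \<partial>lborel)"
    unfolding heat_flow_eq[OF \<open>g \<in> borel_measurable borel\<close>, of "t - a" x, simplified, OF a(2)]
  proof (rule Bochner_Integration.integral_mono)
    have "\<bar>v a y\<bar> \<le> C" "\<bar>g y\<bar> \<le> C" for y using C(2)[OF a(1), of y] v0[of y] g(3,4)[of y] by auto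
    then show "integrable lborel (\<lambda>y. heat_kernel (t - a) (x - y) * g y)"
      "integrable lborel (\<lambda>y. heat_kernel (t - a) (x - y) * v a y)"
      using a by (auto intro!: integrable_heat_kernel_times)
    show "heat_kernel (t - a) (x - y) * g y \<le> heat_kernel (t - a) (x - y) * v a y" for y
      using g(4) by (intro mult_left_mono) auto
  qed
  finally show "v t x \<le> (\<integral>y. heat_kernel (t - a) (x - y) * v a y \<partial>lborel) + \<eta>" by simp
qed

lemma damped_heat_flow_le_DW:
  fixes v :: "real \<Rightarrow> 'a::euclidean_space \<Rightarrow> real"
  assumes v: "DW_evolution f v" and a: "0 \<le> a" "a < t"
    and \<delta>: "\<And>s x. a \<le> s \<Longrightarrow> s \<le> t \<Longrightarrow> v s x \<le> \<delta>"
  shows "exp (- \<delta> * (t - a)) * (\<integral>y. heat_kernel (t - a) (x - y) * v a y \<partial>lborel) \<le> v t x"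
proof -
  have v0: "0 \<le> v a y" for y by (rule DW_evolution_nonneg[OF v a(1)])
  have vd: "v a y \<le> \<delta>" for y using \<delta>[of a y] a by simp
  have vc: "continuous_on UNIV (v a)" by (rule DW_evolution_continuous_space[OF v a(1)])
  then have [measurable]: "v a \<in> borel_measurable borel" by (rule borel_measurable_continuous_onI)
  define g where "g = (\<lambda>n y. v a y * ball_cutoff (real n) y)"
  have g: "continuous_on UNIV (g n)" "\<And>y. real n + 1 < norm y \<Longrightarrow> g n y = 0" "\<And>y. 0 \<le> g n y" "\<And>y. g n y \<le> v a y" for n
    unfolding g_def using vc v0
    by (auto intro!: continuous_intros continuous_on_ball_cutoff mult_nonneg_nonneg mult_left_le ball_cutoff_nonneg ball_cutoff_le_1 simp: ball_cutoff_eq_0)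
  have [measurable]: "g n \<in> borel_measurable borel" for n using g(1) by (rule borel_measurable_continuous_onI)
  have "(\<lambda>n. exp (- \<delta> * (t - a)) * heat_flow (g n) (t - a) x) \<longlonglongrightarrow>
     exp (- \<delta> * (t - a)) * (\<integral>y. heat_kernel (t - a) (x - y) * v a y \<partial>lborel)"
  proof (rule tendsto_mult_left)
    have "(\<lambda>n. \<integral>y. heat_kernel (t - a) (x - y) * g n y \<partial>lborel) \<longlonglongrightarrow> (\<integral>y. heat_kernel (t - a) (x - y) * v a y \<partial>lborel)"
    proof (rule integral_dominated_convergence[where w = "\<lambda>y. heat_kernel (t - a) (x - y) * v a y"])
      show "integrable lborel (\<lambda>y. heat_kernel (t - a) (x - y) * v a y)"
        using a v0 vd by (intro integrable_heat_kernel_times[of _ _ \<delta>]) auto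
      show "AE y in lborel. (\<lambda>n. heat_kernel (t - a) (x - y) * g n y) \<longlonglongrightarrow> heat_kernel (t - a) (x - y) * v a y"
      proof (intro AE_I2 tendsto_mult_left)
        show "(\<lambda>n. g n y) \<longlonglongrightarrow> v a y" for y
          unfolding g_def using tendsto_mult_left[OF ball_cutoff_tendsto_1, of "v a y" y] by simp
      qed
      show "AE y in lborel. norm (heat_kernel (t - a) (x - y) * g n y) \<le> heat_kernel (t - a) (x - y) * v a y" for n
        using g(3,4) by (intro AE_I2) (auto simp: abs_mult intro!: mult_left_mono)
    qed auto
    then show "(\<lambda>n. heat_flow (g n) (t - a) x) \<longlonglongrightarrow> (\<integral>y. heat_kernel (t - a) (x - y) * v a y \<partial>lborel)"
      using a by (simp add: heat_flow_eq)
  qed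
  moreover have le: "exp (- \<delta> * (t - a)) * heat_flow (g n) (t - a) x \<le> v t x" for n
    by (rule heat_flow_damped_le_DW[OF v a(1) _ g(1,2,4) \<delta>]) (use a in auto)
  ultimately show ?thesis by (intro LIMSEQ_le_const2[where a = "v t x"]) blast+
qed

section \<open>Hitting probabilities and solutions of the evolution equation\<close>

lemma nn_integral_measurable_fin_measures[measurable]:
  fixes f :: "'a::euclidean_space \<Rightarrow> ennreal"
  assumes f: "f \<in> borel_measurable borel"
  shows "(\<lambda>\<nu>. integral\<^sup>N \<nu> f) \<in> borel_measurable fin_measures" (is "_ \<in> ?B")
  using f
proof induct
  case (cong f g)
  have "(\<lambda>\<nu>. integral\<^sup>N \<nu> g) \<in> ?B \<longleftrightarrow> (\<lambda>\<nu>. integral\<^sup>N \<nu> f) \<in> ?B"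
    by (intro measurable_cong nn_integral_cong) (use cong in \<open>auto simp: space_fin_measures\<close>)
  with cong show ?case by simp
next
  case (set B)
  then have "(\<lambda>\<nu>. integral\<^sup>N \<nu> (indicator B)) \<in> ?B \<longleftrightarrow> (\<lambda>\<nu>. emeasure \<nu> B) \<in> ?B"
    by (intro measurable_cong nn_integral_indicator) (simp add: space_fin_measures)
  with set show ?case by (simp add: measurable_emeasure_fin_measures)
next
  case (mult f c)
  then have "(\<lambda>\<nu>. \<integral>\<^sup>+x. c * f x \<partial>\<nu>) \<in> ?B \<longleftrightarrow> (\<lambda>\<nu>. c * integral\<^sup>N \<nu> f) \<in> ?B"
    by (intro measurable_cong nn_integral_cmult) (auto simp: space_fin_measures cong: measurable_cong_sets)
  with mult show ?case by simp
next
  case (add f g)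
  then have "(\<lambda>\<nu>. \<integral>\<^sup>+x. g x + f x \<partial>\<nu>) \<in> ?B \<longleftrightarrow> (\<lambda>\<nu>. integral\<^sup>N \<nu> g + integral\<^sup>N \<nu> f) \<in> ?B"
    by (intro measurable_cong nn_integral_add) (auto simp: space_fin_measures cong: measurable_cong_sets)
  with add show ?case by (simp add: ac_simps)
next
  case (seq F)
  then have "(\<lambda>\<nu>. \<integral>\<^sup>+x. (SUP i. F i) x \<partial>\<nu>) \<in> ?B \<longleftrightarrow> (\<lambda>\<nu>. SUP i. integral\<^sup>N \<nu> (F i)) \<in> ?B"
    unfolding SUP_apply
    by (intro measurable_cong nn_integral_monotone_convergence_SUP) (auto simp: space_fin_measures cong: measurable_cong_sets)
  with seq show ?case by (simp add: ac_simps)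
qed

lemma integral_measurable_fin_measures:
  fixes f :: "'a::euclidean_space \<Rightarrow> real"
  assumes f: "f \<in> borel_measurable borel" and nonneg: "\<And>x. 0 \<le> f x"
  shows "(\<lambda>\<nu>. integral\<^sup>L \<nu> f) \<in> borel_measurable fin_measures"
proof -
  have "(\<lambda>\<nu>. integral\<^sup>L \<nu> f) \<in> borel_measurable fin_measures \<longleftrightarrow>
     (\<lambda>\<nu>. enn2real (integral\<^sup>N \<nu> f)) \<in> borel_measurable fin_measures"
    by (intro measurable_cong integral_eq_nn_integral) (use f nonneg in \<open>auto simp: space_fin_measures cong: measurable_cong_sets\<close>)
  then show ?thesis using f by simp
qed

lemma hit_set_measurable:
  fixes B :: "'a::euclidean_space set"
  assumes "B \<in> sets borel"
  shows "{\<nu> \<in> space fin_measures. 0 < emeasure \<nu> B} \<in> sets fin_measures"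
proof -
  have "(\<lambda>\<nu>. emeasure \<nu> B) -` {0<..} \<inter> space fin_measures \<in> sets fin_measures"
    by (rule measurable_sets[OF measurable_emeasure_fin_measures[OF assms]]) simp
  also have "(\<lambda>\<nu>. emeasure \<nu> B) -` {0<..} \<inter> space fin_measures = {\<nu> \<in> space fin_measures. 0 < emeasure \<nu> B}"
    by auto
  finally show ?thesis .
qed

text \<open>A compactly supported continuous function that is positive exactly on the open ball; its multiples detect whether a measure charges the ball.\<close>

definition hat :: "'a::euclidean_space \<Rightarrow> real \<Rightarrow> 'a \<Rightarrow> real" where
  "hat y \<epsilon> z = max 0 (\<epsilon> - norm (z - y))"

lemma hat_nonneg: "0 \<le> hat y \<epsilon> z"
  by (simp add: hat_def)

lemma hat_pos_iff: "0 < hat y \<epsilon> z \<longleftrightarrow> z \<in> ball y \<epsilon>"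
  by (auto simp: hat_def dist_norm norm_minus_commute less_max_iff_disj)

lemma hat_le: "0 \<le> \<epsilon> \<Longrightarrow> hat y \<epsilon> z \<le> \<epsilon>"
  by (simp add: hat_def)

lemma hat_eq_0: "\<epsilon> \<le> norm (z - y) \<Longrightarrow> hat y \<epsilon> z = 0"
  by (simp add: hat_def)

lemma continuous_on_hat: "continuous_on UNIV (hat y \<epsilon>)"
  unfolding hat_def[abs_def] by (intro continuous_intros)

lemma hat_measurable[measurable]: "hat y \<epsilon> \<in> borel_measurable borel"
  by (rule borel_measurable_continuous_onI[OF continuous_on_hat])

lemma hat_cc: "(\<lambda>z. c * hat y \<epsilon> z) \<in> cc_functions"
proof -
  have "{z. c * hat y \<epsilon> z \<noteq> 0} \<subseteq> cball y \<epsilon>"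
    by (auto simp: hat_def dist_norm norm_minus_commute max_def split: if_splits)
  then have "compact (closure {z. c * hat y \<epsilon> z \<noteq> 0})"
    unfolding compact_closure by (rule bounded_subset[OF bounded_cball])
  then show ?thesis unfolding cc_functions_def
    using continuous_on_hat[of y \<epsilon>] by (auto intro!: continuous_intros)
qed

lemma exp_hat_tendsto:
  fixes \<nu> :: "'a::euclidean_space measure"
  assumes \<nu>: "\<nu> \<in> space fin_measures"
  shows "(\<lambda>n. exp (- (\<integral>z. real n * hat y \<epsilon> z \<partial>\<nu>))) \<longlonglongrightarrow> (if 0 < emeasure \<nu> (ball y \<epsilon>) then 0 else 1)"
    and "(if 0 < emeasure \<nu> (ball y \<epsilon>) then 0 else 1) \<le> exp (- (\<integral>z. real n * hat y \<epsilon> z \<partial>\<nu>))"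
proof -
  have [measurable_cong]: "sets \<nu> = sets borel" and fin: "finite_measure \<nu>" using \<nu> by (auto simp: space_fin_measures)
  interpret finite_measure \<nu> by fact
  have int: "integrable \<nu> (hat y \<epsilon>)"
    by (rule integrable_const_bound[of _ "\<bar>\<epsilon>\<bar>"]) (auto simp: hat_def abs_le_iff intro!: AE_I2 order_trans[OF _ abs_ge_self])
  have zero_iff: "(\<integral>z. hat y \<epsilon> z \<partial>\<nu>) = 0 \<longleftrightarrow> emeasure \<nu> (ball y \<epsilon>) = 0"
  proof -
    have "(\<integral>z. hat y \<epsilon> z \<partial>\<nu>) = 0 \<longleftrightarrow> (AE z in \<nu>. hat y \<epsilon> z = 0)"
      by (intro integral_nonneg_eq_0_iff_AE int) (simp add: hat_nonneg)
    also have "\<dots> \<longleftrightarrow> (AE z in \<nu>. z \<notin> ball y \<epsilon>)"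
      using hat_pos_iff[of y \<epsilon>] hat_nonneg[of y \<epsilon>] by (intro AE_cong) (metis less_le)
    also have "\<dots> \<longleftrightarrow> emeasure \<nu> (ball y \<epsilon>) = 0"
      by (subst AE_iff_measurable[of "ball y \<epsilon>"]) (auto simp: sets_eq_imp_space_eq[OF \<open>sets \<nu> = sets borel\<close>])
    finally show ?thesis .
  qed
  have ge0: "0 \<le> (\<integral>z. hat y \<epsilon> z \<partial>\<nu>)" by (intro integral_nonneg_AE) (simp add: hat_nonneg)
  show "(\<lambda>n. exp (- (\<integral>z. real n * hat y \<epsilon> z \<partial>\<nu>))) \<longlonglongrightarrow> (if 0 < emeasure \<nu> (ball y \<epsilon>) then 0 else 1)"
  proof (cases "0 < emeasure \<nu> (ball y \<epsilon>)")
    case True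
    then have "0 < (\<integral>z. hat y \<epsilon> z \<partial>\<nu>)" using zero_iff ge0 by (simp add: less_le)
    then have "(\<lambda>n. exp (- (\<integral>z. hat y \<epsilon> z \<partial>\<nu>)) ^ n) \<longlonglongrightarrow> 0"
      by (intro LIMSEQ_realpow_zero) auto
    then have "(\<lambda>n. exp (- (real n * (\<integral>z. hat y \<epsilon> z \<partial>\<nu>)))) \<longlonglongrightarrow> 0"
      by (simp flip: exp_of_nat_mult)
    then show ?thesis using True by simp
  qed (use zero_iff in \<open>simp add: not_gr_zero\<close>)
  show "(if 0 < emeasure \<nu> (ball y \<epsilon>) then 0 else 1) \<le> exp (- (\<integral>z. real n * hat y \<epsilon> z \<partial>\<nu>))"
    using zero_iff by auto
qed

lemma return_fin_measures: "return borel x \<in> space fin_measures" for x :: "'a::euclidean_space"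
  by (simp add: space_fin_measures prob_space.finite_measure prob_space_return)

context DW_process
begin

lemma Laplace_evolution:
  assumes f: "f \<in> cc_functions" "\<And>x. 0 \<le> f x" and v: "DW_evolution f v"
    and \<mu>: "\<mu> \<in> space fin_measures" and t: "0 \<le> t"
  shows "(\<integral>\<omega>. exp (- (\<integral>x. f x \<partial>\<xi> t \<omega>)) \<partial>P \<mu>) = exp (- (\<integral>x. v t x \<partial>\<mu>))"
proof -
  obtain v' where v': "DW_evolution f v'"
    "(\<integral>\<omega>. exp (- (\<integral>x. f x \<partial>\<xi> t \<omega>)) \<partial>P \<mu>) = exp (- (\<integral>x. v' t x \<partial>\<mu>))"
    using Laplace[OF f(1)] f(2) \<mu> t by blast
  have "v' t x = v t x" for x by (rule DW_evolution_unique[OF v'(1) v t])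
  then show ?thesis using v'(2) by simp
qed

lemma evolution_exists:
  fixes f :: "'a \<Rightarrow> real"
  assumes "f \<in> cc_functions" "\<And>x. 0 \<le> f x"
  obtains v where "DW_evolution f v"
  using Laplace[OF assms(1)] assms(2) by blast

text \<open>The Laplace functionals of \<open>n\<close> times the hat decrease to the probability that the ball is not charged.\<close>

lemma hitting_eq:
  assumes \<mu>: "\<mu> \<in> space fin_measures" and t: "0 < t"
    and v: "\<And>n. DW_evolution (\<lambda>z. real n * hat y \<epsilon> z) (v n)"
    and lim: "\<And>x. (\<lambda>n. v n t x) \<longlonglongrightarrow> u x" and le: "\<And>n x. v n t x \<le> C"
  shows "hitting (P \<mu>) (\<xi> t) \<epsilon> y = ennreal (1 - exp (- (\<integral>x. u x \<partial>\<mu>)))"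
proof -
  interpret prob_space "P \<mu>" by (rule prob[OF \<mu>])
  have [measurable_cong]: "sets (P \<mu>) = sets W" "sets \<mu> = sets borel"
    using sets_P[OF \<mu>] \<mu> by (auto simp: space_fin_measures)
  have sp: "space (P \<mu>) = space W" by (rule sets_eq_imp_space_eq) fact
  have fin: "finite_measure \<mu>" using \<mu> by (simp add: space_fin_measures)
  have \<xi>[measurable]: "\<xi> t \<in> W \<rightarrow>\<^sub>M fin_measures" using t by (intro measurable_\<xi>) simp
  define S where "S = {\<omega> \<in> space (P \<mu>). 0 < emeasure (\<xi> t \<omega>) (ball y \<epsilon>)}"
  have "S = \<xi> t -` {\<nu> \<in> space fin_measures. 0 < emeasure \<nu> (ball y \<epsilon>)} \<inter> space W"
    using measurable_space[OF \<xi>] by (auto simp: S_def sp)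
  then have S: "S \<in> sets (P \<mu>)"
    using measurable_sets[OF \<xi> hit_set_measurable[of "ball y \<epsilon>"]] sets_P[OF \<mu>] by simp
  have [measurable]: "(\<lambda>\<nu>. \<integral>z. hat y \<epsilon> z \<partial>\<nu>) \<in> borel_measurable fin_measures"
    by (intro integral_measurable_fin_measures) (auto simp: hat_nonneg)
  have "(\<lambda>n. \<integral>\<omega>. exp (- (\<integral>z. real n * hat y \<epsilon> z \<partial>\<xi> t \<omega>)) \<partial>P \<mu>) \<longlonglongrightarrow> (\<integral>\<omega>. 1 - indicator S \<omega> \<partial>P \<mu>)"
  proof (rule integral_dominated_convergence[where w = "\<lambda>_. 1"])
    show "AE \<omega> in P \<mu>. (\<lambda>n. exp (- (\<integral>z. real n * hat y \<epsilon> z \<partial>\<xi> t \<omega>))) \<longlonglongrightarrow> 1 - indicator S \<omega>"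
    proof (rule AE_I2)
      fix \<omega> assume w: "\<omega> \<in> space (P \<mu>)"
      then have "\<xi> t \<omega> \<in> space fin_measures" using measurable_space[OF \<xi>] by (simp add: sp)
      from exp_hat_tendsto(1)[OF this, of y \<epsilon>]
      show "(\<lambda>n. exp (- (\<integral>z. real n * hat y \<epsilon> z \<partial>\<xi> t \<omega>))) \<longlonglongrightarrow> 1 - indicator S \<omega>"
        using w by (auto simp: S_def indicator_def split: if_splits)
    qed
    show "AE \<omega> in P \<mu>. norm (exp (- (\<integral>z. real n * hat y \<epsilon> z \<partial>\<xi> t \<omega>))) \<le> 1" for n
      by (intro AE_I2) (auto intro!: integral_nonneg_AE simp: hat_nonneg)
    show "(\<lambda>\<omega>. 1 - indicator S \<omega> :: real) \<in> borel_measurable (P \<mu>)"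
      by (intro borel_measurable_diff borel_measurable_const borel_measurable_indicator S)
  qed simp_all
  moreover have "(\<integral>\<omega>. exp (- (\<integral>z. real n * hat y \<epsilon> z \<partial>\<xi> t \<omega>)) \<partial>P \<mu>) = exp (- (\<integral>x. v n t x \<partial>\<mu>))" for n
    by (rule Laplace_evolution[OF hat_cc _ v \<mu>]) (use t in \<open>auto simp: hat_nonneg\<close>)
  moreover have "(\<lambda>n. exp (- (\<integral>x. v n t x \<partial>\<mu>))) \<longlonglongrightarrow> exp (- (\<integral>x. u x \<partial>\<mu>))"
  proof (intro tendsto_intros integral_dominated_convergence[where w = "\<lambda>_. C"] AE_I2 lim)
    have meas: "v n t \<in> borel_measurable borel" for n
      using t by (intro borel_measurable_continuous_onI DW_evolution_continuous_space[OF v]) simp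
    then show "v n t \<in> borel_measurable \<mu>" for n by simp
    have "u \<in> borel_measurable borel" by (rule borel_measurable_LIMSEQ_real[OF lim meas])
    then show "u \<in> borel_measurable \<mu>" by simp
    show "norm (v n t x) \<le> C" for n x using le[of n x] DW_evolution_nonneg[OF v, of t n x] t by simp
  qed (simp add: finite_measure.integrable_const[OF fin])
  ultimately have "(\<integral>\<omega>. 1 - indicator S \<omega> \<partial>P \<mu>) = exp (- (\<integral>x. u x \<partial>\<mu>))"
    using LIMSEQ_unique by fastforce
  moreover have "(\<integral>\<omega>. 1 - indicator S \<omega> \<partial>P \<mu>) = 1 - measure (P \<mu>) S"
    using S by (subst Bochner_Integration.integral_diff) (auto simp: prob_space emeasure_eq_measure)
  ultimately have "measure (P \<mu>) S = 1 - exp (- (\<integral>x. u x \<partial>\<mu>))" by simp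
  then show ?thesis unfolding hitting_def S_def[symmetric] by (simp add: emeasure_eq_measure)
qed

end

text \<open>This is \<open>u\<^sub>\<epsilon>(t,x)\<close>. The factor \<open>1/t\<close> is the intensity of the roots of the clusters, so that the integral of this function
  over the initial measure is the expected number of clusters that charge the ball.\<close>

definition cluster_density :: "(real \<Rightarrow> 'a::euclidean_space \<Rightarrow> 'a measure measure) \<Rightarrow> real \<Rightarrow> real \<Rightarrow> 'a \<Rightarrow> real" where
  "cluster_density H \<epsilon> t x = measure (H t x) {\<nu> \<in> space fin_measures. 0 < emeasure \<nu> (ball 0 \<epsilon>)} / t"

context DW_clusters
begin

lemma cluster_prob:
  assumes "0 < t"
  shows "prob_space (H t x)" "sets (H t x) = sets fin_measures"
  using measurable_space[OF cluster_kernel[OF assms], of x] by (auto simp: space_prob_algebra)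

lemma cluster_subprob: "0 < t \<Longrightarrow> H t \<in> borel \<rightarrow>\<^sub>M subprob_algebra fin_measures"
  by (rule measurable_prob_algebraD[OF cluster_kernel])

text \<open>Both Laplace functionals for a unit mass at \<open>x\<close> describe the same quantity, hence the exponents agree.\<close>

lemma cluster_evolution:
  fixes f :: "'a \<Rightarrow> real"
  assumes f: "f \<in> cc_functions" "\<And>x. 0 \<le> f x" and v: "DW_evolution f v" and t: "0 < t"
  shows "(\<integral>\<nu>. 1 - exp (- (\<integral>y. f y \<partial>\<nu>)) \<partial>H t x) = t * v t x"
proof -
  have fm: "f \<in> borel_measurable borel"
    using f(1) by (intro borel_measurable_continuous_onI) (simp add: cc_functions_def)
  have [measurable]: "(\<lambda>\<nu>. \<integral>y. f y \<partial>\<nu>) \<in> borel_measurable fin_measures"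
    by (rule integral_measurable_fin_measures[OF fm f(2)])
  note [measurable] = cluster_subprob[OF t]
  have meas: "(\<lambda>x. \<integral>\<nu>. 1 - exp (- (\<integral>y. f y \<partial>\<nu>)) \<partial>H t x) \<in> borel_measurable borel"
    by measurable
  have vm: "v t \<in> borel_measurable borel"
    using t by (intro borel_measurable_continuous_onI DW_evolution_continuous_space[OF v]) simp
  have "exp (- (1 / t) * (\<integral>x. (\<integral>\<nu>. 1 - exp (- (\<integral>y. f y \<partial>\<nu>)) \<partial>H t x) \<partial>return borel x))
     = exp (- (\<integral>x. v t x \<partial>return borel x))"
    using cluster_Laplace[OF return_fin_measures t f(1), of x] f(2)
      Laplace_evolution[OF f v return_fin_measures, of t x] t by simp
  then have "exp (- (1 / t) * (\<integral>\<nu>. 1 - exp (- (\<integral>y. f y \<partial>\<nu>)) \<partial>H t x)) = exp (- v t x)"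
    using meas vm by (simp add: integral_return)
  then show ?thesis using t by (simp add: field_simps)
qed

lemma
  fixes x y :: 'a
  assumes v: "\<And>n. DW_evolution (\<lambda>z. real n * hat y \<epsilon> z) (v n)" and t: "0 < t"
  defines "N \<equiv> measure (H t x) {\<nu> \<in> space fin_measures. 0 < emeasure \<nu> (ball y \<epsilon>)}"
  shows evolution_tendsto_cluster_hit: "(\<lambda>n. v n t x) \<longlonglongrightarrow> N / t"
    and evolution_le_cluster_hit: "v n t x \<le> N / t"
proof -
  interpret prob_space "H t x" by (rule cluster_prob[OF t])
  note [measurable_cong] = cluster_prob(2)[OF t, of x]
  have sp: "space (H t x) = space fin_measures" by (rule sets_eq_imp_space_eq[OF cluster_prob(2)[OF t]])
  define S where "S = {\<nu> \<in> space fin_measures. 0 < emeasure \<nu> (ball y \<epsilon>)}"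
  have S[measurable]: "S \<in> sets fin_measures" unfolding S_def by (rule hit_set_measurable) simp
  have [measurable]: "(\<lambda>\<nu>. \<integral>z. hat y \<epsilon> z \<partial>\<nu>) \<in> borel_measurable fin_measures"
    by (intro integral_measurable_fin_measures) (auto simp: hat_nonneg)
  have eq: "(\<integral>\<nu>. 1 - exp (- (\<integral>z. real n * hat y \<epsilon> z \<partial>\<nu>)) \<partial>H t x) = t * v n t x" for n
    by (rule cluster_evolution[OF hat_cc _ v t]) (simp add: hat_nonneg)
  have ind: "1 - (if 0 < emeasure \<nu> (ball y \<epsilon>) then 0 else 1 :: real) = indicator S \<nu>" if "\<nu> \<in> space fin_measures" for \<nu>
    using that by (simp add: S_def indicator_def)
  have "(\<lambda>n. \<integral>\<nu>. 1 - exp (- (\<integral>z. real n * hat y \<epsilon> z \<partial>\<nu>)) \<partial>H t x) \<longlonglongrightarrow> (\<integral>\<nu>. indicator S \<nu> \<partial>H t x)"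
  proof (rule integral_dominated_convergence[where w = "\<lambda>_. 1"])
    show "AE \<nu> in H t x. (\<lambda>n. 1 - exp (- (\<integral>z. real n * hat y \<epsilon> z \<partial>\<nu>))) \<longlonglongrightarrow> indicator S \<nu>"
      using tendsto_diff[OF tendsto_const exp_hat_tendsto(1), of _ 1 y \<epsilon>] ind
      by (intro AE_I2) (metis sp)
    show "AE \<nu> in H t x. norm (1 - exp (- (\<integral>z. real n * hat y \<epsilon> z \<partial>\<nu>))) \<le> 1" for n
      by (intro AE_I2) (auto intro!: integral_nonneg_AE simp: hat_nonneg)
  qed simp_all
  then have "(\<lambda>n. t * v n t x) \<longlonglongrightarrow> (\<integral>\<nu>. indicator S \<nu> \<partial>H t x)" unfolding eq .
  then have "(\<lambda>n. t * v n t x) \<longlonglongrightarrow> N" using S by (simp add: N_def S_def[symmetric] sp)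
  from tendsto_divide[OF this tendsto_const, of t] show "(\<lambda>n. v n t x) \<longlonglongrightarrow> N / t" using t by simp
  have "t * v n t x \<le> (\<integral>\<nu>. indicator S \<nu> \<partial>H t x)" unfolding eq[symmetric]
  proof (rule Bochner_Integration.integral_mono)
    show "integrable (H t x) (\<lambda>\<nu>. 1 - exp (- (\<integral>z. real n * hat y \<epsilon> z \<partial>\<nu>)))"
      by (rule integrable_const_bound[of _ 1]) (auto intro!: AE_I2 integral_nonneg_AE simp: hat_nonneg)
    show "1 - exp (- (\<integral>z. real n * hat y \<epsilon> z \<partial>\<nu>)) \<le> indicator S \<nu>" if "\<nu> \<in> space (H t x)" for \<nu>
      using exp_hat_tendsto(2)[of \<nu> y \<epsilon> n] ind[of \<nu>] that by (simp add: sp)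
  qed (use S in \<open>simp add: emeasure_eq_measure\<close>)
  then show "v n t x \<le> N / t" using S t by (simp add: N_def S_def[symmetric] sp field_simps)
qed

text \<open>Translation invariance of the cluster laws is inherited from the equation, as the hitting probabilities are limits of its solutions.\<close>

lemma cluster_hit_translate:
  assumes t: "0 < t"
  shows "measure (H t x) {\<nu> \<in> space fin_measures. 0 < emeasure \<nu> (ball y \<epsilon>)} = t * cluster_density H \<epsilon> t (x - y)"
proof -
  have "\<forall>n. \<exists>v. DW_evolution (\<lambda>z::'a. real n * hat 0 \<epsilon> z) v"
    using evolution_exists[OF hat_cc] by (metis hat_nonneg mult_nonneg_nonneg of_nat_0_le_iff)
  then obtain v where v: "\<And>n. DW_evolution (\<lambda>z::'a. real n * hat 0 \<epsilon> z) (v n)" by metis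
  have "hat 0 \<epsilon> (z - y) = hat y \<epsilon> z" for z by (simp add: hat_def)
  with DW_evolution_affine[OF v zero_less_one, of _ "- y"]
  have v': "\<And>n. DW_evolution (\<lambda>z. real n * hat y \<epsilon> z) (\<lambda>t x. v n t (x - y))" by simp
  from LIMSEQ_unique[OF evolution_tendsto_cluster_hit[OF v' t] evolution_tendsto_cluster_hit[OF v t], of x]
  show ?thesis using t by (simp add: cluster_density_def field_simps)
qed

lemma hat_evolutions:
  obtains v where "\<And>n. DW_evolution (\<lambda>z::'a. real n * hat y \<epsilon> z) (v n)"
proof -
  have "\<forall>n. \<exists>v. DW_evolution (\<lambda>z::'a. real n * hat y \<epsilon> z) v"
    using evolution_exists[OF hat_cc] by (metis hat_nonneg mult_nonneg_nonneg of_nat_0_le_iff)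
  then show ?thesis using that by metis
qed

lemma cluster_density_nonneg: "0 < t \<Longrightarrow> 0 \<le> cluster_density H \<epsilon> t x"
  by (simp add: cluster_density_def)

lemma cluster_density_le: "0 < t \<Longrightarrow> cluster_density H \<epsilon> t x \<le> 1 / t"
  unfolding cluster_density_def
  by (intro divide_right_mono prob_space.prob_le_1 cluster_prob) auto

lemma cluster_density_measurable:
  assumes "0 < t"
  shows "cluster_density H \<epsilon> t \<in> borel_measurable borel"
proof -
  note [measurable] = cluster_subprob[OF assms] measurable_measure_subprob_algebra[OF hit_set_measurable]
  show ?thesis unfolding cluster_density_def[abs_def] by measurable
qed

lemma hitting_process:
  assumes \<mu>: "\<mu> \<in> space fin_measures" and t: "0 < t"
  shows "hitting (P \<mu>) (\<xi> t) \<epsilon> y = ennreal (1 - exp (- (\<integral>x. cluster_density H \<epsilon> t (x - y) \<partial>\<mu>)))"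
proof -
  obtain v where v: "\<And>n. DW_evolution (\<lambda>z::'a. real n * hat y \<epsilon> z) (v n)" using hat_evolutions[of y \<epsilon>] by blast
  show ?thesis
  proof (rule hitting_eq[OF \<mu> t v])
    show lim: "(\<lambda>n. v n t x) \<longlonglongrightarrow> cluster_density H \<epsilon> t (x - y)" for x
      using evolution_tendsto_cluster_hit[OF v t, of x] t by (simp add: cluster_hit_translate)
    show "v n t x \<le> 1 / t" for n x
      using evolution_le_cluster_hit[OF v t, of n x] cluster_density_le[OF t, of \<epsilon> "x - y"] t
      by (simp add: cluster_hit_translate)
  qed
qed

lemma hitting_clusters:
  assumes \<mu>: "sets \<mu> = sets borel" and t: "0 < t"
  shows "hitting (\<mu> \<bind> H t) (\<lambda>\<nu>. \<nu>) \<epsilon> y = (\<integral>\<^sup>+x. ennreal (t * cluster_density H \<epsilon> t (x - y)) \<partial>\<mu>)"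
proof -
  have sp: "space \<mu> = UNIV" using sets_eq_imp_space_eq[OF \<mu>] by simp
  have "space (\<mu> \<bind> H t) = space fin_measures"
    using sp cluster_prob[OF t] by (intro space_bind) auto
  then have "hitting (\<mu> \<bind> H t) (\<lambda>\<nu>. \<nu>) \<epsilon> y = emeasure (\<mu> \<bind> H t) {\<nu> \<in> space fin_measures. 0 < emeasure \<nu> (ball y \<epsilon>)}"
    by (simp add: hitting_def)
  also have "\<dots> = (\<integral>\<^sup>+x. emeasure (H t x) {\<nu> \<in> space fin_measures. 0 < emeasure \<nu> (ball y \<epsilon>)} \<partial>\<mu>)"
    using sp by (intro emeasure_bind[where N = fin_measures] hit_set_measurable)
      (auto simp: measurable_cong_sets[OF \<mu> refl] intro!: cluster_subprob t)
  also have "\<dots> = (\<integral>\<^sup>+x. ennreal (t * cluster_density H \<epsilon> t (x - y)) \<partial>\<mu>)"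
    using finite_measure.emeasure_eq_measure[OF prob_space.finite_measure[OF cluster_prob(1)[OF t]]]
    by (simp add: cluster_hit_translate[OF t])
  finally show ?thesis .
qed

end

section \<open>Asymptotics of the hitting density of a single cluster\<close>

text \<open>The range of \<open>\<epsilon>\<close> in the upper bound. It grows with \<open>t\<close>, so a radius that is small at time \<open>s\<close> is small at all later times.\<close>

definition small_radius :: "real \<Rightarrow> real \<Rightarrow> bool" where
  "small_radius t \<epsilon> \<longleftrightarrow> 0 < \<epsilon> \<and> \<epsilon> < 1 \<and> \<epsilon> \<le> t \<and> 64 * \<epsilon>\<^sup>2 \<le> t"

lemma small_radius_mono: "small_radius s \<epsilon> \<Longrightarrow> s \<le> t \<Longrightarrow> small_radius t \<epsilon>"
  by (auto simp: small_radius_def)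

lemma eventually_small_radius:
  assumes "0 < t"
  shows "\<forall>\<^sub>F \<epsilon> in at_right 0. small_radius t \<epsilon>"
proof -
  define e where "e = min (1 / 2) (min t (sqrt t / 8))"
  have e: "e > 0" using assms by (simp add: e_def)
  have "\<forall>\<^sub>F \<epsilon> in at_right 0. \<epsilon> < e" using e by (rule eventually_at_right_real[THEN eventually_mono]) auto
  moreover have "\<forall>\<^sub>F \<epsilon> in at_right 0. (0::real) < \<epsilon>" by (simp add: eventually_at_right_less)
  ultimately show ?thesis
  proof eventually_elim
    case (elim \<epsilon>)
    then have "\<epsilon> \<le> sqrt t / 8" by (simp add: e_def)
    then have "\<epsilon>\<^sup>2 \<le> (sqrt t / 8)\<^sup>2" using elim by (intro power_mono) auto
    then show ?case using elim assms by (simp add: small_radius_def e_def power_divide)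
  qed
qed

lemma hit_rate_pos: "0 < \<epsilon> \<Longrightarrow> \<epsilon> < 1 \<Longrightarrow> 0 < hit_rate d \<epsilon>"
  by (simp add: hit_rate_def)

lemma hit_rate_at_top:
  assumes "2 \<le> d"
  shows "filterlim (hit_rate d) at_top (at_right 0)"
proof (cases "d = 2")
  case True
  have "filterlim (\<lambda>\<epsilon>::real. - ln \<epsilon>) at_top (at_right 0)"
    using ln_at_0 by (simp add: filterlim_uminus_at_top)
  then have "filterlim (\<lambda>\<epsilon>::real. \<bar>ln \<epsilon>\<bar>) at_top (at_right 0)"
    by (rule filterlim_at_top_mono) (auto intro!: always_eventually)
  then show ?thesis using True by (simp add: hit_rate_def[abs_def])
next
  case False
  then have "2 - real d < 0" using assms by simp
  then have "filterlim (\<lambda>\<epsilon>::real. (real d - 2) * - ln \<epsilon>) at_top (at_right 0)"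
    using ln_at_0 by (intro filterlim_tendsto_pos_mult_at_top[OF tendsto_const]) (auto simp: filterlim_uminus_at_top)
  then have lim: "filterlim (\<lambda>\<epsilon>::real. exp ((real d - 2) * - ln \<epsilon>)) at_top (at_right 0)"
    by (rule filterlim_compose[OF exp_at_top])
  have eq: "\<forall>\<^sub>F \<epsilon> in at_right 0. exp ((real d - 2) * - ln \<epsilon>) = \<epsilon> powr (2 - real d)"
    using eventually_at_right_less[of "0::real"] by eventually_elim (simp add: powr_def algebra_simps)
  have "filterlim (\<lambda>\<epsilon>::real. \<epsilon> powr (2 - real d)) at_top (at_right 0)"
    using lim unfolding filterlim_cong[OF refl refl eq] .
  then show ?thesis using False by (simp add: hit_rate_def[abs_def])
qed

lemma heat_kernel_vanishes:
  fixes x :: "'a::euclidean_space"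
  assumes "0 < s" "0 < \<eta>"
  shows "\<exists>R. \<forall>x::'a. R < norm x \<longrightarrow> C * heat_kernel s x \<le> \<eta>"
proof -
  define K where "K = \<bar>C\<bar> * (2 * pi * s) powr (- real DIM('a) / 2)"
  have K: "0 \<le> K" by (simp add: K_def)
  have "C * heat_kernel s x \<le> \<eta>" if x: "sqrt (2 * s * K / \<eta>) < norm x" for x :: 'a
  proof -
    have "2 * s * K / \<eta> = (sqrt (2 * s * K / \<eta>))\<^sup>2" using assms K by simp
    also have "\<dots> \<le> (norm x)\<^sup>2" using x assms K by (intro power_mono) auto
    finally have q: "K / \<eta> \<le> (norm x)\<^sup>2 / (2 * s)" using assms by (simp add: field_simps)
    have "C * heat_kernel s x \<le> \<bar>C\<bar> * heat_kernel s x" by (intro mult_right_mono) auto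
    also have "\<dots> = K * inverse (exp ((norm x)\<^sup>2 / (2 * s)))"
    proof -
      have e: "exp (- (norm x)\<^sup>2 / (2 * s)) = inverse (exp ((norm x)\<^sup>2 / (2 * s)))" by (simp add: exp_minus)
      show ?thesis unfolding heat_kernel_def K_def e by (simp only: mult.assoc)
    qed
    also have "\<dots> \<le> \<eta>"
    proof -
      have "K / \<eta> \<le> exp ((norm x)\<^sup>2 / (2 * s))" using q exp_ge_add_one_self[of "(norm x)\<^sup>2 / (2 * s)"] by linarith
      then have "K \<le> \<eta> * exp ((norm x)\<^sup>2 / (2 * s))" using assms by (simp add: pos_divide_le_eq mult.commute)
      then show ?thesis by (simp add: divide_inverse[symmetric] pos_divide_le_eq)
    qed
    finally show ?thesis .
  qed
  then show ?thesis by blast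
qed

context DW_clusters
begin

text \<open>The Gaussian bound gives \<open>v \<le> \<delta>\<close> from time \<open>s\<close> on, uniformly in the approximating solutions, and makes them vanish at infinity;
  the limit is by dominated convergence.\<close>

lemma cluster_density_flow:
  fixes x :: 'a
  assumes s: "0 < s" "s < t" and R: "0 < R" and K: "0 \<le> K"
    and b: "\<And>r v n x. s \<le> r \<Longrightarrow> DW_evolution (\<lambda>z::'a. real n * hat 0 \<epsilon> z) v \<Longrightarrow> R * v r x \<le> K * heat_kernel (4 * r) x"
    and int: "integrable lborel (cluster_density H \<epsilon> s)"
  defines "\<delta> \<equiv> K * (8 * pi * s) powr (- real DIM('a) / 2) / R"
    and "F \<equiv> \<integral>y. heat_kernel (t - s) (x - y) * cluster_density H \<epsilon> s y \<partial>lborel"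
  shows "exp (- \<delta> * (t - s)) * F \<le> cluster_density H \<epsilon> t x" "cluster_density H \<epsilon> t x \<le> F"
proof -
  obtain v where v: "\<And>n. DW_evolution (\<lambda>z::'a. real n * hat 0 \<epsilon> z) (v n)" using hat_evolutions[of 0 \<epsilon>] by blast
  have lim: "(\<lambda>n. v n r x) \<longlonglongrightarrow> cluster_density H \<epsilon> r x" and le: "\<And>n. v n r x \<le> cluster_density H \<epsilon> r x"
    if "0 < r" for r x
    using evolution_tendsto_cluster_hit[OF v that, of x] evolution_le_cluster_hit[OF v that, of _ x]
    by (auto simp: cluster_density_def)
  have t: "0 < t" using s by simp
  have v0: "0 \<le> v n r x" if "0 \<le> r" for n r x using DW_evolution_nonneg[OF v that] .
  have [measurable]: "v n s \<in> borel_measurable borel" for n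
    using s by (intro borel_measurable_continuous_onI DW_evolution_continuous_space[OF v]) simp
  have vint: "integrable lborel (v n s)" for n
    by (rule Bochner_Integration.integrable_bound[OF int]) (use le s v0 in \<open>auto intro!: AE_I2 order_trans[OF le abs_ge_self]\<close>)
  have van: "\<exists>R. \<forall>x. R < norm x \<longrightarrow> v n s x \<le> \<eta>" if "0 < \<eta>" for n \<eta>
  proof -
    have "v n s x \<le> K / R * heat_kernel (4 * s) x" for x using b[OF order_refl v, of n x] R by (simp add: field_simps)
    moreover have "\<exists>R'. \<forall>x::'a. R' < norm x \<longrightarrow> K / R * heat_kernel (4 * s) x \<le> \<eta>"
      by (rule heat_kernel_vanishes) (use that s in auto)
    ultimately show ?thesis using order_trans by blast
  qed
  have d: "v n r x \<le> \<delta>" if "s \<le> r" for n r x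
  proof -
    have "R * v n r x \<le> K * heat_kernel (4 * r) x" by (rule b[OF that v])
    also have "\<dots> \<le> K * (2 * pi * (4 * r)) powr (- real DIM('a) / 2)"
      using that s K by (intro mult_left_mono heat_kernel_le) auto
    also have "\<dots> \<le> K * (8 * pi * s) powr (- real DIM('a) / 2)"
      using that s K by (intro mult_left_mono powr_mono2') auto
    finally show ?thesis using R by (simp add: \<delta>_def field_simps)
  qed
  let ?F = "\<lambda>n. \<integral>y. heat_kernel (t - s) (x - y) * v n s y \<partial>lborel"
  have [measurable]: "cluster_density H \<epsilon> s \<in> borel_measurable borel" by (rule cluster_density_measurable[OF s(1)])
  have Fint: "integrable lborel (\<lambda>y. heat_kernel (t - s) (x - y) * cluster_density H \<epsilon> s y)"
    using s cluster_density_le[OF s(1)] cluster_density_nonneg[OF s(1)]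
    by (intro integrable_heat_kernel_times[of _ _ "1 / s"]) auto
  have Flim: "?F \<longlonglongrightarrow> F" unfolding F_def
  proof (rule integral_dominated_convergence[OF _ _ Fint])
    show "AE y in lborel. (\<lambda>n. heat_kernel (t - s) (x - y) * v n s y) \<longlonglongrightarrow> heat_kernel (t - s) (x - y) * cluster_density H \<epsilon> s y"
      by (intro AE_I2 tendsto_mult_left lim s)
    show "AE y in lborel. norm (heat_kernel (t - s) (x - y) * v n s y) \<le> heat_kernel (t - s) (x - y) * cluster_density H \<epsilon> s y" for n
      using v0 s le by (intro AE_I2) (auto simp: abs_mult intro!: mult_left_mono)
  qed simp_all
  have up: "v n t x \<le> ?F n" for n
    using s by (intro DW_le_heat_flow[OF v _ s(2) vint van]) auto
  show "cluster_density H \<epsilon> t x \<le> F"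
    by (rule LIMSEQ_le[OF lim[OF t] Flim]) (use up in blast)
  have "exp (- \<delta> * (t - s)) * ?F n \<le> v n t x" for n
    using s by (intro damped_heat_flow_le_DW[OF v _ s(2)] d) auto
  then show "exp (- \<delta> * (t - s)) * F \<le> cluster_density H \<epsilon> t x"
    by (intro LIMSEQ_le[OF tendsto_mult_left[OF Flim] lim[OF t]]) blast
qed

end

text \<open>The derivative \<open>- 2 x exp (-x\<^sup>2)\<close> is bounded by \<open>1\<close>, because \<open>2 \<bar>x\<bar> \<le> 1 + x\<^sup>2 \<le> exp (x\<^sup>2)\<close>.\<close>

lemma exp_neg_square_lipschitz: "\<bar>exp (- a\<^sup>2) - exp (- b\<^sup>2)\<bar> \<le> \<bar>a - b\<bar>" for a b :: real
proof -
  have d: "((\<lambda>x. exp (- x\<^sup>2)) has_real_derivative - 2 * x * exp (- x\<^sup>2)) (at x)" for x :: real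
    by (auto intro!: derivative_eq_intros)
  have b: "norm (- 2 * x * exp (- x\<^sup>2)) \<le> 1" for x :: real
  proof -
    have "2 * \<bar>x\<bar> \<le> 1 + x\<^sup>2" using zero_le_power2[of "\<bar>x\<bar> - 1"] by (simp add: power2_diff)
    also have "\<dots> \<le> exp (x\<^sup>2)" using exp_ge_add_one_self[of "x\<^sup>2"] by simp
    finally show ?thesis by (simp add: abs_mult exp_minus field_simps)
  qed
  have "norm (exp (- a\<^sup>2) - exp (- b\<^sup>2)) \<le> 1 * norm (a - b)"
    by (rule field_differentiable_bound[OF convex_UNIV, of "\<lambda>x. exp (- x\<^sup>2)" "\<lambda>x. - 2 * x * exp (- x\<^sup>2)"])
      (use d b in \<open>auto simp: has_field_derivative_at_within\<close>)
  then show ?thesis by simp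
qed

lemma heat_kernel_lipschitz_space:
  fixes x y :: "'a::euclidean_space"
  assumes "0 < r"
  shows "\<bar>heat_kernel r x - heat_kernel r y\<bar> \<le> (2 * pi * r) powr (- real DIM('a) / 2) / sqrt (2 * r) * norm (x - y)"
proof -
  define c where "c = (2 * pi * r) powr (- real DIM('a) / 2)"
  have k: "heat_kernel r z = c * exp (- (norm z / sqrt (2 * r))\<^sup>2)" for z :: 'a
    using assms by (simp add: heat_kernel_def c_def power_divide)
  have "\<bar>heat_kernel r x - heat_kernel r y\<bar> = c * \<bar>exp (- (norm x / sqrt (2 * r))\<^sup>2) - exp (- (norm y / sqrt (2 * r))\<^sup>2)\<bar>"
    unfolding k by (simp add: c_def abs_mult flip: right_diff_distrib)
  also have "\<dots> \<le> c * \<bar>norm x / sqrt (2 * r) - norm y / sqrt (2 * r)\<bar>"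
    by (intro mult_left_mono exp_neg_square_lipschitz) (simp add: c_def)
  also have "\<dots> = c / sqrt (2 * r) * \<bar>norm x - norm y\<bar>"
    using assms by (simp add: abs_divide flip: diff_divide_distrib)
  also have "\<dots> \<le> c / sqrt (2 * r) * norm (x - y)"
    using assms by (intro mult_left_mono norm_triangle_ineq3) (auto simp: c_def)
  finally show ?thesis by (simp add: c_def)
qed

lemma heat_kernel_lipschitz_time:
  fixes x :: "'a::euclidean_space"
  assumes a: "0 < a" and r: "a \<le> r" "r \<le> t"
  shows "\<bar>heat_kernel t x - heat_kernel r x\<bar> \<le> (2 * pi * a) powr (- real DIM('a) / 2) * ((1 + real DIM('a) / 2) / a) * (t - r)"
proof -
  let ?K = "(2 * pi * a) powr (- real DIM('a) / 2) * ((1 + real DIM('a) / 2) / a)"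
  have d: "((\<lambda>s. heat_kernel s x) has_real_derivative
    heat_kernel s x * ((norm x)\<^sup>2 / (2 * s\<^sup>2) - real DIM('a) / (2 * s))) (at s within {a..})" if "a \<le> s" for s
    using that a by (intro has_field_derivative_at_within[OF DERIV_heat_kernel_time]) auto
  have b: "norm (heat_kernel s x * ((norm x)\<^sup>2 / (2 * s\<^sup>2) - real DIM('a) / (2 * s))) \<le> ?K" if s: "a \<le> s" for s
  proof -
    define q where "q = (norm x)\<^sup>2 / (2 * s)"
    have s0: "s > 0" using s a by simp
    have q: "0 \<le> q" using s0 by (simp add: q_def)
    have "(norm x)\<^sup>2 / (2 * s\<^sup>2) - real DIM('a) / (2 * s) = (q - real DIM('a) / 2) / s"
      using s0 by (simp add: q_def power2_eq_square field_simps)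
    then have "norm (heat_kernel s x * ((norm x)\<^sup>2 / (2 * s\<^sup>2) - real DIM('a) / (2 * s)))
       = (2 * pi * s) powr (- real DIM('a) / 2) * (exp (- q) * \<bar>q - real DIM('a) / 2\<bar> / s)"
      using s0 by (simp add: heat_kernel_def q_def abs_mult)
    also have "\<dots> \<le> (2 * pi * a) powr (- real DIM('a) / 2) * ((1 + real DIM('a) / 2) / a)"
    proof (intro mult_mono powr_mono2' frac_le)
      have "q \<le> exp q" using exp_ge_add_one_self[of q] by linarith
      then have "exp (- q) * q \<le> 1" by (simp add: exp_minus field_simps)
      moreover have "exp (- q) * (real DIM('a) / 2) \<le> 1 * (real DIM('a) / 2)" using q by (intro mult_right_mono) auto
      moreover have "exp (- q) * \<bar>q - real DIM('a) / 2\<bar> \<le> exp (- q) * (q + real DIM('a) / 2)"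
        using q by (intro mult_left_mono) auto
      moreover have "exp (- q) * (q + real DIM('a) / 2) = exp (- q) * q + exp (- q) * (real DIM('a) / 2)"
        by (rule distrib_left)
      ultimately show "exp (- q) * \<bar>q - real DIM('a) / 2\<bar> \<le> 1 + real DIM('a) / 2" by linarith
    qed (use a s s0 in auto)
    finally show ?thesis .
  qed
  have "norm (heat_kernel t x - heat_kernel r x) \<le> ?K * norm (t - r)"
    by (rule field_differentiable_bound[of "{a..}", OF _ d b]) (use a r in auto)
  then show ?thesis using r by simp
qed

text \<open>The factor \<open>\<bar>y\<bar>\<close> is absorbed by widening the Gaussian; integrated over \<open>y\<close>, this bounds the first moment by \<open>O(\<surd>s)\<close>.\<close>

lemma norm_times_heat_kernel_le:
  fixes y :: "'a::euclidean_space"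
  assumes s: "0 < s"
  shows "norm y * heat_kernel (4 * s) y \<le> 4 * sqrt s * 2 powr (real DIM('a) / 2) * heat_kernel (8 * s) y"
proof -
  define w where "w = norm y / (4 * sqrt s)"
  have w: "0 \<le> w" using s by (simp add: w_def)
  have "w \<le> 1 + w\<^sup>2" using zero_le_power2[of "w - 1"] w by (simp add: power2_diff)
  also have "\<dots> \<le> exp (w\<^sup>2)" by (rule exp_ge_add_one_self)
  finally have "norm y \<le> 4 * sqrt s * exp (w\<^sup>2)" using s by (simp add: w_def field_simps)
  then have "norm y * heat_kernel (4 * s) y \<le> 4 * sqrt s * exp (w\<^sup>2) * heat_kernel (4 * s) y"
    by (intro mult_right_mono) auto
  also have "\<dots> = 4 * sqrt s * (exp (w\<^sup>2) * heat_kernel (4 * s) y)" by simp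
  also have "exp (w\<^sup>2) * heat_kernel (4 * s) y = 2 powr (real DIM('a) / 2) * heat_kernel (8 * s) y"
  proof -
    have w2: "w\<^sup>2 = (norm y)\<^sup>2 / (16 * s)" using s by (simp add: w_def power_divide power_mult_distrib)
    have p: "(2 * pi * (4 * s)) powr (- real DIM('a) / 2) = 2 powr (real DIM('a) / 2) * (2 * pi * (8 * s)) powr (- real DIM('a) / 2)"
    proof -
      have "(2 * pi * (8 * s)) powr (- real DIM('a) / 2) = (2 * (2 * pi * (4 * s))) powr (- real DIM('a) / 2)" by simp
      also have "\<dots> = 2 powr (- real DIM('a) / 2) * (2 * pi * (4 * s)) powr (- real DIM('a) / 2)" by (rule powr_mult)
      finally show ?thesis by (simp add: powr_minus)
    qed
    have "exp (w\<^sup>2) * exp (- (norm y)\<^sup>2 / (2 * (4 * s))) = exp (- (norm y)\<^sup>2 / (2 * (8 * s)))"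
      using s by (simp add: w2 mult_exp_exp)
    then show ?thesis unfolding heat_kernel_def p by (simp add: mult_ac)
  qed
  finally show ?thesis by simp
qed

lemma integral_heat_kernel_0:
  assumes "0 < t"
  shows "integrable lborel (heat_kernel t :: 'a::euclidean_space \<Rightarrow> real)" "(\<integral>y. heat_kernel t (y :: 'a) \<partial>lborel) = 1"
  using integrable_heat_kernel[OF assms, of "0::'a"] integral_heat_kernel[OF assms, of "0::'a"] by simp_all

lemma integral_heat_flow:
  fixes g :: "'a::euclidean_space \<Rightarrow> real"
  assumes t: "0 < t" and g: "integrable lborel g" "\<And>x. 0 \<le> g x" "\<And>x. g x \<le> C"
  shows "integrable lborel (\<lambda>x. \<integral>y. heat_kernel t (x - y) * g y \<partial>lborel)"
    and "(\<integral>x. (\<integral>y. heat_kernel t (x - y) * g y \<partial>lborel) \<partial>lborel) = (\<integral>y. g y \<partial>lborel)"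
proof -
  have [measurable]: "g \<in> borel_measurable borel" using g(1) by simp
  have inner: "ennreal (\<integral>y. heat_kernel t (x - y) * g y \<partial>lborel) = (\<integral>\<^sup>+y. ennreal (heat_kernel t (x - y) * g y) \<partial>lborel)" for x
    using g t by (intro nn_integral_eq_integral[symmetric] integrable_heat_kernel_times[of _ _ C]) auto
  have "(\<integral>\<^sup>+x. ennreal (\<integral>y. heat_kernel t (x - y) * g y \<partial>lborel) \<partial>lborel)
      = (\<integral>\<^sup>+y. (\<integral>\<^sup>+x. ennreal (heat_kernel t (x - y) * g y) \<partial>lborel) \<partial>lborel)"
    unfolding inner by (rule lborel_pair.Fubini') measurable
  also have "\<dots> = (\<integral>\<^sup>+y. ennreal (g y) \<partial>lborel)"
  proof (rule nn_integral_cong)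
    fix y :: 'a
    have "(\<integral>\<^sup>+x. ennreal (heat_kernel t (x - y) * g y) \<partial>lborel) = (\<integral>\<^sup>+x. ennreal (heat_kernel t (y - x)) * ennreal (g y) \<partial>lborel)"
      by (intro nn_integral_cong) (simp add: ennreal_mult g heat_kernel_minus_commute[of t _ y])
    also have "\<dots> = ennreal (g y)"
      by (subst nn_integral_multc) (simp_all add: nn_integral_heat_kernel[OF t])
    finally show "(\<integral>\<^sup>+x. ennreal (heat_kernel t (x - y) * g y) \<partial>lborel) = ennreal (g y)" .
  qed
  also have "\<dots> = ennreal (\<integral>y. g y \<partial>lborel)" using g by (intro nn_integral_eq_integral) auto
  finally have "has_bochner_integral lborel (\<lambda>x. \<integral>y. heat_kernel t (x - y) * g y \<partial>lborel) (\<integral>y. g y \<partial>lborel)"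
    using g by (intro has_bochner_integral_nn_integral) (auto intro!: integral_nonneg_AE)
  then show "integrable lborel (\<lambda>x. \<integral>y. heat_kernel t (x - y) * g y \<partial>lborel)"
    "(\<integral>x. (\<integral>y. heat_kernel t (x - y) * g y \<partial>lborel) \<partial>lborel) = (\<integral>y. g y \<partial>lborel)"
    by (auto simp: has_bochner_integral_iff)
qed

text \<open>A density below \<open>A p\<^bsub>4s\<^esub>\<close> has its first moment of order \<open>\<surd>s\<close>, and the heat kernel at times in \<open>[t/2, t]\<close> is Lipschitz in space and time.\<close>

lemma heat_flow_concentrated:
  fixes g :: "'a::euclidean_space \<Rightarrow> real"
  assumes s: "0 < s" "s \<le> t / 2" and A: "0 \<le> A"
    and g: "integrable lborel g" "\<And>x. 0 \<le> g x" "\<And>x. g x \<le> A * heat_kernel (4 * s) x"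
  defines "\<kappa> \<equiv> (pi * t) powr (- real DIM('a) / 2)"
  shows "\<bar>(\<integral>y. heat_kernel (t - s) (x - y) * g y \<partial>lborel) - (\<integral>y. g y \<partial>lborel) * heat_kernel t x\<bar>
    \<le> A * \<kappa> * (2 powr (real DIM('a) / 2) * 4 * sqrt s / sqrt t + (2 + real DIM('a)) / t * s)"
proof -
  have [measurable]: "g \<in> borel_measurable borel" using g(1) by simp
  have t: "0 < t" using s by simp
  define C1 where "C1 = \<kappa> / sqrt t"
  define C2 where "C2 = \<kappa> * ((2 + real DIM('a)) / t)"
  have C: "0 \<le> C1" "0 \<le> C2" using t by (auto simp: C1_def C2_def \<kappa>_def)
  have k: "\<bar>heat_kernel (t - s) (x - y) - heat_kernel t x\<bar> \<le> C1 * norm y + C2 * s" for y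
  proof -
    have "\<bar>heat_kernel (t - s) (x - y) - heat_kernel (t - s) x\<bar>
       \<le> (2 * pi * (t - s)) powr (- real DIM('a) / 2) / sqrt (2 * (t - s)) * norm (x - y - x)"
      using s by (intro heat_kernel_lipschitz_space) auto
    also have "\<dots> \<le> \<kappa> / sqrt t * norm (x - y - x)"
      unfolding \<kappa>_def using s t by (intro mult_right_mono frac_le powr_mono2') auto
    finally have 1: "\<bar>heat_kernel (t - s) (x - y) - heat_kernel (t - s) x\<bar> \<le> C1 * norm y" by (simp add: C1_def)
    have "\<bar>heat_kernel t x - heat_kernel (t - s) x\<bar>
      \<le> (2 * pi * (t / 2)) powr (- real DIM('a) / 2) * ((1 + real DIM('a) / 2) / (t / 2)) * (t - (t - s))"
      using s t by (intro heat_kernel_lipschitz_time) auto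
    also have "\<dots> = C2 * s" using t by (simp add: C2_def \<kappa>_def field_simps)
    finally show ?thesis using 1 by linarith
  qed
  define J where "J = (\<lambda>y. C1 * (A * (4 * sqrt s * 2 powr (real DIM('a) / 2) * heat_kernel (8 * s) y)) + C2 * s * (A * heat_kernel (4 * s) (y::'a)))"
  have gb: "\<bar>g y\<bar> \<le> A * (2 * pi * (4 * s)) powr (- real DIM('a) / 2)" for y
    using g(2,3)[of y] heat_kernel_le[of "4 * s" y] s mult_left_mono[OF heat_kernel_le[of "4 * s" y] A] by auto
  have int1: "integrable lborel (\<lambda>y. heat_kernel (t - s) (x - y) * g y)"
    using s t gb by (intro integrable_heat_kernel_times) auto
  have int2: "integrable lborel (\<lambda>y. g y * heat_kernel t x)" using g(1) by simp
  have intJ: "integrable lborel J" "(\<integral>y. J y \<partial>lborel) = C1 * (A * (4 * sqrt s * 2 powr (real DIM('a) / 2))) + C2 * s * A"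
    unfolding J_def using s integral_heat_kernel_0[where 'a = 'a, of "8 * s"] integral_heat_kernel_0[where 'a = 'a, of "4 * s"]
    by simp_all
  have "\<bar>(\<integral>y. heat_kernel (t - s) (x - y) * g y \<partial>lborel) - (\<integral>y. g y \<partial>lborel) * heat_kernel t x\<bar>
     = \<bar>\<integral>y. (heat_kernel (t - s) (x - y) * g y - g y * heat_kernel t x) \<partial>lborel\<bar>"
    using int1 int2 by simp
  also have "\<dots> \<le> (\<integral>y. \<bar>heat_kernel (t - s) (x - y) * g y - g y * heat_kernel t x\<bar> \<partial>lborel)"
    by (rule integral_abs_bound)
  also have "\<dots> \<le> (\<integral>y. J y \<partial>lborel)"
  proof (rule Bochner_Integration.integral_mono[OF _ intJ(1)])
    show "integrable lborel (\<lambda>y. \<bar>heat_kernel (t - s) (x - y) * g y - g y * heat_kernel t x\<bar>)"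
      using int1 int2 by simp
    fix y
    have "\<bar>heat_kernel (t - s) (x - y) * g y - g y * heat_kernel t x\<bar> = \<bar>heat_kernel (t - s) (x - y) - heat_kernel t x\<bar> * g y"
      using g(2)[of y] by (simp add: abs_mult left_diff_distrib[symmetric] mult.commute[of "g y"])
    also have "\<dots> \<le> (C1 * norm y + C2 * s) * g y" by (intro mult_right_mono k g(2))
    also have "\<dots> \<le> (C1 * norm y + C2 * s) * (A * heat_kernel (4 * s) y)"
      using C s by (intro mult_left_mono g(3)) auto
    also have "\<dots> = C1 * (A * (norm y * heat_kernel (4 * s) y)) + C2 * s * (A * heat_kernel (4 * s) y)"
      by (simp add: algebra_simps)
    also have "\<dots> \<le> J y" unfolding J_def using s A C
      by (intro add_right_mono mult_left_mono norm_times_heat_kernel_le) auto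
    finally show "\<bar>heat_kernel (t - s) (x - y) * g y - g y * heat_kernel t x\<bar> \<le> J y" .
  qed
  also have "\<dots> = A * \<kappa> * (2 powr (real DIM('a) / 2) * 4 * sqrt s / sqrt t + (2 + real DIM('a)) / t * s)"
    unfolding intJ(2) C1_def C2_def by (simp add: algebra_simps)
  finally show ?thesis .
qed

definition cluster_mass :: "(real \<Rightarrow> 'a::euclidean_space \<Rightarrow> 'a measure measure) \<Rightarrow> real \<Rightarrow> real" where
  "cluster_mass H \<epsilon> = hit_rate DIM('a) \<epsilon> * (\<integral>x. cluster_density H \<epsilon> 1 x \<partial>lborel)"

text \<open>The upper bound with its constant, both for the limit \<open>u\<^sub>\<epsilon>\<close> and for the solutions that approximate it.\<close>

definition cluster_bound :: "(real \<Rightarrow> 'a::euclidean_space \<Rightarrow> 'a measure measure) \<Rightarrow> real \<Rightarrow> bool" where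
  "cluster_bound H A \<longleftrightarrow> 0 < A \<and>
     (\<forall>\<epsilon> t x. 0 < t \<longrightarrow> small_radius t \<epsilon> \<longrightarrow> hit_rate DIM('a) \<epsilon> * cluster_density H \<epsilon> t x \<le> A * heat_kernel (4 * t) x) \<and>
     (\<forall>\<epsilon> t x v n. 0 < t \<longrightarrow> small_radius t \<epsilon> \<longrightarrow> DW_evolution (\<lambda>z::'a. real n * hat 0 \<epsilon> z) v \<longrightarrow>
        hit_rate DIM('a) \<epsilon> * v t x \<le> A * heat_kernel (4 * t) x)"

context DW_clusters
begin

lemma cluster_bound_exists:
  assumes "2 \<le> DIM('a)"
  obtains A where "cluster_bound H A"
proof -
  obtain A where A: "0 < A"
    "\<And>f v \<epsilon> t (x::'a). DW_evolution f v \<Longrightarrow> (\<And>x. \<epsilon> \<le> norm x \<Longrightarrow> f x = 0) \<Longrightarrow>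
       0 < \<epsilon> \<Longrightarrow> \<epsilon> < 1 \<Longrightarrow> \<epsilon> \<le> t \<Longrightarrow> 64 * \<epsilon>\<^sup>2 \<le> t \<Longrightarrow>
       hit_rate DIM('a) \<epsilon> * v t x \<le> A * t powr (- real DIM('a) / 2) * exp (- (norm x)\<^sup>2 / (8 * t))"
    using DW_upper_bound[OF assms] by blast
  define A' where "A' = A * (8 * pi) powr (real DIM('a) / 2)"
  have eq: "A * t powr (- real DIM('a) / 2) * exp (- (norm x)\<^sup>2 / (8 * t)) = A' * heat_kernel (4 * t) x" if "0 < t" for t and x :: 'a
  proof -
    have "(2 * pi * (4 * t)) powr (- real DIM('a) / 2) = ((8 * pi) * t) powr (- real DIM('a) / 2)" by (simp add: mult_ac)
    also have "\<dots> = (8 * pi) powr (- real DIM('a) / 2) * t powr (- real DIM('a) / 2)" using that by (simp add: powr_mult)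
    finally show ?thesis by (simp add: A'_def heat_kernel_def powr_minus)
  qed
  have 1: "hit_rate DIM('a) \<epsilon> * v t x \<le> A' * heat_kernel (4 * t) x"
    if "0 < t" "small_radius t \<epsilon>" "DW_evolution (\<lambda>z::'a. real n * hat 0 \<epsilon> z) v" for \<epsilon> t n v and x :: 'a
    using A(2)[OF that(3), of \<epsilon> t x] that(1,2) unfolding eq[OF that(1)] by (simp add: small_radius_def hat_eq_0)
  have 2: "hit_rate DIM('a) \<epsilon> * cluster_density H \<epsilon> t x \<le> A' * heat_kernel (4 * t) x"
    if "0 < t" "small_radius t \<epsilon>" for \<epsilon> t and x :: 'a
  proof -
    obtain v where v: "\<And>n. DW_evolution (\<lambda>z::'a. real n * hat 0 \<epsilon> z) (v n)" using hat_evolutions[of 0 \<epsilon>] by blast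
    have "(\<lambda>n. hit_rate DIM('a) \<epsilon> * v n t x) \<longlonglongrightarrow> hit_rate DIM('a) \<epsilon> * cluster_density H \<epsilon> t x"
      using evolution_tendsto_cluster_hit[OF v that(1), of x] by (intro tendsto_mult_left) (simp add: cluster_density_def)
    then show ?thesis by (rule LIMSEQ_le_const2) (use 1[OF that v] in blast)
  qed
  have "0 < A'" using A(1) by (simp add: A'_def)
  then have "cluster_bound H A'" unfolding cluster_bound_def using 1 2 by blast
  then show ?thesis by (rule that)
qed

lemma cluster_density_integrable:
  assumes A: "cluster_bound H A" and t: "0 < t" "small_radius t \<epsilon>"
  shows "integrable lborel (cluster_density H \<epsilon> t)"
    and "hit_rate DIM('a) \<epsilon> * (\<integral>x. cluster_density H \<epsilon> t x \<partial>lborel) \<le> A"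
    and "0 \<le> hit_rate DIM('a) \<epsilon> * (\<integral>x. cluster_density H \<epsilon> t x \<partial>lborel)"
proof -
  have R: "0 < hit_rate DIM('a) \<epsilon>" using t(2) by (auto simp: small_radius_def intro!: hit_rate_pos)
  have b: "hit_rate DIM('a) \<epsilon> * cluster_density H \<epsilon> t x \<le> A * heat_kernel (4 * t) x" for x
    using A t by (auto simp: cluster_bound_def)
  have K: "integrable lborel (\<lambda>x. A * heat_kernel (4 * t) (x :: 'a))" "(\<integral>x. A * heat_kernel (4 * t) (x :: 'a) \<partial>lborel) = A"
    using integral_heat_kernel_0[where 'a = 'a, of "4 * t"] t by simp_all
  have nn: "0 \<le> cluster_density H \<epsilon> t x" for x by (rule cluster_density_nonneg[OF t(1)])
  have [measurable]: "cluster_density H \<epsilon> t \<in> borel_measurable borel" by (rule cluster_density_measurable[OF t(1)])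
  have int: "integrable lborel (\<lambda>x. hit_rate DIM('a) \<epsilon> * cluster_density H \<epsilon> t x)"
    by (rule Bochner_Integration.integrable_bound[OF K(1)])
      (use R nn order_trans[OF b abs_ge_self] in \<open>auto simp: abs_mult intro!: AE_I2\<close>)
  then show "integrable lborel (cluster_density H \<epsilon> t)" using R by simp
  show "0 \<le> hit_rate DIM('a) \<epsilon> * (\<integral>x. cluster_density H \<epsilon> t x \<partial>lborel)"
    using R nn by (intro mult_nonneg_nonneg integral_nonneg_AE) auto
  show "hit_rate DIM('a) \<epsilon> * (\<integral>x. cluster_density H \<epsilon> t x \<partial>lborel) \<le> A"
    using Bochner_Integration.integral_mono[OF int K(1) b] unfolding K(2) by simp
qed

text \<open>The error has two parts. The first, of order \<open>\<delta> = O(1/r)\<close>, comes from replacing \<open>r u\<^sub>\<epsilon>(t)\<close> by the heat flow of \<open>r u\<^sub>\<epsilon>(s)\<close> and the mass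
  at time \<open>s\<close> by the mass at time \<open>1\<close>; the second, which is small with \<open>s\<close> uniformly in \<open>\<epsilon>\<close>, from replacing that heat flow by mass times \<open>p\<^sub>t\<close>.\<close>

lemma cluster_density_approx:
  assumes A: "cluster_bound H A" and s: "0 < s" "s \<le> t / 2" "s < 1" and e: "small_radius s \<epsilon>"
  defines "R \<equiv> hit_rate DIM('a) \<epsilon>" and "\<kappa> \<equiv> (pi * t) powr (- real DIM('a) / 2)"
  shows "\<bar>R * cluster_density H \<epsilon> t x - cluster_mass H \<epsilon> * heat_kernel t x\<bar>
    \<le> A * (8 * pi * s) powr (- real DIM('a) / 2) / R * (A * \<kappa> * (t + 1))
      + A * \<kappa> * (2 powr (real DIM('a) / 2) * 4 * sqrt s / sqrt t + (2 + real DIM('a)) / t * s)"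
proof -
  have t: "0 < t" "s < t" using s by auto
  have A0: "0 < A" using A by (simp add: cluster_bound_def)
  have R: "0 < R" using e by (auto simp: small_radius_def R_def intro!: hit_rate_pos)
  define \<delta> where "\<delta> = A * (8 * pi * s) powr (- real DIM('a) / 2) / R"
  have \<delta>: "0 \<le> \<delta>" using A0 R by (simp add: \<delta>_def)
  define V where "V = (\<lambda>y. R * cluster_density H \<epsilon> s y)"
  define M where "M = (\<integral>y. V y \<partial>lborel)"
  define F where "F = (\<lambda>r x. \<integral>y. heat_kernel (r - s) (x - y) * V y \<partial>lborel)"
  have int: "integrable lborel (cluster_density H \<epsilon> s)" by (rule cluster_density_integrable[OF A s(1) e])
  have V: "integrable lborel V" "\<And>y. 0 \<le> V y" "\<And>y. V y \<le> A * heat_kernel (4 * s) y"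
    using int R cluster_density_nonneg[OF s(1)] A s(1) e by (auto simp: V_def R_def cluster_bound_def)
  have M: "0 \<le> M" "M \<le> A"
    using cluster_density_integrable(2,3)[OF A s(1) e] by (simp_all add: M_def V_def R_def)
  have VC: "V y \<le> R * (1 / s)" for y
    unfolding V_def using R cluster_density_le[OF s(1)] by (intro mult_left_mono) auto
  have flow: "exp (- \<delta> * (r - s)) * F r x \<le> R * cluster_density H \<epsilon> r x" "R * cluster_density H \<epsilon> r x \<le> F r x"
    if r: "s < r" for r x
  proof -
    have b: "R * v q z \<le> A * heat_kernel (4 * q) z"
      if "s \<le> q" "DW_evolution (\<lambda>z::'a. real n * hat 0 \<epsilon> z) v" for q v n z
    proof -
      have "0 < q" using that(1) s(1) by simp
      then show ?thesis using A small_radius_mono[OF e that(1)] that(2) unfolding cluster_bound_def R_def by blast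
    qed
    have Feq: "F r x = R * (\<integral>y. heat_kernel (r - s) (x - y) * cluster_density H \<epsilon> s y \<partial>lborel)"
      unfolding F_def V_def by (simp add: mult.left_commute[of _ R])
    have fl: "exp (- \<delta> * (r - s)) * (\<integral>y. heat_kernel (r - s) (x - y) * cluster_density H \<epsilon> s y \<partial>lborel) \<le> cluster_density H \<epsilon> r x"
      "cluster_density H \<epsilon> r x \<le> (\<integral>y. heat_kernel (r - s) (x - y) * cluster_density H \<epsilon> s y \<partial>lborel)"
      unfolding \<delta>_def by (rule cluster_density_flow[OF s(1) r R less_imp_le[OF A0] _ int], rule b; assumption)+
    have "R * (exp (- \<delta> * (r - s)) * (\<integral>y. heat_kernel (r - s) (x - y) * cluster_density H \<epsilon> s y \<partial>lborel)) \<le> R * cluster_density H \<epsilon> r x"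
      using fl(1) R by (intro mult_left_mono) auto
    then show "exp (- \<delta> * (r - s)) * F r x \<le> R * cluster_density H \<epsilon> r x" unfolding Feq by (simp add: mult.left_commute)
    show "R * cluster_density H \<epsilon> r x \<le> F r x" unfolding Feq using fl(2) R by (intro mult_left_mono) auto
  qed
  have damp: "(1 - exp (- \<delta> * (r - s))) \<le> \<delta> * r" if "s < r" for r
  proof -
    have "1 - exp (- \<delta> * (r - s)) \<le> \<delta> * (r - s)" using exp_ge_add_one_self[of "- \<delta> * (r - s)"] by simp
    also have "\<dots> \<le> \<delta> * r" using \<delta> s by (intro mult_left_mono) auto
    finally show ?thesis .
  qed
  have \<kappa>: "0 \<le> \<kappa>" by (simp add: \<kappa>_def)
  have F: "0 \<le> F t x" "F t x \<le> A * \<kappa>"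
  proof -
    show "0 \<le> F t x" unfolding F_def using V by (intro integral_nonneg_AE) auto
    have "F t x \<le> (\<integral>y. \<kappa> * V y \<partial>lborel)"
      unfolding F_def
    proof (rule Bochner_Integration.integral_mono)
      show "integrable lborel (\<lambda>y. heat_kernel (t - s) (x - y) * V y)"
        using t V(1,2) VC by (intro integrable_heat_kernel_times[of _ _ "R * (1 / s)"]) auto
      show "heat_kernel (t - s) (x - y) * V y \<le> \<kappa> * V y" for y
      proof (intro mult_right_mono V)
        have "heat_kernel (t - s) (x - y) \<le> (2 * pi * (t - s)) powr (- real DIM('a) / 2)" using t by (intro heat_kernel_le) auto
        also have "\<dots> \<le> \<kappa>" unfolding \<kappa>_def using t s by (intro powr_mono2') auto
        finally show "heat_kernel (t - s) (x - y) \<le> \<kappa>" .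
      qed
    qed (use V in simp)
    also have "\<dots> = \<kappa> * M" by (simp add: M_def)
    also have "\<dots> \<le> \<kappa> * A" using M \<kappa> by (intro mult_left_mono)
    finally show "F t x \<le> A * \<kappa>" by (simp add: mult.commute)
  qed
  have "\<bar>R * cluster_density H \<epsilon> t x - F t x\<bar> \<le> (1 - exp (- \<delta> * (t - s))) * F t x"
    using flow[OF t(2), of x] by (simp add: algebra_simps)
  also have "\<dots> \<le> (\<delta> * t) * (A * \<kappa>)" using F damp[OF t(2)] \<delta> t by (intro mult_mono) auto
  finally have 1: "\<bar>R * cluster_density H \<epsilon> t x - F t x\<bar> \<le> (\<delta> * t) * (A * \<kappa>)" .
  have 2: "\<bar>F t x - M * heat_kernel t x\<bar>
     \<le> A * \<kappa> * (2 powr (real DIM('a) / 2) * 4 * sqrt s / sqrt t + (2 + real DIM('a)) / t * s)"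
    unfolding F_def M_def \<kappa>_def by (rule heat_flow_concentrated) (use s A0 V in auto)
  have mass: "\<bar>M - cluster_mass H \<epsilon>\<bar> \<le> \<delta> * A"
  proof -
    have IF: "integrable lborel (F 1)" "(\<integral>x. F 1 x \<partial>lborel) = M"
      unfolding F_def M_def using s by (intro integral_heat_flow[OF _ V(1,2) VC]; simp)+
    have int1: "integrable lborel (\<lambda>x. R * cluster_density H \<epsilon> 1 x)"
      using cluster_density_integrable(1)[OF A, of 1 \<epsilon>] small_radius_mono[OF e] s by simp
    have m: "cluster_mass H \<epsilon> = (\<integral>x. R * cluster_density H \<epsilon> 1 x \<partial>lborel)"
      by (simp add: cluster_mass_def R_def)
    have "cluster_mass H \<epsilon> \<le> M" unfolding m IF(2)[symmetric]
      by (rule Bochner_Integration.integral_mono[OF int1 IF(1)]) (rule flow(2)[OF s(3)])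
    moreover have "(\<integral>x. exp (- \<delta> * (1 - s)) * F 1 x \<partial>lborel) \<le> cluster_mass H \<epsilon>" unfolding m
      by (rule Bochner_Integration.integral_mono[OF _ int1]) (use IF(1) flow(1)[OF s(3)] in auto)
    then have "exp (- \<delta> * (1 - s)) * M \<le> cluster_mass H \<epsilon>" using IF(2) by simp
    moreover have "(1 - exp (- \<delta> * (1 - s))) * M \<le> (\<delta> * 1) * A"
      using damp[OF s(3)] M \<delta> by (intro mult_mono) auto
    ultimately show ?thesis by (simp add: left_diff_distrib)
  qed
  have kt: "heat_kernel t x \<le> \<kappa>"
  proof -
    have "heat_kernel t x \<le> (2 * pi * t) powr (- real DIM('a) / 2)" using t by (intro heat_kernel_le) auto
    also have "\<dots> \<le> \<kappa>" unfolding \<kappa>_def using t by (intro powr_mono2') auto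
    finally show ?thesis .
  qed
  have "\<bar>M * heat_kernel t x - cluster_mass H \<epsilon> * heat_kernel t x\<bar> = \<bar>M - cluster_mass H \<epsilon>\<bar> * heat_kernel t x"
    by (simp add: abs_mult flip: left_diff_distrib)
  also have "\<dots> \<le> (\<delta> * A) * \<kappa>" using mass kt \<delta> A0 by (intro mult_mono) auto
  finally have 3: "\<bar>M * heat_kernel t x - cluster_mass H \<epsilon> * heat_kernel t x\<bar> \<le> (\<delta> * A) * \<kappa>" .
  have "\<delta> * (A * \<kappa> * (t + 1)) = (\<delta> * t) * (A * \<kappa>) + (\<delta> * A) * \<kappa>" by (simp add: algebra_simps)
  then show ?thesis unfolding \<delta>_def[symmetric] using 1 2 3 by linarith
qed

text \<open>Choose \<open>s\<close> first, then \<open>\<epsilon>\<close>.\<close>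

lemma cluster_density_uniform_limit:
  assumes d: "2 \<le> DIM('a)" and A: "cluster_bound H A" and t: "0 < t" and \<eta>: "0 < \<eta>"
  shows "\<forall>\<^sub>F \<epsilon> in at_right 0. \<forall>x.
    \<bar>hit_rate DIM('a) \<epsilon> * cluster_density H \<epsilon> t x - cluster_mass H \<epsilon> * heat_kernel t x\<bar> \<le> \<eta>"
proof -
  have A0: "0 < A" using A by (simp add: cluster_bound_def)
  define \<kappa> where "\<kappa> = (pi * t) powr (- real DIM('a) / 2)"
  define E where "E = (\<lambda>s. A * \<kappa> * (2 powr (real DIM('a) / 2) * 4 * sqrt s / sqrt t + (2 + real DIM('a)) / t * s))"
  have "(E \<longlongrightarrow> A * \<kappa> * (2 powr (real DIM('a) / 2) * 4 * sqrt 0 / sqrt t + (2 + real DIM('a)) / t * 0)) (at_right 0)"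
    unfolding E_def using t by (intro tendsto_intros) auto
  then have "\<forall>\<^sub>F s in at_right 0. E s < \<eta> / 2" using \<eta> by (intro order_tendstoD(2)) auto
  moreover have "\<forall>\<^sub>F s in at_right 0. s < min (t / 2) 1"
    by (rule order_tendstoD(2)[OF tendsto_ident_at]) (use t in simp)
  moreover have "\<forall>\<^sub>F s in at_right 0. (0::real) < s" by (rule eventually_at_right_less)
  ultimately have "\<forall>\<^sub>F s in at_right 0. 0 < s \<and> s < min (t / 2) 1 \<and> E s < \<eta> / 2" by eventually_elim auto
  then obtain s where s: "0 < s" "s < t / 2" "s < 1" "E s < \<eta> / 2"
    using eventually_happens'[OF trivial_limit_at_right_real] by force
  define Q where "Q = A * (8 * pi * s) powr (- real DIM('a) / 2) * (A * \<kappa> * (t + 1))"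
  have "\<forall>\<^sub>F \<epsilon> in at_right 0. Q * 2 / \<eta> \<le> hit_rate DIM('a) \<epsilon>"
    using hit_rate_at_top[OF d] by (simp add: filterlim_at_top)
  then show ?thesis using eventually_small_radius[OF s(1)]
  proof eventually_elim
    case (elim \<epsilon>)
    have R: "0 < hit_rate DIM('a) \<epsilon>" using elim(2) by (auto simp: small_radius_def intro!: hit_rate_pos)
    have "Q / hit_rate DIM('a) \<epsilon> \<le> \<eta> / 2" using elim(1) R \<eta> by (simp add: field_simps)
    then show ?case
      using cluster_density_approx[OF A s(1) less_imp_le[OF s(2)] s(3) elim(2), folded \<kappa>_def] s(4)
      unfolding E_def Q_def by (smt (verit) field_sum_of_halves times_divide_eq_left)
  qed
qed

text \<open>The error is below \<open>\<eta>\<^sup>2 / B\<close> by the uniform limit and below \<open>B exp (-\<bar>x\<bar>\<^sup>2 / (8t))\<close> by the upper bound, hence below the geometric mean of the two.\<close>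

lemma cluster_density_gaussian_limit:
  assumes d: "2 \<le> DIM('a)" and A: "cluster_bound H A" and t: "0 < t" and \<eta>: "0 < \<eta>"
  shows "\<forall>\<^sub>F \<epsilon> in at_right 0. \<forall>x.
    \<bar>hit_rate DIM('a) \<epsilon> * cluster_density H \<epsilon> t x - cluster_mass H \<epsilon> * heat_kernel t x\<bar>
    \<le> \<eta> * exp (- (norm x)\<^sup>2 / (16 * t))"
proof -
  have A0: "0 < A" using A by (simp add: cluster_bound_def)
  define B where "B = A * ((8 * pi * t) powr (- real DIM('a) / 2) + (2 * pi * t) powr (- real DIM('a) / 2))"
  have B: "0 < B" using A0 t by (simp add: B_def add_pos_pos)
  have "\<forall>\<^sub>F \<epsilon> in at_right 0. \<forall>x.
      \<bar>hit_rate DIM('a) \<epsilon> * cluster_density H \<epsilon> t x - cluster_mass H \<epsilon> * heat_kernel t x\<bar> \<le> \<eta>\<^sup>2 / B"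
    using \<eta> B by (intro cluster_density_uniform_limit[OF d A t]) simp
  then show ?thesis using eventually_small_radius[OF t] eventually_small_radius[of 1, simplified]
  proof eventually_elim
    case (elim \<epsilon>)
    show ?case
    proof
      fix x
      let ?D = "\<bar>hit_rate DIM('a) \<epsilon> * cluster_density H \<epsilon> t x - cluster_mass H \<epsilon> * heat_kernel t x\<bar>"
      let ?G = "exp (- (norm x)\<^sup>2 / (8 * t))"
      have R: "0 < hit_rate DIM('a) \<epsilon>" using elim(2) by (auto simp: small_radius_def intro!: hit_rate_pos)
      have m: "0 \<le> cluster_mass H \<epsilon>" "cluster_mass H \<epsilon> \<le> A"
        using cluster_density_integrable(2,3)[OF A, of 1 \<epsilon>] elim(3) by (simp_all add: cluster_mass_def)
      have "hit_rate DIM('a) \<epsilon> * cluster_density H \<epsilon> t x \<le> A * heat_kernel (4 * t) x"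
        using A t elim(2) by (auto simp: cluster_bound_def)
      also have "\<dots> = A * (8 * pi * t) powr (- real DIM('a) / 2) * ?G" by (simp add: heat_kernel_def mult_ac)
      finally have 1: "hit_rate DIM('a) \<epsilon> * cluster_density H \<epsilon> t x \<le> A * (8 * pi * t) powr (- real DIM('a) / 2) * ?G" .
      have "cluster_mass H \<epsilon> * heat_kernel t x \<le> A * ((2 * pi * t) powr (- real DIM('a) / 2) * ?G)"
        unfolding heat_kernel_def using m t by (intro mult_mono) (auto simp: frac_le)
      then have 2: "cluster_mass H \<epsilon> * heat_kernel t x \<le> A * (2 * pi * t) powr (- real DIM('a) / 2) * ?G" by simp
      have "0 \<le> hit_rate DIM('a) \<epsilon> * cluster_density H \<epsilon> t x" "0 \<le> cluster_mass H \<epsilon> * heat_kernel t x"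
        using R m cluster_density_nonneg[OF t, of \<epsilon> x] by auto
      with 1 2 have "?D \<le> B * ?G" unfolding B_def distrib_left distrib_right by linarith
      then have "?D * ?D \<le> (\<eta>\<^sup>2 / B) * (B * ?G)" using elim(1) \<eta> B by (intro mult_mono) auto
      also have "\<dots> = \<eta>\<^sup>2 * ?G" using B by simp
      also have "\<dots> = (\<eta> * exp (- (norm x)\<^sup>2 / (16 * t)))\<^sup>2"
        by (simp add: power_mult_distrib power2_eq_square mult_exp_exp)
      finally have "?D\<^sup>2 \<le> (\<eta> * exp (- (norm x)\<^sup>2 / (16 * t)))\<^sup>2" by (simp add: power2_eq_square)
      then show "?D \<le> \<eta> * exp (- (norm x)\<^sup>2 / (16 * t))" by (rule power2_le_imp_le) (use \<eta> in simp)
    qed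
  qed
qed

end

section \<open>Sums of measures and of independent processes\<close>

lemma sets_sum_measure[simp]: "sets (sum_measure \<nu>) = sets borel"
  using sets.sigma_sets_eq[of borel] by (simp add: sum_measure_def)

lemma emeasure_sum_measure:
  fixes \<nu> :: "nat \<Rightarrow> 'a::euclidean_space measure"
  assumes \<nu>: "\<And>n. sets (\<nu> n) = sets borel" and B: "B \<in> sets borel"
  shows "emeasure (sum_measure \<nu>) B = (\<Sum>n. emeasure (\<nu> n) B)"
proof (rule emeasure_measure_of[OF sum_measure_def])
  show "countably_additive (sets (sum_measure \<nu>)) (\<lambda>B. \<Sum>n. emeasure (\<nu> n) B)"
  proof (rule countably_additiveI)
    fix A :: "nat \<Rightarrow> 'a set"
    assume A: "range A \<subseteq> sets (sum_measure \<nu>)" "disjoint_family A"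
    have "(\<Sum>i n. emeasure (\<nu> n) (A i)) = (\<Sum>n i. emeasure (\<nu> n) (A i))"
      using nn_integral_suminf[of "\<lambda>n i. emeasure (\<nu> n) (A i)" "count_space UNIV"]
      by (simp add: nn_integral_count_space_nat)
    also have "\<dots> = (\<Sum>n. emeasure (\<nu> n) (\<Union>i. A i))"
      using A by (intro suminf_cong suminf_emeasure) (auto simp: \<nu>)
    finally show "(\<Sum>i n. emeasure (\<nu> n) (A i)) = (\<Sum>n. emeasure (\<nu> n) (\<Union>i. A i))" .
  qed
qed (use B in \<open>auto simp: positive_def\<close>)

lemma nn_integral_sum_measure:
  fixes \<nu> :: "nat \<Rightarrow> 'a::euclidean_space measure"
  assumes \<nu>: "\<And>n. sets (\<nu> n) = sets borel" and f: "f \<in> borel_measurable borel"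
  shows "(\<integral>\<^sup>+x. f x \<partial>sum_measure \<nu>) = (\<Sum>n. \<integral>\<^sup>+x. f x \<partial>\<nu> n)"
  using f
proof induct
  note [measurable_cong] = \<nu> sets_sum_measure[of \<nu>]
  have sp: "space (\<nu> n) = UNIV" "space (sum_measure \<nu>) = UNIV" for n
    using sets_eq_imp_space_eq[OF \<nu>] sets_eq_imp_space_eq[OF sets_sum_measure] by auto
  case (cong f g)
  then show ?case using sp by (metis (no_types, lifting) nn_integral_cong UNIV_I space_borel suminf_cong)
next
  case (set B)
  then show ?case using \<nu> by (simp add: emeasure_sum_measure)
next
  note [measurable_cong] = \<nu> sets_sum_measure[of \<nu>]
  case (mult f c)
  then show ?case by (simp add: nn_integral_cmult)
next
  note [measurable_cong] = \<nu> sets_sum_measure[of \<nu>]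
  case (add f g)
  then show ?case by (simp add: nn_integral_add suminf_add[symmetric])
next
  note [measurable_cong] = \<nu> sets_sum_measure[of \<nu>]
  case (seq F)
  have i: "incseq (\<lambda>i. integral\<^sup>N (\<nu> n) (F i))" for n
    using \<open>incseq F\<close> by (auto simp: incseq_def le_fun_def intro!: nn_integral_mono)
  have "(\<integral>\<^sup>+x. (SUP i. F i x) \<partial>sum_measure \<nu>) = (SUP i. \<integral>\<^sup>+x. F i x \<partial>sum_measure \<nu>)"
    using seq by (intro nn_integral_monotone_convergence_SUP) auto
  also have "\<dots> = (SUP i. \<Sum>n. \<integral>\<^sup>+x. F i x \<partial>\<nu> n)" using seq by simp
  also have "\<dots> = (\<Sum>n. SUP i. \<integral>\<^sup>+x. F i x \<partial>\<nu> n)"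
    using i by (subst ennreal_suminf_SUP_eq) auto
  also have "\<dots> = (\<Sum>n. \<integral>\<^sup>+x. (SUP i. F i x) \<partial>\<nu> n)"
    using seq by (intro suminf_cong nn_integral_monotone_convergence_SUP[symmetric]) auto
  finally show ?case by (simp add: image_comp SUP_apply)
qed

context DW_clusters
begin

text \<open>The infinite product set is the decreasing intersection of cylinders.\<close>

lemma PiM_decreasing_products:
  fixes \<mu>s :: "nat \<Rightarrow> 'a measure"
  assumes \<mu>s: "\<And>n. \<mu>s n \<in> space fin_measures" and E: "\<And>n. E n \<in> sets W"
  shows "Pi\<^sub>E UNIV E \<in> sets (sum_prob P \<mu>s)"
    and "(\<lambda>n. \<Prod>i<n. measure (P (\<mu>s i)) (E i)) \<longlonglongrightarrow> measure (sum_prob P \<mu>s) (Pi\<^sub>E UNIV E)"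
proof -
  interpret PP: product_prob_space "\<lambda>n. P (\<mu>s n)" UNIV
    by (rule product_prob_spaceI) (rule prob[OF \<mu>s])
  have sets: "sets (P (\<mu>s n)) = sets W" for n by (rule sets_P[OF \<mu>s])
  have sp: "space (P (\<mu>s n)) = space W" for n by (rule sets_eq_imp_space_eq[OF sets])
  have E': "E n \<in> sets (P (\<mu>s n))" for n using E sets by simp
  let ?E = "\<lambda>n. PP.emb UNIV {..<n} (Pi\<^sub>E {..<n} E)"
  have em: "?E n \<in> sets (PiM UNIV (\<lambda>n. P (\<mu>s n)))" for n
    using E' by (intro sets_PiM_I_finite sets_PiM_I) auto
  have eq: "Pi\<^sub>E UNIV E = (\<Inter>n. ?E n)"
    using E'[THEN sets.sets_into_space] by (fastforce simp: prod_emb_def PiE_iff space_PiM)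
  have "(\<Prod>i<n. measure (P (\<mu>s i)) (E i)) = measure (PiM UNIV (\<lambda>n. P (\<mu>s n))) (?E n)" for n
    using E' by (subst PP.measure_PiM_emb) auto
  moreover have "decseq ?E"
    by (auto simp: prod_emb_def PiE_iff decseq_def)
  ultimately show "(\<lambda>n. \<Prod>i<n. measure (P (\<mu>s i)) (E i)) \<longlonglongrightarrow> measure (sum_prob P \<mu>s) (Pi\<^sub>E UNIV E)"
    unfolding eq sum_prob_def using em by (simp add: PP.finite_Lim_measure_decseq image_subset_iff)
  show "Pi\<^sub>E UNIV E \<in> sets (sum_prob P \<mu>s)"
    unfolding eq sum_prob_def using em by auto
qed

lemma sum_process_space:
  assumes \<mu>s: "\<And>n. \<mu>s n \<in> space fin_measures" and t: "0 \<le> t" and w: "\<omega> \<in> space (sum_prob P \<mu>s)"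
  shows "\<omega> n \<in> space W" "\<xi> t (\<omega> n) \<in> space fin_measures" "sets (\<xi> t (\<omega> n)) = sets borel"
    and "B \<in> sets borel \<Longrightarrow> emeasure (sum_process \<xi> t \<omega>) B = (\<Sum>n. emeasure (\<xi> t (\<omega> n)) B)"
proof -
  have sp: "space (P (\<mu>s n)) = space W" for n by (rule sets_eq_imp_space_eq[OF sets_P[OF \<mu>s]])
  have 1: "\<omega> n \<in> space W" for n using w by (auto simp: sum_prob_def space_PiM sp)
  have 2: "\<xi> t (\<omega> n) \<in> space fin_measures" for n by (rule measurable_space[OF measurable_\<xi>[OF t] 1])
  then have 3: "sets (\<xi> t (\<omega> n)) = sets borel" for n by (simp add: space_fin_measures)
  show "\<omega> n \<in> space W" "\<xi> t (\<omega> n) \<in> space fin_measures" "sets (\<xi> t (\<omega> n)) = sets borel" by fact+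
  show "B \<in> sets borel \<Longrightarrow> emeasure (sum_process \<xi> t \<omega>) B = (\<Sum>n. emeasure (\<xi> t (\<omega> n)) B)"
    unfolding sum_process_def by (rule emeasure_sum_measure[OF 3])
qed

text \<open>The sum charges the ball iff one of the independent summands does, so the probabilities \<open>exp (-\<integral> u\<^sub>\<epsilon> d\<mu>\<^sub>n)\<close> of avoiding it multiply.\<close>

lemma hitting_sum_process:
  fixes \<mu>s :: "nat \<Rightarrow> 'a measure"
  assumes \<mu>s: "\<And>n. \<mu>s n \<in> space fin_measures" and t: "0 < t"
    and int: "integrable (sum_measure \<mu>s) (\<lambda>x. cluster_density H \<epsilon> t (x - y))"
  shows "hitting (sum_prob P \<mu>s) (sum_process \<xi> t) \<epsilon> y
    = ennreal (1 - exp (- (\<integral>x. cluster_density H \<epsilon> t (x - y) \<partial>sum_measure \<mu>s)))"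
proof -
  interpret PP: product_prob_space "\<lambda>n. P (\<mu>s n)" UNIV
    by (rule product_prob_spaceI) (rule prob[OF \<mu>s])
  have ps: "prob_space (sum_prob P \<mu>s)" unfolding sum_prob_def by unfold_locales
  have sets: "sets (P (\<mu>s n)) = sets W" for n by (rule sets_P[OF \<mu>s])
  have sp: "space (P (\<mu>s n)) = space W" for n by (rule sets_eq_imp_space_eq[OF sets])
  have s\<mu>: "sets (\<mu>s n) = sets borel" for n using \<mu>s by (simp add: space_fin_measures)
  let ?u = "\<lambda>x. cluster_density H \<epsilon> t (x - y)"
  note [measurable] = cluster_density_measurable[OF t]
  have \<xi>[measurable]: "\<xi> t \<in> W \<rightarrow>\<^sub>M fin_measures" using t by (intro measurable_\<xi>) simp
  define E where "E = {\<omega> \<in> space W. \<not> 0 < emeasure (\<xi> t \<omega>) (ball y \<epsilon>)}"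
  define S where "S = {\<omega> \<in> space W. 0 < emeasure (\<xi> t \<omega>) (ball y \<epsilon>)}"
  have "S = \<xi> t -` {\<nu> \<in> space fin_measures. 0 < emeasure \<nu> (ball y \<epsilon>)} \<inter> space W"
    using measurable_space[OF \<xi>] by (auto simp: S_def)
  then have S: "S \<in> sets W"
    using measurable_sets[OF \<xi> hit_set_measurable[of "ball y \<epsilon>"]] by simp
  have ES: "E = space W - S" by (auto simp: E_def S_def)
  have E: "E \<in> sets W" unfolding ES using S by auto
  have mE: "measure (P (\<mu>s n)) E = exp (- (\<integral>x. ?u x \<partial>\<mu>s n))" for n
  proof -
    note Q = prob[OF \<mu>s, of n]
    have "ennreal (measure (P (\<mu>s n)) S) = ennreal (1 - exp (- (\<integral>x. ?u x \<partial>\<mu>s n)))"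
      using hitting_process[OF \<mu>s t, of n \<epsilon> y] unfolding hitting_def sp S_def[symmetric]
      by (simp add: finite_measure.emeasure_eq_measure[OF prob_space.finite_measure[OF Q]])
    moreover have "0 \<le> (\<integral>x. ?u x \<partial>\<mu>s n)" by (intro integral_nonneg_AE AE_I2 cluster_density_nonneg t)
    ultimately have "measure (P (\<mu>s n)) S = 1 - exp (- (\<integral>x. ?u x \<partial>\<mu>s n))" by simp
    then show ?thesis unfolding ES using prob_space.prob_compl[OF Q, of S] S sets sp by simp
  qed
  have nn: "(\<integral>\<^sup>+x. ennreal (?u x) \<partial>sum_measure \<mu>s) = (\<Sum>n. \<integral>\<^sup>+x. ennreal (?u x) \<partial>\<mu>s n)"
    by (intro nn_integral_sum_measure s\<mu>) measurable
  have uint: "integrable (\<mu>s n) ?u" for n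
  proof -
    interpret finite_measure "\<mu>s n" using \<mu>s by (simp add: space_fin_measures)
    note [measurable_cong] = s\<mu>
    show ?thesis
      by (rule integrable_const_bound[of _ "1 / t"])
        (use cluster_density_nonneg[OF t] cluster_density_le[OF t] in auto)
  qed
  have "ennreal (\<integral>x. ?u x \<partial>sum_measure \<mu>s) = (\<Sum>n. ennreal (\<integral>x. ?u x \<partial>\<mu>s n))"
  proof -
    have "ennreal (\<integral>x. ?u x \<partial>sum_measure \<mu>s) = (\<integral>\<^sup>+x. ennreal (?u x) \<partial>sum_measure \<mu>s)"
      by (intro nn_integral_eq_integral[symmetric] int AE_I2 cluster_density_nonneg t)
    also have "\<dots> = (\<Sum>n. ennreal (\<integral>x. ?u x \<partial>\<mu>s n))"
      unfolding nn by (intro suminf_cong nn_integral_eq_integral uint AE_I2 cluster_density_nonneg t)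
    finally show ?thesis .
  qed
  moreover have pos: "0 \<le> (\<integral>x. ?u x \<partial>\<mu>s n)" "0 \<le> (\<integral>x. ?u x \<partial>sum_measure \<mu>s)" for n
    by (intro integral_nonneg_AE AE_I2 cluster_density_nonneg t)+
  ultimately have sums: "(\<lambda>n. \<integral>x. ?u x \<partial>\<mu>s n) sums (\<integral>x. ?u x \<partial>sum_measure \<mu>s)"
    using sums_ennreal[OF pos(1) pos(2)] summable_sums[OF summableI, of "\<lambda>n. ennreal (\<integral>x. ?u x \<partial>\<mu>s n)"] by simp
  have "(\<lambda>n. \<Prod>i<n. measure (P (\<mu>s i)) E) \<longlonglongrightarrow> measure (sum_prob P \<mu>s) (Pi\<^sub>E UNIV (\<lambda>_. E))"
    by (rule PiM_decreasing_products(2)[OF \<mu>s E])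
  moreover have "(\<Prod>i<n. measure (P (\<mu>s i)) E) = exp (- (\<Sum>i<n. \<integral>x. ?u x \<partial>\<mu>s i))" for n
    by (simp add: mE exp_sum sum_negf[symmetric])
  moreover have "(\<lambda>n. exp (- (\<Sum>i<n. \<integral>x. ?u x \<partial>\<mu>s i))) \<longlonglongrightarrow> exp (- (\<integral>x. ?u x \<partial>sum_measure \<mu>s))"
    using sums unfolding sums_def by (intro tendsto_intros)
  ultimately have m: "measure (sum_prob P \<mu>s) (Pi\<^sub>E UNIV (\<lambda>_. E)) = exp (- (\<integral>x. ?u x \<partial>sum_measure \<mu>s))"
    by (simp add: LIMSEQ_unique)
  have "{\<omega> \<in> space (sum_prob P \<mu>s). 0 < emeasure (sum_process \<xi> t \<omega>) (ball y \<epsilon>)}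
      = space (sum_prob P \<mu>s) - Pi\<^sub>E UNIV (\<lambda>_. E)"
  proof -
    have "emeasure (sum_process \<xi> t \<omega>) (ball y \<epsilon>) = 0 \<longleftrightarrow> (\<forall>n. emeasure (\<xi> t (\<omega> n)) (ball y \<epsilon>) = 0)"
      if "\<omega> \<in> space (sum_prob P \<mu>s)" for \<omega>
      using sum_process_space(4)[OF \<mu>s less_imp_le[OF t] that, of "ball y \<epsilon>"] by (simp add: suminf_eq_zero_iff)
    then show ?thesis
      using sum_process_space(1)[OF \<mu>s less_imp_le[OF t]] by (fastforce simp: PiE_iff E_def not_gr_zero)
  qed
  then show ?thesis unfolding hitting_def
    using prob_space.prob_compl[OF ps PiM_decreasing_products(1)[OF \<mu>s E]] m
    by (simp add: finite_measure.emeasure_eq_measure[OF prob_space.finite_measure[OF ps]])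
qed

lemma integral_prod_sum_prob:
  fixes \<mu>s :: "nat \<Rightarrow> 'a measure" and X :: "'w \<Rightarrow> real"
  assumes \<mu>s: "\<And>n. \<mu>s n \<in> space fin_measures" and X: "X \<in> borel_measurable W"
    and b: "\<And>\<omega>. \<bar>X \<omega>\<bar> \<le> 1"
  shows "(\<integral>\<omega>. (\<Prod>i<n. X (\<omega> i)) \<partial>sum_prob P \<mu>s) = (\<Prod>i<n. \<integral>\<omega>. X \<omega> \<partial>P (\<mu>s i))"
proof -
  interpret PP: product_prob_space "\<lambda>n. P (\<mu>s n)" UNIV
    by (rule product_prob_spaceI) (rule prob[OF \<mu>s])
  have [measurable_cong]: "sets (P (\<mu>s n)) = sets W" for n by (rule sets_P[OF \<mu>s])
  note [measurable] = X
  have int: "integrable (P (\<mu>s i)) X" for i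
    by (rule finite_measure.integrable_const_bound[OF prob_space.finite_measure[OF prob[OF \<mu>s]], of _ 1])
      (use b in auto)
  have "(\<Prod>i<n. \<integral>\<omega>. X \<omega> \<partial>P (\<mu>s i)) = (\<integral>x. (\<Prod>i<n. X (x i)) \<partial>PiM {..<n} (\<lambda>n. P (\<mu>s n)))"
    by (rule PP.product_integral_prod[symmetric]) (use int in auto)
  also have "\<dots> = (\<integral>x. (\<Prod>i<n. X (x i)) \<partial>distr (PiM UNIV (\<lambda>n. P (\<mu>s n))) (PiM {..<n} (\<lambda>n. P (\<mu>s n))) (\<lambda>x. restrict x {..<n}))"
    by (subst PP.distr_PiM_restrict_finite) auto
  also have "\<dots> = (\<integral>\<omega>. (\<Prod>i<n. X (restrict \<omega> {..<n} i)) \<partial>PiM UNIV (\<lambda>n. P (\<mu>s n)))"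
    by (rule integral_distr) measurable
  finally show ?thesis by (simp add: sum_prob_def)
qed

text \<open>If the mass of the sum process in the unit ball is at most \<open>K\<close> with positive probability, then the Laplace functionals \<open>exp (-\<Sum>i<n. \<integral> v t d\<mu>\<^sub>i)\<close> of
  the partial sums stay above a positive constant.\<close>

lemma locally_finite_imp_summable:
  fixes \<mu>s :: "nat \<Rightarrow> 'a measure"
  assumes \<mu>s: "\<And>n. \<mu>s n \<in> space fin_measures" and lf: "locally_finite_DW P \<xi> \<mu>s" and t: "0 < t"
    and v: "DW_evolution (hat 0 1) v"
  shows "summable (\<lambda>n. \<integral>x. v t x \<partial>\<mu>s n)"
proof -
  interpret PP: product_prob_space "\<lambda>n. P (\<mu>s n)" UNIV
    by (rule product_prob_spaceI) (rule prob[OF \<mu>s])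
  let ?P = "sum_prob P \<mu>s"
  have ps: "prob_space ?P" unfolding sum_prob_def by unfold_locales
  interpret Q: prob_space ?P by (rule ps)
  have [measurable_cong]: "sets (P (\<mu>s n)) = sets W" for n by (rule sets_P[OF \<mu>s])
  have \<xi>[measurable]: "\<xi> t \<in> W \<rightarrow>\<^sub>M fin_measures" using t by (intro measurable_\<xi>) simp
  have [measurable]: "(\<lambda>\<nu>. emeasure \<nu> (ball 0 1)) \<in> borel_measurable (fin_measures :: 'a measure measure)"
    by (rule measurable_emeasure_fin_measures) simp
  have [measurable]: "(\<lambda>\<nu>. \<integral>z. hat 0 1 z \<partial>\<nu>) \<in> borel_measurable (fin_measures :: 'a measure measure)"
    by (intro integral_measurable_fin_measures) (auto simp: hat_nonneg)
  define X where "X = (\<lambda>\<omega>. \<integral>z. hat 0 1 z \<partial>\<xi> t \<omega>)"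
  have [measurable]: "X \<in> borel_measurable W" unfolding X_def by measurable
  have X0: "0 \<le> X \<omega>" for \<omega> unfolding X_def by (intro integral_nonneg_AE) (simp add: hat_nonneg)
  define S where "S = (\<lambda>\<omega>. \<Sum>n. emeasure (\<xi> t (\<omega> n)) (ball 0 1))"
  have [measurable]: "S \<in> borel_measurable ?P" unfolding S_def sum_prob_def by measurable
  have fin: "AE \<omega> in ?P. S \<omega> < \<infinity>"
  proof -
    have "AE \<omega> in ?P. locally_finite_measure (sum_process \<xi> t \<omega>)"
      using lf t by (simp add: locally_finite_DW_def)
    then show ?thesis
    proof (rule AE_mp, intro AE_I2 impI)
      fix \<omega> assume w: "\<omega> \<in> space ?P" "locally_finite_measure (sum_process \<xi> t \<omega>)"
      then have "emeasure (sum_process \<xi> t \<omega>) (ball 0 1) < \<infinity>" by (auto simp: locally_finite_measure_def)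
      then show "S \<omega> < \<infinity>" using sum_process_space(4)[OF \<mu>s less_imp_le[OF t] w(1), of "ball 0 1"] by (simp add: S_def)
    qed
  qed
  \<comment> \<open>Finiteness almost surely only gives a level that is not exceeded with positive probability, which is enough.\<close>
  have "\<exists>K::nat. emeasure ?P {\<omega> \<in> space ?P. S \<omega> \<le> of_nat K} \<noteq> 0"
  proof (rule ccontr)
    assume "\<not> ?thesis"
    then have "AE \<omega> in ?P. \<not> S \<omega> \<le> of_nat K" for K :: nat
      by (subst AE_iff_measurable[OF _ refl]) auto
    then have "AE \<omega> in ?P. \<forall>K::nat. \<not> S \<omega> \<le> of_nat K" by (simp add: AE_all_countable)
    with fin have "AE \<omega> in ?P. False"
    proof eventually_elim
      case (elim \<omega>)
      then obtain r where "0 \<le> r" "S \<omega> = ennreal r" by (cases "S \<omega>") auto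
      then have "S \<omega> \<le> of_nat (nat \<lceil>r\<rceil>)" by (simp add: ennreal_of_nat_eq_real_of_nat of_nat_ceiling)
      with elim(2) show False by blast
    qed
    then show False by simp
  qed
  then obtain K :: nat where K: "emeasure ?P {\<omega> \<in> space ?P. S \<omega> \<le> of_nat K} \<noteq> 0" by blast
  let ?A = "{\<omega> \<in> space ?P. S \<omega> \<le> of_nat K}"
  have A: "?A \<in> sets ?P" by measurable
  have pA: "0 < measure ?P ?A" using K by (simp add: Q.emeasure_eq_measure zero_less_measure_iff)
  have XS: "(\<Sum>i<n. X (\<omega> i)) \<le> real K" if w: "\<omega> \<in> ?A" for \<omega> n
  proof -
    have "ennreal (X (\<omega> i)) \<le> emeasure (\<xi> t (\<omega> i)) (ball 0 1)" for i
    proof -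
      have f: "\<xi> t (\<omega> i) \<in> space fin_measures" and [measurable_cong]: "sets (\<xi> t (\<omega> i)) = sets borel"
        using sum_process_space(2,3)[OF \<mu>s less_imp_le[OF t]] w by auto
      interpret finite_measure "\<xi> t (\<omega> i)" using f by (simp add: space_fin_measures)
      have "integrable (\<xi> t (\<omega> i)) (hat 0 1)"
        by (rule integrable_const_bound[of _ 1]) (auto simp: hat_nonneg intro!: hat_le)
      then have "ennreal (X (\<omega> i)) = (\<integral>\<^sup>+z. ennreal (hat 0 1 z) \<partial>\<xi> t (\<omega> i))"
        unfolding X_def by (intro nn_integral_eq_integral[symmetric]) (auto simp: hat_nonneg)
      also have "\<dots> \<le> (\<integral>\<^sup>+z. indicator (ball 0 1) z \<partial>\<xi> t (\<omega> i))"
        using hat_le[of 1 "0::'a"] hat_eq_0[of 1 _ "0::'a"]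
        by (intro nn_integral_mono) (auto simp: indicator_def not_less)
      finally show ?thesis by simp
    qed
    then have "(\<Sum>i<n. ennreal (X (\<omega> i))) \<le> (\<Sum>i<n. emeasure (\<xi> t (\<omega> i)) (ball 0 1))"
      by (intro sum_mono) simp
    also have "\<dots> \<le> S \<omega>" unfolding S_def by (rule sum_le_suminf) auto
    also have "\<dots> \<le> of_nat K" using w by simp
    finally have "ennreal (\<Sum>i<n. X (\<omega> i)) \<le> ennreal (real K)" using X0 by (simp add: ennreal_of_nat_eq_real_of_nat)
    then show ?thesis by simp
  qed
  have lower: "exp (- real K) * measure ?P ?A \<le> exp (- (\<Sum>i<n. \<integral>x. v t x \<partial>\<mu>s i))" for n
  proof -
    have "exp (- real K) * measure ?P ?A = (\<integral>\<omega>. exp (- real K) * indicator ?A \<omega> \<partial>?P)"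
      using A by (simp add: Q.emeasure_eq_measure)
    also have "\<dots> \<le> (\<integral>\<omega>. (\<Prod>i<n. exp (- X (\<omega> i))) \<partial>?P)"
    proof (rule Bochner_Integration.integral_mono)
      show "integrable ?P (\<lambda>\<omega>. exp (- real K) * indicator ?A \<omega>)"
        using A by (simp add: Q.emeasure_eq_measure)
      show "integrable ?P (\<lambda>\<omega>. \<Prod>i<n. exp (- X (\<omega> i)))"
      proof (rule Q.integrable_const_bound[of _ 1])
        show "(\<lambda>\<omega>. \<Prod>i<n. exp (- X (\<omega> i))) \<in> borel_measurable ?P" unfolding sum_prob_def by measurable
        show "AE \<omega> in ?P. norm (\<Prod>i<n. exp (- X (\<omega> i))) \<le> 1"
          using X0 by (intro AE_I2) (auto simp: abs_prod intro!: prod_le_1)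
      qed
      show "exp (- real K) * indicator ?A \<omega> \<le> (\<Prod>i<n. exp (- X (\<omega> i)))" for \<omega>
        using XS[of \<omega> n] by (auto simp: indicator_def exp_sum[symmetric] sum_negf intro!: prod_nonneg)
    qed
    also have "\<dots> = (\<Prod>i<n. \<integral>\<omega>. exp (- X \<omega>) \<partial>P (\<mu>s i))"
      by (rule integral_prod_sum_prob[OF \<mu>s]) (use X0 in auto)
    also have "\<dots> = (\<Prod>i<n. exp (- (\<integral>x. v t x \<partial>\<mu>s i)))"
      unfolding X_def using hat_cc[of 1 "0::'a" 1] t
      by (intro prod.cong refl Laplace_evolution[OF _ _ v \<mu>s]) (auto simp: hat_nonneg)
    also have "\<dots> = exp (- (\<Sum>i<n. \<integral>x. v t x \<partial>\<mu>s i))" by (simp add: exp_sum sum_negf[symmetric])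
    finally show ?thesis .
  qed
  define L where "L = - ln (exp (- real K) * measure ?P ?A)"
  have "(\<Sum>i<n. \<integral>x. v t x \<partial>\<mu>s i) \<le> L" for n
  proof -
    have "ln (exp (- real K) * measure ?P ?A) \<le> ln (exp (- (\<Sum>i<n. \<integral>x. v t x \<partial>\<mu>s i)))"
      using lower[of n] pA by (intro ln_mono) auto
    then show ?thesis by (simp add: L_def)
  qed
  moreover have "0 \<le> (\<integral>x. v t x \<partial>\<mu>s n)" for n
    using t by (intro integral_nonneg_AE AE_I2 DW_evolution_nonneg[OF v]) simp
  ultimately show ?thesis by (intro summableI_nonneg_bounded[where x = L]) auto
qed

text \<open>The damped heat flow of a bump is at least a Gaussian of the same time scale.\<close>

lemma DW_gaussian_lower_bound:
  assumes v: "DW_evolution (hat (0::'a) 1) v" and t: "0 < t"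
  obtains c where "0 < c" "\<And>x. c * exp (- (norm x)\<^sup>2 / t) \<le> v t x"
proof -
  obtain C where C: "0 < C" "\<And>t x. 0 \<le> t \<Longrightarrow> v t x \<le> C" using DW_evolution_bounded[OF v] by blast
  define I where "I = (\<integral>y. hat (0::'a) 1 y \<partial>lborel)"
  have hint: "integrable lborel (hat (0::'a) 1)"
  proof -
    have "integrable lborel (\<lambda>x. indicator (cball (0::'a) 1) x *\<^sub>R hat 0 1 x)"
      by (intro borel_integrable_compact compact_cball continuous_on_subset[OF continuous_on_hat]) auto
    moreover have "(\<lambda>x. indicator (cball (0::'a) 1) x *\<^sub>R hat 0 1 x) = hat 0 1"
      using hat_eq_0[of 1 _ "0::'a"] by (auto simp: fun_eq_iff indicator_def)
    ultimately show ?thesis by simp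
  qed
  have I: "0 < I"
  proof -
    have "(\<integral>y. 1 / 2 * indicator (ball (0::'a) (1 / 2)) y \<partial>lborel) \<le> I" unfolding I_def
    proof (rule Bochner_Integration.integral_mono[OF _ hint])
      show "integrable lborel (\<lambda>y. 1 / 2 * indicator (ball (0::'a) (1 / 2)) y :: real)"
        by (intro integrable_mult_right integrable_real_indicator) (use emeasure_bounded_finite[OF bounded_ball, of "0::'a" "1 / 2"] in auto)
    qed (auto simp: indicator_def hat_def)
    then have "1 / 2 * measure lborel (ball (0::'a) (1 / 2)) \<le> I" by simp
    moreover have "0 < measure lborel (ball (0::'a) (1 / 2))" by (rule content_ball_pos) simp
    ultimately show ?thesis by linarith
  qed
  define k where "k = (2 * pi * t) powr (- real DIM('a) / 2)"
  define c where "c = exp (- C * t) * (k * exp (- 1 / t) * I)"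
  have k: "0 < k" using t by (simp add: k_def)
  show ?thesis
  proof (rule that[of c])
    show "0 < c" using I k by (simp add: c_def)
    fix x :: 'a
    have "k * exp (- 1 / t) * exp (- (norm x)\<^sup>2 / t) * I = (\<integral>y. k * exp (- 1 / t) * exp (- (norm x)\<^sup>2 / t) * hat (0::'a) 1 y \<partial>lborel)"
      by (simp add: I_def)
    also have "\<dots> \<le> (\<integral>y. heat_kernel t (x - y) * hat (0::'a) 1 y \<partial>lborel)"
    proof (rule Bochner_Integration.integral_mono)
      show "integrable lborel (\<lambda>y. k * exp (- 1 / t) * exp (- (norm x)\<^sup>2 / t) * hat (0::'a) 1 y)" using hint by simp
      show "integrable lborel (\<lambda>y. heat_kernel t (x - y) * hat (0::'a) 1 y)"
        using t by (intro integrable_heat_kernel_times[of _ _ 1]) (auto simp: hat_nonneg intro!: hat_le)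
      show "k * exp (- 1 / t) * exp (- (norm x)\<^sup>2 / t) * hat (0::'a) 1 y \<le> heat_kernel t (x - y) * hat (0::'a) 1 y" for y
      proof (cases "norm y \<le> 1")
        case True
        have "(norm (x - y))\<^sup>2 \<le> (norm x + 1)\<^sup>2"
          using norm_triangle_ineq4[of x y] True by (intro power_mono) auto
        also have "\<dots> \<le> 2 * ((norm x)\<^sup>2 + 1)" using zero_le_power2[of "norm x - 1"] by (simp add: power2_sum power2_diff)
        finally have "(norm (x - y))\<^sup>2 / (2 * t) \<le> ((norm x)\<^sup>2 + 1) / t" using t by (simp add: field_simps)
        then have "exp (- 1 / t) * exp (- (norm x)\<^sup>2 / t) \<le> exp (- (norm (x - y))\<^sup>2 / (2 * t))"
          by (simp add: mult_exp_exp add_divide_distrib)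
        then show ?thesis unfolding heat_kernel_def k_def[symmetric] mult.assoc[of k] using k
          by (intro mult_right_mono mult_left_mono hat_nonneg) auto
      next
        case False
        then show ?thesis using hat_eq_0[of 1 y "0::'a"] by simp
      qed
    qed
    finally have 1: "k * exp (- 1 / t) * exp (- (norm x)\<^sup>2 / t) * I \<le> (\<integral>y. heat_kernel t (x - y) * v 0 y \<partial>lborel)"
      by (simp add: DW_evolution_initial[OF v])
    have "c * exp (- (norm x)\<^sup>2 / t) = exp (- C * (t - 0)) * (k * exp (- 1 / t) * exp (- (norm x)\<^sup>2 / t) * I)"
      by (simp add: c_def mult_ac)
    also have "\<dots> \<le> exp (- C * (t - 0)) * (\<integral>y. heat_kernel (t - 0) (x - y) * v 0 y \<partial>lborel)"
      using 1 by (intro mult_left_mono) auto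
    also have "\<dots> \<le> v t x" by (rule damped_heat_flow_le_DW[OF v order_refl t C(2)])
    finally show "c * exp (- (norm x)\<^sup>2 / t) \<le> v t x" .
  qed
qed

text \<open>Summability of the exponents \<open>\<integral> v t d\<mu>\<^sub>n\<close> becomes a Gaussian integrability condition on \<open>\<mu>\<close> through the lower bound for \<open>v t\<close>.\<close>

lemma locally_finite_imp_gaussian_integrable:
  fixes \<mu>s :: "nat \<Rightarrow> 'a measure"
  assumes \<mu>s: "\<And>n. \<mu>s n \<in> space fin_measures" and lf: "locally_finite_DW P \<xi> \<mu>s" and t: "0 < t"
  shows "(\<integral>\<^sup>+x. ennreal (exp (- (norm x)\<^sup>2 / t)) \<partial>sum_measure \<mu>s) < \<infinity>"
proof -
  obtain v where v: "DW_evolution (hat (0::'a) 1) v"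
    using evolution_exists[of "hat 0 1"] hat_cc[of 1 "0::'a" 1] by (auto simp: hat_nonneg)
  obtain c where c: "0 < c" "\<And>x. c * exp (- (norm x)\<^sup>2 / t) \<le> v t x"
    using DW_gaussian_lower_bound[OF v t] by blast
  have s\<mu>: "sets (\<mu>s n) = sets borel" for n using \<mu>s by (simp add: space_fin_measures)
  have v0: "0 \<le> v t x" for x using t by (intro DW_evolution_nonneg[OF v]) simp
  have vm[measurable]: "v t \<in> borel_measurable borel"
    using t by (intro borel_measurable_continuous_onI DW_evolution_continuous_space[OF v]) simp
  have vint: "integrable (\<mu>s n) (v t)" for n
  proof -
    interpret finite_measure "\<mu>s n" using \<mu>s by (simp add: space_fin_measures)
    note [measurable_cong] = s\<mu>
    show ?thesis
      by (rule integrable_const_bound[of _ "1 / t"]) (use v0 DW_le_inverse_time[OF v t] in auto)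
  qed
  have "ennreal c * (\<integral>\<^sup>+x. ennreal (exp (- (norm x)\<^sup>2 / t)) \<partial>sum_measure \<mu>s)
      = (\<integral>\<^sup>+x. ennreal (c * exp (- (norm x)\<^sup>2 / t)) \<partial>sum_measure \<mu>s)"
    using c(1) by (subst nn_integral_cmult[symmetric])
      (auto simp: ennreal_mult measurable_cong_sets[OF sets_sum_measure refl])
  also have "\<dots> \<le> (\<integral>\<^sup>+x. ennreal (v t x) \<partial>sum_measure \<mu>s)"
    using c(2) by (intro nn_integral_mono ennreal_leI) auto
  also have "\<dots> = (\<Sum>n. \<integral>\<^sup>+x. ennreal (v t x) \<partial>\<mu>s n)"
    by (intro nn_integral_sum_measure s\<mu>) measurable
  also have "\<dots> = (\<Sum>n. ennreal (\<integral>x. v t x \<partial>\<mu>s n))"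
    using vint v0 by (intro suminf_cong nn_integral_eq_integral) auto
  also have "\<dots> = ennreal (\<Sum>n. \<integral>x. v t x \<partial>\<mu>s n)"
    using locally_finite_imp_summable[OF \<mu>s lf t v] v0
    by (intro suminf_ennreal2) (auto intro!: integral_nonneg_AE)
  also have "\<dots> < \<infinity>" by simp
  finally have "ennreal c * (\<integral>\<^sup>+x. ennreal (exp (- (norm x)\<^sup>2 / t)) \<partial>sum_measure \<mu>s) < \<infinity>" .
  then show ?thesis using c(1) by (auto simp: ennreal_mult_less_top less_top[symmetric])
qed

end

section \<open>Integration over the roots and uniform limits\<close>

text \<open>Reduction of the supremum of extended real differences to a uniform estimate for real-valued representatives.\<close>

lemma unif_close_onI:
  assumes eq: "\<forall>\<^sub>F \<epsilon> in at_right 0. \<forall>x\<in>B. F \<epsilon> x = ennreal (f \<epsilon> x) \<and> G \<epsilon> x = ennreal (g \<epsilon> x) \<and> 0 \<le> f \<epsilon> x \<and> 0 \<le> g \<epsilon> x"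
    and close: "\<And>\<eta>. 0 < \<eta> \<Longrightarrow> \<forall>\<^sub>F \<epsilon> in at_right 0. \<forall>x\<in>B. \<bar>f \<epsilon> x - g \<epsilon> x\<bar> \<le> \<eta>"
  shows "unif_close_on B F G"
  unfolding unif_close_on_def
proof (rule order_tendstoI)
  fix a :: ennreal assume "0 < a"
  then obtain \<eta> where \<eta>: "0 < \<eta>" "ennreal \<eta> < a"
    by (metis dense ennreal_cases ennreal_less_zero_iff less_top_ennreal linorder_not_le order_less_trans)
  show "\<forall>\<^sub>F \<epsilon> in at_right 0. (SUP x\<in>B. e2ennreal \<bar>enn2ereal (F \<epsilon> x) - enn2ereal (G \<epsilon> x)\<bar>) < a"
    using eq close[OF \<eta>(1)]
  proof eventually_elim
    case (elim \<epsilon>)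
    have "(SUP x\<in>B. e2ennreal \<bar>enn2ereal (F \<epsilon> x) - enn2ereal (G \<epsilon> x)\<bar>) \<le> ennreal \<eta>"
    proof (rule SUP_least)
      fix x assume x: "x \<in> B"
      have "\<bar>enn2ereal (F \<epsilon> x) - enn2ereal (G \<epsilon> x)\<bar> = ereal \<bar>f \<epsilon> x - g \<epsilon> x\<bar>"
        using elim(1) x by (simp add: enn2ereal_ennreal)
      then show "e2ennreal \<bar>enn2ereal (F \<epsilon> x) - enn2ereal (G \<epsilon> x)\<bar> \<le> ennreal \<eta>"
        using elim(2) x by (simp add: ennreal.abs_eq[symmetric] ennreal_leI flip: ennreal_def)
    qed
    then show ?case using \<eta>(2) by (rule le_less_trans)
  qed
qed simp

lemma abs_one_minus_exp_minus_self_le: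
  fixes a :: real
  assumes "0 \<le> a"
  shows "\<bar>1 - exp (- a) - a\<bar> \<le> a\<^sup>2"
proof -
  have 1: "1 - exp (- a) \<le> a" using exp_ge_add_one_self[of "- a"] by simp
  have "a - a\<^sup>2 \<le> 1 - exp (- a)"
  proof -
    have "(1 + a) * exp (- a) \<le> 1" using exp_ge_add_one_self[of a] by (simp add: exp_minus field_simps)
    then have "exp (- a) \<le> 1 / (1 + a)" using assms by (simp add: field_simps)
    also have "\<dots> \<le> 1 - a + a\<^sup>2" using assms by (simp add: field_simps power2_eq_square)
    finally show ?thesis by simp
  qed
  with 1 show ?thesis by simp
qed

text \<open>The condition on \<open>\<mu>\<close> under which errors of size \<open>\<eta> exp (-\<bar>x\<bar>\<^sup>2 / (16t))\<close> can be integrated uniformly for centres \<open>y\<close> in \<open>B\<close>.\<close>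

definition gaussian_finite_on :: "'a::euclidean_space set \<Rightarrow> 'a measure \<Rightarrow> real \<Rightarrow> bool" where
  "gaussian_finite_on B \<mu> t \<longleftrightarrow>
     (\<exists>C\<ge>0. \<forall>y\<in>B. (\<integral>\<^sup>+x. ennreal (exp (- (norm (x - y))\<^sup>2 / (16 * t))) \<partial>\<mu>) \<le> ennreal C)"

lemma gaussian_finite_on_finite_measure:
  assumes \<mu>: "\<mu> \<in> space fin_measures" and t: "0 < t"
  shows "gaussian_finite_on B \<mu> t"
proof -
  interpret finite_measure \<mu> using \<mu> by (simp add: space_fin_measures)
  have "(\<integral>\<^sup>+x. ennreal (exp (- (norm (x - y))\<^sup>2 / (16 * t))) \<partial>\<mu>) \<le> (\<integral>\<^sup>+x. 1 \<partial>\<mu>)" for y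
    using t by (intro nn_integral_mono) (auto simp: ennreal_le_1)
  then have "(\<integral>\<^sup>+x. ennreal (exp (- (norm (x - y))\<^sup>2 / (16 * t))) \<partial>\<mu>) \<le> ennreal (measure \<mu> (space \<mu>))" for y
    by (simp add: emeasure_eq_measure)
  then show ?thesis unfolding gaussian_finite_on_def by (intro exI[of _ "measure \<mu> (space \<mu>)"]) auto
qed

text \<open>Moving the centre by at most \<open>b\<close> costs a constant factor if the Gaussian is widened, as \<open>\<bar>x\<bar>\<^sup>2 \<le> 2 \<bar>x - y\<bar>\<^sup>2 + 2 b\<^sup>2\<close>.\<close>

lemma gaussian_finite_on_bounded:
  assumes \<mu>: "sets \<mu> = sets borel" and t: "0 < t" and B: "bounded B"
    and fin: "(\<integral>\<^sup>+x. ennreal (exp (- (norm x)\<^sup>2 / (32 * t))) \<partial>\<mu>) < \<infinity>"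
  shows "gaussian_finite_on B \<mu> t"
proof -
  obtain b where b: "\<And>y. y \<in> B \<Longrightarrow> norm y \<le> b" using B by (auto simp: bounded_iff)
  obtain C where C: "0 \<le> C" "(\<integral>\<^sup>+x. ennreal (exp (- (norm x)\<^sup>2 / (32 * t))) \<partial>\<mu>) = ennreal C"
    using fin by (cases "\<integral>\<^sup>+x. ennreal (exp (- (norm x)\<^sup>2 / (32 * t))) \<partial>\<mu>") auto
  have "(\<integral>\<^sup>+x. ennreal (exp (- (norm (x - y))\<^sup>2 / (16 * t))) \<partial>\<mu>) \<le> ennreal (exp (b\<^sup>2 / (16 * t)) * C)" if y: "y \<in> B" for y
  proof -
    have pt: "exp (- (norm (x - y))\<^sup>2 / (16 * t)) \<le> exp (b\<^sup>2 / (16 * t)) * exp (- (norm x)\<^sup>2 / (32 * t))" for x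
    proof -
      have "norm x \<le> norm (x - y) + b" using norm_triangle_sub[of x y] b[OF y] by simp
      then have "(norm x)\<^sup>2 \<le> (norm (x - y) + b)\<^sup>2" by (intro power_mono) auto
      also have "\<dots> \<le> 2 * (norm (x - y))\<^sup>2 + 2 * b\<^sup>2"
        using zero_le_power2[of "norm (x - y) - b"] by (simp add: power2_sum power2_diff)
      finally have "(norm x)\<^sup>2 / (32 * t) \<le> (2 * (norm (x - y))\<^sup>2 + 2 * b\<^sup>2) / (32 * t)"
        using t by (intro divide_right_mono) auto
      also have "\<dots> = (norm (x - y))\<^sup>2 / (16 * t) + b\<^sup>2 / (16 * t)" using t by (simp add: field_simps)
      finally show ?thesis by (simp add: mult_exp_exp)
    qed
    have "(\<integral>\<^sup>+x. ennreal (exp (- (norm (x - y))\<^sup>2 / (16 * t))) \<partial>\<mu>)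
       \<le> (\<integral>\<^sup>+x. ennreal (exp (b\<^sup>2 / (16 * t))) * ennreal (exp (- (norm x)\<^sup>2 / (32 * t))) \<partial>\<mu>)"
      using pt by (intro nn_integral_mono) (simp add: ennreal_leI flip: ennreal_mult)
    also have "\<dots> = ennreal (exp (b\<^sup>2 / (16 * t))) * ennreal C"
      unfolding C(2)[symmetric] by (rule nn_integral_cmult) (simp add: measurable_cong_sets[OF \<mu> refl])
    finally show ?thesis using C(1) by (simp add: ennreal_mult)
  qed
  then show ?thesis unfolding gaussian_finite_on_def using C(1) by (intro exI[of _ "exp (b\<^sup>2 / (16 * t)) * C"]) auto
qed

lemma integral_le_of_gaussian_bound:
  fixes f :: "'a::euclidean_space \<Rightarrow> real"
  assumes \<mu>: "sets \<mu> = sets borel" and f: "f \<in> borel_measurable borel" and a: "0 \<le> a" and C: "0 \<le> C"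
    and le: "\<And>x. \<bar>f x\<bar> \<le> a * exp (- (norm (x - y))\<^sup>2 / (16 * t))"
    and fin: "(\<integral>\<^sup>+x. ennreal (exp (- (norm (x - y))\<^sup>2 / (16 * t))) \<partial>\<mu>) \<le> ennreal C"
  shows "integrable \<mu> f" "\<bar>\<integral>x. f x \<partial>\<mu>\<bar> \<le> a * C"
proof -
  note [measurable_cong] = \<mu>
  note [measurable] = f
  have "(\<integral>\<^sup>+x. ennreal (norm (f x)) \<partial>\<mu>) \<le> (\<integral>\<^sup>+x. ennreal a * ennreal (exp (- (norm (x - y))\<^sup>2 / (16 * t))) \<partial>\<mu>)"
    using le a by (intro nn_integral_mono) (simp add: ennreal_leI flip: ennreal_mult)
  also have "\<dots> = ennreal a * (\<integral>\<^sup>+x. ennreal (exp (- (norm (x - y))\<^sup>2 / (16 * t))) \<partial>\<mu>)"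
    by (rule nn_integral_cmult) measurable
  also have "\<dots> \<le> ennreal a * ennreal C" by (intro mult_left_mono fin) simp
  finally have b: "(\<integral>\<^sup>+x. ennreal (norm (f x)) \<partial>\<mu>) \<le> ennreal (a * C)" using a C by (simp add: ennreal_mult)
  show int: "integrable \<mu> f"
    by (rule integrableI_bounded) (use b in \<open>auto intro: le_less_trans\<close>)
  have "\<bar>\<integral>x. f x \<partial>\<mu>\<bar> \<le> (\<integral>x. norm (f x) \<partial>\<mu>)" using integral_norm_bound[of \<mu> f] by simp
  moreover have "ennreal (\<integral>x. norm (f x) \<partial>\<mu>) = (\<integral>\<^sup>+x. ennreal (norm (f x)) \<partial>\<mu>)"
    using int by (intro nn_integral_eq_integral[symmetric]) auto
  then have "ennreal (\<integral>x. norm (f x) \<partial>\<mu>) \<le> ennreal (a * C)" using b by (simp only:)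
  then have "(\<integral>x. norm (f x) \<partial>\<mu>) \<le> a * C" using a C by (subst (asm) ennreal_le_iff) auto
  ultimately show "\<bar>\<integral>x. f x \<partial>\<mu>\<bar> \<le> a * C" by linarith
qed

context DW_clusters
begin

lemma log_norm_eq:
  assumes A: "cluster_bound H A" and e: "small_radius 1 \<epsilon>" and d: "DIM('a) = 2"
  shows "log_norm H \<epsilon> = ennreal (cluster_mass H \<epsilon>)"
proof -
  have "hitting (lborel \<bind> H 1) (\<lambda>\<nu>. \<nu>) \<epsilon> 0 = (\<integral>\<^sup>+x. ennreal (cluster_density H \<epsilon> 1 x) \<partial>lborel)"
    using hitting_clusters[of lborel 1 \<epsilon> 0] by simp
  also have "\<dots> = ennreal (\<integral>x. cluster_density H \<epsilon> 1 x \<partial>lborel)"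
    by (intro nn_integral_eq_integral cluster_density_integrable[OF A] AE_I2 cluster_density_nonneg e) auto
  finally show ?thesis
    by (simp add: log_norm_def cluster_mass_def hit_rate_def d ennreal_mult integral_nonneg_AE cluster_density_nonneg)
qed

lemma heat_conv_eq:
  fixes y :: 'a
  assumes \<mu>: "sets \<mu> = sets borel" and t: "0 < t" and C: "0 \<le> C"
    and fin: "(\<integral>\<^sup>+x. ennreal (exp (- (norm (x - y))\<^sup>2 / (16 * t))) \<partial>\<mu>) \<le> ennreal C"
  shows "heat_conv \<mu> t y = ennreal (\<integral>x. heat_kernel t (x - y) \<partial>\<mu>)"
    and "integrable \<mu> (\<lambda>x. heat_kernel t (x - y))"
    and "\<bar>\<integral>x. heat_kernel t (x - y) \<partial>\<mu>\<bar> \<le> (2 * pi * t) powr (- real DIM('a) / 2) * C"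
proof -
  have b: "\<bar>heat_kernel t (x - y)\<bar> \<le> (2 * pi * t) powr (- real DIM('a) / 2) * exp (- (norm (x - y))\<^sup>2 / (16 * t))" for x
    using t unfolding heat_kernel_def abs_mult by (intro mult_mono) (auto simp: frac_le)
  have m: "(\<lambda>x. heat_kernel t (x - y)) \<in> borel_measurable borel" by measurable
  show int: "integrable \<mu> (\<lambda>x. heat_kernel t (x - y))"
    and "\<bar>\<integral>x. heat_kernel t (x - y) \<partial>\<mu>\<bar> \<le> (2 * pi * t) powr (- real DIM('a) / 2) * C"
    using integral_le_of_gaussian_bound[OF \<mu> m _ C b fin] by simp_all
  show "heat_conv \<mu> t y = ennreal (\<integral>x. heat_kernel t (x - y) \<partial>\<mu>)"
    unfolding heat_conv_def heat_kernel_minus_commute[of t y] using int by (intro nn_integral_eq_integral) auto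
qed

lemma cluster_density_integral_limit:
  assumes d: "2 \<le> DIM('a)" and A: "cluster_bound H A" and t: "0 < t"
    and \<mu>: "sets \<mu> = sets borel" and B: "gaussian_finite_on B \<mu> t" and \<eta>: "0 < \<eta>"
  shows "\<forall>\<^sub>F \<epsilon> in at_right 0. \<forall>y\<in>B. integrable \<mu> (\<lambda>x. cluster_density H \<epsilon> t (x - y)) \<and>
    \<bar>hit_rate DIM('a) \<epsilon> * (\<integral>x. cluster_density H \<epsilon> t (x - y) \<partial>\<mu>)
      - cluster_mass H \<epsilon> * (\<integral>x. heat_kernel t (x - y) \<partial>\<mu>)\<bar> \<le> \<eta>"
proof -
  obtain C where C: "0 \<le> C" "\<And>y. y \<in> B \<Longrightarrow> (\<integral>\<^sup>+x. ennreal (exp (- (norm (x - y))\<^sup>2 / (16 * t))) \<partial>\<mu>) \<le> ennreal C"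
    using B by (auto simp: gaussian_finite_on_def)
  define a where "a = \<eta> / (C + 1)"
  have a: "0 < a" "a * C \<le> \<eta>" using \<eta> C(1) by (auto simp: a_def field_simps)
  show ?thesis using cluster_density_gaussian_limit[OF d A t a(1)] eventually_small_radius[OF t]
  proof eventually_elim
    case (elim \<epsilon>)
    show ?case
    proof
      fix y assume y: "y \<in> B"
      let ?f = "\<lambda>x. hit_rate DIM('a) \<epsilon> * cluster_density H \<epsilon> t (x - y) - cluster_mass H \<epsilon> * heat_kernel t (x - y)"
      note [measurable] = cluster_density_measurable[OF t]
      have m: "?f \<in> borel_measurable borel" by measurable
      have "\<bar>?f x\<bar> \<le> a * exp (- (norm (x - y))\<^sup>2 / (16 * t))" for x using elim(1) by blast
      note f = integral_le_of_gaussian_bound[OF \<mu> m less_imp_le[OF a(1)] C(1) this C(2)[OF y]]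
      have K: "integrable \<mu> (\<lambda>x. cluster_mass H \<epsilon> * heat_kernel t (x - y))"
        by (intro integrable_mult_right heat_conv_eq(2)[OF \<mu> t C(1) C(2)[OF y]])
      have R: "0 < hit_rate DIM('a) \<epsilon>" using elim(2) by (auto simp: small_radius_def intro!: hit_rate_pos)
      have "integrable \<mu> (\<lambda>x. ?f x + cluster_mass H \<epsilon> * heat_kernel t (x - y))"
        by (intro Bochner_Integration.integrable_add f(1) K)
      then have U: "integrable \<mu> (\<lambda>x. cluster_density H \<epsilon> t (x - y))" using R by simp
      have "(\<integral>x. ?f x \<partial>\<mu>) = hit_rate DIM('a) \<epsilon> * (\<integral>x. cluster_density H \<epsilon> t (x - y) \<partial>\<mu>)
          - cluster_mass H \<epsilon> * (\<integral>x. heat_kernel t (x - y) \<partial>\<mu>)"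
        using U K by simp
      then show "integrable \<mu> (\<lambda>x. cluster_density H \<epsilon> t (x - y)) \<and>
        \<bar>hit_rate DIM('a) \<epsilon> * (\<integral>x. cluster_density H \<epsilon> t (x - y) \<partial>\<mu>)
          - cluster_mass H \<epsilon> * (\<integral>x. heat_kernel t (x - y) \<partial>\<mu>)\<bar> \<le> \<eta>"
        using U f(2) a(2) by simp
    qed
  qed
qed

text \<open>The function \<open>k\<close> stands for \<open>m(\<epsilon>)\<close> in the plane and for the constant \<open>c\<close> in higher dimensions. The passage from \<open>\<Phi>\<close> to
  \<open>1 - exp (-\<Phi>)\<close> costs \<open>r \<Phi>\<^sup>2 = (r \<Phi>)\<^sup>2 / r\<close>, where \<open>r \<Phi>\<close> is bounded.\<close>

lemma hitting_limits_real:
  assumes d: "2 \<le> DIM('a)" and A: "cluster_bound H A" and t: "0 < t"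
    and \<mu>: "sets \<mu> = sets borel" and B: "gaussian_finite_on B \<mu> t"
    and k: "((\<lambda>\<epsilon>. k \<epsilon> - cluster_mass H \<epsilon>) \<longlongrightarrow> 0) (at_right 0)" and \<eta>: "0 < \<eta>"
  defines "\<Phi> \<equiv> \<lambda>\<epsilon> y. \<integral>x. cluster_density H \<epsilon> t (x - y) \<partial>\<mu>"
  shows "\<forall>\<^sub>F \<epsilon> in at_right 0. \<forall>y\<in>B. \<bar>hit_rate DIM('a) \<epsilon> * \<Phi> \<epsilon> y - k \<epsilon> * (\<integral>x. heat_kernel t (x - y) \<partial>\<mu>)\<bar> \<le> \<eta>"
    and "\<forall>\<^sub>F \<epsilon> in at_right 0. \<forall>y\<in>B. \<bar>hit_rate DIM('a) \<epsilon> * (1 - exp (- \<Phi> \<epsilon> y)) - k \<epsilon> * (\<integral>x. heat_kernel t (x - y) \<partial>\<mu>)\<bar> \<le> \<eta>"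
proof -
  obtain C where C: "0 \<le> C" "\<And>y. y \<in> B \<Longrightarrow> (\<integral>\<^sup>+x. ennreal (exp (- (norm (x - y))\<^sup>2 / (16 * t))) \<partial>\<mu>) \<le> ennreal C"
    using B by (auto simp: gaussian_finite_on_def)
  define Q where "Q = (2 * pi * t) powr (- real DIM('a) / 2) * C"
  have Q: "\<bar>\<integral>x. heat_kernel t (x - y) \<partial>\<mu>\<bar> \<le> Q" if "y \<in> B" for y
    unfolding Q_def by (rule heat_conv_eq(3)[OF \<mu> t C(1) C(2)[OF that]])
  have Q0: "0 \<le> Q" using C(1) by (simp add: Q_def)
  have first: "\<forall>\<^sub>F \<epsilon> in at_right 0. \<forall>y\<in>B. \<bar>hit_rate DIM('a) \<epsilon> * \<Phi> \<epsilon> y - k \<epsilon> * (\<integral>x. heat_kernel t (x - y) \<partial>\<mu>)\<bar> \<le> \<eta>"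
    if \<eta>: "0 < \<eta>" for \<eta>
  proof -
    have "\<forall>\<^sub>F \<epsilon> in at_right 0. dist (k \<epsilon> - cluster_mass H \<epsilon>) 0 < \<eta> / (2 * (Q + 1))"
      using \<eta> Q0 by (intro tendstoD[OF k]) simp
    then show ?thesis using cluster_density_integral_limit[OF d A t \<mu> B half_gt_zero[OF \<eta>]]
    proof eventually_elim
      case (elim \<epsilon>)
      show ?case
      proof
        fix y assume y: "y \<in> B"
        let ?q = "\<integral>x. heat_kernel t (x - y) \<partial>\<mu>"
        have "\<bar>k \<epsilon> * ?q - cluster_mass H \<epsilon> * ?q\<bar> = \<bar>k \<epsilon> - cluster_mass H \<epsilon>\<bar> * \<bar>?q\<bar>"
          by (simp add: abs_mult flip: left_diff_distrib)
        also have "\<dots> \<le> \<eta> / (2 * (Q + 1)) * (Q + 1)"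
          using elim(1) Q[OF y] Q0 \<eta> by (intro mult_mono) (auto simp: dist_real_def)
        also have "\<dots> = \<eta> / 2" using Q0 by (simp add: field_simps)
        finally have "\<bar>k \<epsilon> * ?q - cluster_mass H \<epsilon> * ?q\<bar> \<le> \<eta> / 2" .
        moreover have "\<bar>hit_rate DIM('a) \<epsilon> * \<Phi> \<epsilon> y - cluster_mass H \<epsilon> * ?q\<bar> \<le> \<eta> / 2"
          using elim(2) y unfolding \<Phi>_def by blast
        ultimately show "\<bar>hit_rate DIM('a) \<epsilon> * \<Phi> \<epsilon> y - k \<epsilon> * ?q\<bar> \<le> \<eta>" by linarith
      qed
    qed
  qed
  show "\<forall>\<^sub>F \<epsilon> in at_right 0. \<forall>y\<in>B. \<bar>hit_rate DIM('a) \<epsilon> * \<Phi> \<epsilon> y - k \<epsilon> * (\<integral>x. heat_kernel t (x - y) \<partial>\<mu>)\<bar> \<le> \<eta>"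
    by (rule first[OF \<eta>])
  have A0: "0 < A" using A by (simp add: cluster_bound_def)
  define N where "N = A * Q + 1"
  have N: "0 < N" using A0 Q0 by (simp add: N_def add_nonneg_pos)
  have "\<forall>\<^sub>F \<epsilon> in at_right 0. N\<^sup>2 * 2 / \<eta> \<le> hit_rate DIM('a) \<epsilon>"
    using hit_rate_at_top[OF d] by (simp add: filterlim_at_top)
  then show "\<forall>\<^sub>F \<epsilon> in at_right 0. \<forall>y\<in>B. \<bar>hit_rate DIM('a) \<epsilon> * (1 - exp (- \<Phi> \<epsilon> y)) - k \<epsilon> * (\<integral>x. heat_kernel t (x - y) \<partial>\<mu>)\<bar> \<le> \<eta>"
    using first[OF half_gt_zero[OF \<eta>]] cluster_density_integral_limit[OF d A t \<mu> B zero_less_one]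
      eventually_small_radius[OF zero_less_one]
  proof eventually_elim
    case (elim \<epsilon>)
    show ?case
    proof
      fix y assume y: "y \<in> B"
      let ?R = "hit_rate DIM('a) \<epsilon>" and ?q = "\<integral>x. heat_kernel t (x - y) \<partial>\<mu>"
      have R: "0 < ?R" using elim(4) by (auto simp: small_radius_def intro!: hit_rate_pos)
      have m: "0 \<le> cluster_mass H \<epsilon>" "cluster_mass H \<epsilon> \<le> A"
        using cluster_density_integrable(2,3)[OF A zero_less_one elim(4)] by (simp_all add: cluster_mass_def)
      have \<Phi>0: "0 \<le> \<Phi> \<epsilon> y" unfolding \<Phi>_def by (intro integral_nonneg_AE AE_I2 cluster_density_nonneg t)
      have "cluster_mass H \<epsilon> * ?q \<le> A * Q" using m Q[OF y] Q0 by (intro mult_mono) auto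
      moreover have "\<bar>?R * \<Phi> \<epsilon> y - cluster_mass H \<epsilon> * ?q\<bar> \<le> 1" using elim(3) y unfolding \<Phi>_def by blast
      ultimately have "?R * \<Phi> \<epsilon> y \<le> N" unfolding N_def by linarith
      then have sq: "(?R * \<Phi> \<epsilon> y)\<^sup>2 \<le> N\<^sup>2" using R \<Phi>0 by (intro power_mono) auto
      have "\<bar>?R * (1 - exp (- \<Phi> \<epsilon> y)) - ?R * \<Phi> \<epsilon> y\<bar> = ?R * \<bar>1 - exp (- \<Phi> \<epsilon> y) - \<Phi> \<epsilon> y\<bar>"
        using R by (simp add: abs_mult flip: right_diff_distrib)
      also have "\<dots> \<le> ?R * (\<Phi> \<epsilon> y)\<^sup>2"
        using R by (intro mult_left_mono abs_one_minus_exp_minus_self_le \<Phi>0) auto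
      also have "\<dots> = (?R * \<Phi> \<epsilon> y)\<^sup>2 / ?R" using R by (simp add: power2_eq_square)
      also have "\<dots> \<le> N\<^sup>2 / ?R" using R sq by (intro divide_right_mono) auto
      also have "\<dots> \<le> \<eta> / 2" using elim(1) R \<eta> by (simp add: field_simps)
      finally have "\<bar>?R * (1 - exp (- \<Phi> \<epsilon> y)) - ?R * \<Phi> \<epsilon> y\<bar> \<le> \<eta> / 2" .
      moreover have "\<bar>?R * \<Phi> \<epsilon> y - k \<epsilon> * ?q\<bar> \<le> \<eta> / 2" using elim(2) y by blast
      ultimately show "\<bar>?R * (1 - exp (- \<Phi> \<epsilon> y)) - k \<epsilon> * ?q\<bar> \<le> \<eta>" by linarith
    qed
  qed
qed

lemma hitting_limits:
  assumes d: "2 \<le> DIM('a)" and A: "cluster_bound H A" and t: "0 < t"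
    and \<mu>: "sets \<mu> = sets borel" and B: "gaussian_finite_on B \<mu> t"
    and k: "((\<lambda>\<epsilon>. k \<epsilon> - cluster_mass H \<epsilon>) \<longlongrightarrow> 0) (at_right 0)" "\<forall>\<^sub>F \<epsilon> in at_right 0. 0 \<le> k \<epsilon> \<and> K \<epsilon> = ennreal (k \<epsilon>)"
    and h: "\<And>\<epsilon> y. integrable \<mu> (\<lambda>x. cluster_density H \<epsilon> t (x - y)) \<Longrightarrow>
        h \<epsilon> y = ennreal (1 - exp (- (\<integral>x. cluster_density H \<epsilon> t (x - y) \<partial>\<mu>)))"
    and rate: "\<And>\<epsilon>. rate \<epsilon> = hit_rate DIM('a) \<epsilon>"
  shows "unif_close_on B (\<lambda>\<epsilon> y. ennreal (rate \<epsilon>) * h \<epsilon> y) (\<lambda>\<epsilon> y. K \<epsilon> * heat_conv \<mu> t y)"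
    and "unif_close_on B (\<lambda>\<epsilon> y. ennreal (rate \<epsilon>) * hitting (\<mu> \<bind> H t) (\<lambda>\<nu>. \<nu>) \<epsilon> y) (\<lambda>\<epsilon> y. K \<epsilon> * (ennreal t * heat_conv \<mu> t y))"
proof -
  obtain C where C: "0 \<le> C" "\<And>y. y \<in> B \<Longrightarrow> (\<integral>\<^sup>+x. ennreal (exp (- (norm (x - y))\<^sup>2 / (16 * t))) \<partial>\<mu>) \<le> ennreal C"
    using B by (auto simp: gaussian_finite_on_def)
  define \<Phi> where "\<Phi> = (\<lambda>\<epsilon> y. \<integral>x. cluster_density H \<epsilon> t (x - y) \<partial>\<mu>)"
  define q where "q = (\<lambda>y. \<integral>x. heat_kernel t (x - y) \<partial>\<mu>)"
  have \<Phi>0: "0 \<le> \<Phi> \<epsilon> y" for \<epsilon> y unfolding \<Phi>_def by (intro integral_nonneg_AE AE_I2 cluster_density_nonneg t)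
  have q0: "0 \<le> q y" for y unfolding q_def by (intro integral_nonneg_AE) simp
  have hc: "heat_conv \<mu> t y = ennreal (q y)" if "y \<in> B" for y
    unfolding q_def by (rule heat_conv_eq(1)[OF \<mu> t C(1) C(2)[OF that]])
  have good: "\<forall>\<^sub>F \<epsilon> in at_right 0. 0 \<le> k \<epsilon> \<and> K \<epsilon> = ennreal (k \<epsilon>) \<and> 0 < hit_rate DIM('a) \<epsilon> \<and>
      (\<forall>y\<in>B. integrable \<mu> (\<lambda>x. cluster_density H \<epsilon> t (x - y)))"
    using k(2) cluster_density_integral_limit[OF d A t \<mu> B zero_less_one] eventually_small_radius[OF zero_less_one]
    by eventually_elim (auto simp: small_radius_def intro!: hit_rate_pos)
  show "unif_close_on B (\<lambda>\<epsilon> y. ennreal (rate \<epsilon>) * h \<epsilon> y) (\<lambda>\<epsilon> y. K \<epsilon> * heat_conv \<mu> t y)"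
  proof (rule unif_close_onI[where f = "\<lambda>\<epsilon> y. hit_rate DIM('a) \<epsilon> * (1 - exp (- \<Phi> \<epsilon> y))" and g = "\<lambda>\<epsilon> y. k \<epsilon> * q y"])
    show "\<forall>\<^sub>F \<epsilon> in at_right 0. \<forall>y\<in>B. ennreal (rate \<epsilon>) * h \<epsilon> y = ennreal (hit_rate DIM('a) \<epsilon> * (1 - exp (- \<Phi> \<epsilon> y))) \<and>
        K \<epsilon> * heat_conv \<mu> t y = ennreal (k \<epsilon> * q y) \<and> 0 \<le> hit_rate DIM('a) \<epsilon> * (1 - exp (- \<Phi> \<epsilon> y)) \<and> 0 \<le> k \<epsilon> * q y"
      using good
    proof eventually_elim
      case (elim \<epsilon>)
      then have "h \<epsilon> y = ennreal (1 - exp (- \<Phi> \<epsilon> y))" if "y \<in> B" for y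
        using h[of \<epsilon> y] that by (simp add: \<Phi>_def)
      then show ?case using elim \<Phi>0 q0 hc by (simp add: rate ennreal_mult)
    qed
    show "\<forall>\<^sub>F \<epsilon> in at_right 0. \<forall>y\<in>B. \<bar>hit_rate DIM('a) \<epsilon> * (1 - exp (- \<Phi> \<epsilon> y)) - k \<epsilon> * q y\<bar> \<le> \<eta>" if "0 < \<eta>" for \<eta>
      unfolding \<Phi>_def q_def by (rule hitting_limits_real(2)[OF d A t \<mu> B k(1) that])
  qed
  show "unif_close_on B (\<lambda>\<epsilon> y. ennreal (rate \<epsilon>) * hitting (\<mu> \<bind> H t) (\<lambda>\<nu>. \<nu>) \<epsilon> y) (\<lambda>\<epsilon> y. K \<epsilon> * (ennreal t * heat_conv \<mu> t y))"
  proof (rule unif_close_onI[where f = "\<lambda>\<epsilon> y. hit_rate DIM('a) \<epsilon> * (t * \<Phi> \<epsilon> y)" and g = "\<lambda>\<epsilon> y. k \<epsilon> * (t * q y)"])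
    show "\<forall>\<^sub>F \<epsilon> in at_right 0. \<forall>y\<in>B. ennreal (rate \<epsilon>) * hitting (\<mu> \<bind> H t) (\<lambda>\<nu>. \<nu>) \<epsilon> y = ennreal (hit_rate DIM('a) \<epsilon> * (t * \<Phi> \<epsilon> y)) \<and>
        K \<epsilon> * (ennreal t * heat_conv \<mu> t y) = ennreal (k \<epsilon> * (t * q y)) \<and> 0 \<le> hit_rate DIM('a) \<epsilon> * (t * \<Phi> \<epsilon> y) \<and> 0 \<le> k \<epsilon> * (t * q y)"
      using good
    proof eventually_elim
      case (elim \<epsilon>)
      have "hitting (\<mu> \<bind> H t) (\<lambda>\<nu>. \<nu>) \<epsilon> y = ennreal (t * \<Phi> \<epsilon> y)" if "y \<in> B" for y
      proof -
        have "integrable \<mu> (\<lambda>x. t * cluster_density H \<epsilon> t (x - y))" using elim that by simp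
        then have "(\<integral>\<^sup>+x. ennreal (t * cluster_density H \<epsilon> t (x - y)) \<partial>\<mu>) = ennreal (\<integral>x. t * cluster_density H \<epsilon> t (x - y) \<partial>\<mu>)"
          using t cluster_density_nonneg[OF t] by (intro nn_integral_eq_integral AE_I2 mult_nonneg_nonneg) auto
        then show ?thesis by (simp add: hitting_clusters[OF \<mu> t] \<Phi>_def)
      qed
      then show ?case using elim \<Phi>0 q0 hc t by (simp add: rate ennreal_mult)
    qed
    show "\<forall>\<^sub>F \<epsilon> in at_right 0. \<forall>y\<in>B. \<bar>hit_rate DIM('a) \<epsilon> * (t * \<Phi> \<epsilon> y) - k \<epsilon> * (t * q y)\<bar> \<le> \<eta>" if \<eta>: "0 < \<eta>" for \<eta>
    proof -
      have "0 < \<eta> / t" using \<eta> t by simp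
      from hitting_limits_real(1)[OF d A t \<mu> B k(1) this] show ?thesis
      proof eventually_elim
        case (elim \<epsilon>)
        show ?case
        proof
          fix y assume "y \<in> B"
          then have "\<bar>hit_rate DIM('a) \<epsilon> * \<Phi> \<epsilon> y - k \<epsilon> * q y\<bar> \<le> \<eta> / t" using elim unfolding \<Phi>_def q_def by blast
          then have "t * \<bar>hit_rate DIM('a) \<epsilon> * \<Phi> \<epsilon> y - k \<epsilon> * q y\<bar> \<le> \<eta>" using t by (simp add: field_simps)
          moreover have "hit_rate DIM('a) \<epsilon> * (t * \<Phi> \<epsilon> y) - k \<epsilon> * (t * q y) = t * (hit_rate DIM('a) \<epsilon> * \<Phi> \<epsilon> y - k \<epsilon> * q y)"
            by (simp add: algebra_simps)
          ultimately show "\<bar>hit_rate DIM('a) \<epsilon> * (t * \<Phi> \<epsilon> y) - k \<epsilon> * (t * q y)\<bar> \<le> \<eta>" using t by (simp add: abs_mult)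
        qed
      qed
    qed
  qed
qed

text \<open>At the origin and time \<open>1\<close>, for a unit mass at the origin, the normalized hitting probability tends to \<open>c p\<^sub>1(0)\<close> by assumption and differs from \<open>m(\<epsilon>) p\<^sub>1(0)\<close>
  by a null sequence.\<close>

lemma cluster_mass_tendsto_DIP_constant:
  assumes d: "3 \<le> DIM('a)" and A: "cluster_bound H A" and c: "DIP_constant P \<xi> c"
  shows "((\<lambda>\<epsilon>. c - cluster_mass H \<epsilon>) \<longlongrightarrow> 0) (at_right 0)"
proof -
  let ?\<mu> = "return borel (0::'a)"
  let ?R = "hit_rate DIM('a)" and ?U = "\<lambda>\<epsilon>. cluster_density H \<epsilon> 1 0" and ?k = "heat_kernel 1 (0::'a)"
  have d2: "2 \<le> DIM('a)" using d by simp
  have c0: "0 < c" using c by (simp add: DIP_constant_def)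
  have k0: "0 < ?k" by (simp add: heat_kernel_def)
  note [measurable] = cluster_density_measurable[OF zero_less_one]
  have U: "(\<integral>x. cluster_density H \<epsilon> 1 (x - 0) \<partial>?\<mu>) = ?U \<epsilon>" for \<epsilon>
    using integral_return[of "0::'a" borel "cluster_density H \<epsilon> 1"] by simp
  have K: "(\<integral>x. heat_kernel 1 (x - 0) \<partial>?\<mu>) = ?k"
    using integral_return[of "0::'a" borel "heat_kernel 1"] by simp
  have hc: "heat_conv ?\<mu> 1 0 = ennreal ?k"
    by (simp add: heat_conv_def nn_integral_return)
  have hit: "ennreal (\<epsilon> powr (2 - real DIM('a))) * hitting (P ?\<mu>) (\<xi> 1) \<epsilon> 0 = ennreal (?R \<epsilon> * (1 - exp (- ?U \<epsilon>)))" for \<epsilon>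
    using d hitting_process[OF return_fin_measures[of 0] zero_less_one, of \<epsilon> 0] cluster_density_nonneg[OF zero_less_one, of \<epsilon> 0]
    unfolding U by (simp add: hit_rate_def ennreal_mult)
  have "((\<lambda>\<epsilon>. ennreal (\<epsilon> powr (2 - real DIM('a))) * hitting (P ?\<mu>) (\<xi> 1) \<epsilon> 0) \<longlongrightarrow> ennreal c * heat_conv ?\<mu> 1 0) (at_right 0)"
    using c return_fin_measures[of "0::'a"] zero_less_one unfolding DIP_constant_def by blast
  then have "((\<lambda>\<epsilon>. ennreal (?R \<epsilon> * (1 - exp (- ?U \<epsilon>)))) \<longlongrightarrow> ennreal (c * ?k)) (at_right 0)"
    unfolding hit hc using c0 by (simp add: ennreal_mult)
  then have 1: "((\<lambda>\<epsilon>. ?R \<epsilon> * (1 - exp (- ?U \<epsilon>))) \<longlongrightarrow> c * ?k) (at_right 0)"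
  proof (rule tendsto_ennrealD)
    show "\<forall>\<^sub>F \<epsilon> in at_right 0. 0 \<le> ?R \<epsilon> * (1 - exp (- ?U \<epsilon>))"
      using eventually_small_radius[OF zero_less_one]
      by eventually_elim (auto simp: small_radius_def cluster_density_nonneg intro!: mult_nonneg_nonneg less_imp_le[OF hit_rate_pos])
  qed (use c0 k0 in simp)
  have 2: "((\<lambda>\<epsilon>. ?R \<epsilon> * (1 - exp (- ?U \<epsilon>)) - cluster_mass H \<epsilon> * ?k) \<longlongrightarrow> 0) (at_right 0)"
  proof (rule tendstoI)
    fix e :: real assume e: "0 < e"
    have "\<forall>\<^sub>F \<epsilon> in at_right 0. \<forall>y\<in>{0}. \<bar>?R \<epsilon> * (1 - exp (- (\<integral>x. cluster_density H \<epsilon> 1 (x - y) \<partial>?\<mu>))) - cluster_mass H \<epsilon> * (\<integral>x. heat_kernel 1 (x - y) \<partial>?\<mu>)\<bar> \<le> e / 2"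
      by (rule hitting_limits_real(2)[OF d2 A]) (use e in \<open>auto intro!: gaussian_finite_on_finite_measure return_fin_measures\<close>)
    then show "\<forall>\<^sub>F \<epsilon> in at_right 0. dist (?R \<epsilon> * (1 - exp (- ?U \<epsilon>)) - cluster_mass H \<epsilon> * ?k) 0 < e"
    proof eventually_elim
      case (elim \<epsilon>)
      then show ?case using U[of \<epsilon>] K e by (simp add: dist_real_def)
    qed
  qed
  from tendsto_divide[OF tendsto_diff[OF 1 2] tendsto_const, of ?k] k0
  have "((\<lambda>\<epsilon>. cluster_mass H \<epsilon>) \<longlongrightarrow> c) (at_right 0)" by simp
  from tendsto_diff[OF tendsto_const this, of c] show ?thesis by simp
qed

end

theorem theorem5p3:
  fixes W :: "'w measure"
    and P :: "'a::euclidean_space measure \<Rightarrow> 'w measure"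
    and \<xi> :: "real \<Rightarrow> 'w \<Rightarrow> 'a measure"
    and H :: "real \<Rightarrow> 'a \<Rightarrow> 'a measure measure"
    and t :: real
  assumes "2 \<le> DIM('a)"
    and "DW_process W P \<xi>"
    and "DW_clusters W P \<xi> H"
    and "0 < t"
  shows
    "(\<forall>\<mu>\<in>space fin_measures.
       (3 \<le> DIM('a) \<longrightarrow> (\<forall>c. DIP_constant P \<xi> c \<longrightarrow>
          unif_close_on UNIV
            (\<lambda>\<epsilon> x. ennreal (\<epsilon> powr (2 - real DIM('a))) * hitting (P \<mu>) (\<xi> t) \<epsilon> x)
            (\<lambda>\<epsilon> x. ennreal c * heat_conv \<mu> t x) \<and>
          unif_close_on UNIV
            (\<lambda>\<epsilon> x. ennreal (\<epsilon> powr (2 - real DIM('a))) * hitting (\<mu> \<bind> H t) (\<lambda>\<nu>. \<nu>) \<epsilon> x)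
            (\<lambda>\<epsilon> x. ennreal c * (ennreal t * heat_conv \<mu> t x)))) \<and>
       (DIM('a) = 2 \<longrightarrow>
          unif_close_on UNIV
            (\<lambda>\<epsilon> x. ennreal \<bar>ln \<epsilon>\<bar> * hitting (P \<mu>) (\<xi> t) \<epsilon> x)
            (\<lambda>\<epsilon> x. log_norm H \<epsilon> * heat_conv \<mu> t x) \<and>
          unif_close_on UNIV
            (\<lambda>\<epsilon> x. ennreal \<bar>ln \<epsilon>\<bar> * hitting (\<mu> \<bind> H t) (\<lambda>\<nu>. \<nu>) \<epsilon> x)
            (\<lambda>\<epsilon> x. log_norm H \<epsilon> * (ennreal t * heat_conv \<mu> t x))))
     \<and>
     (\<forall>\<mu> \<mu>s B. sigma_finite_measure \<mu> \<longrightarrow> (\<forall>n. \<mu>s n \<in> space fin_measures) \<longrightarrow> \<mu> = sum_measure \<mu>s \<longrightarrow>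
        locally_finite_DW P \<xi> \<mu>s \<longrightarrow> B \<in> sets borel \<longrightarrow> bounded B \<longrightarrow>
       (3 \<le> DIM('a) \<longrightarrow> (\<forall>c. DIP_constant P \<xi> c \<longrightarrow>
          unif_close_on B
            (\<lambda>\<epsilon> x. ennreal (\<epsilon> powr (2 - real DIM('a))) * hitting (sum_prob P \<mu>s) (sum_process \<xi> t) \<epsilon> x)
            (\<lambda>\<epsilon> x. ennreal c * heat_conv \<mu> t x) \<and>
          unif_close_on B
            (\<lambda>\<epsilon> x. ennreal (\<epsilon> powr (2 - real DIM('a))) * hitting (\<mu> \<bind> H t) (\<lambda>\<nu>. \<nu>) \<epsilon> x)
            (\<lambda>\<epsilon> x. ennreal c * (ennreal t * heat_conv \<mu> t x)))) \<and>
       (DIM('a) = 2 \<longrightarrow>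
          unif_close_on B
            (\<lambda>\<epsilon> x. ennreal \<bar>ln \<epsilon>\<bar> * hitting (sum_prob P \<mu>s) (sum_process \<xi> t) \<epsilon> x)
            (\<lambda>\<epsilon> x. log_norm H \<epsilon> * heat_conv \<mu> t x) \<and>
          unif_close_on B
            (\<lambda>\<epsilon> x. ennreal \<bar>ln \<epsilon>\<bar> * hitting (\<mu> \<bind> H t) (\<lambda>\<nu>. \<nu>) \<epsilon> x)
            (\<lambda>\<epsilon> x. log_norm H \<epsilon> * (ennreal t * heat_conv \<mu> t x))))"
proof -
  interpret DW_clusters W P \<xi> H by fact
  note d = \<open>2 \<le> DIM('a)\<close> and t = \<open>0 < t\<close>
  obtain A where A: "cluster_bound H A" using cluster_bound_exists[OF d] by blast
  have main: "(3 \<le> DIM('a) \<longrightarrow> (\<forall>c. DIP_constant P \<xi> c \<longrightarrow>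
          unif_close_on B (\<lambda>\<epsilon> x. ennreal (\<epsilon> powr (2 - real DIM('a))) * h \<epsilon> x) (\<lambda>\<epsilon> x. ennreal c * heat_conv \<mu> t x) \<and>
          unif_close_on B (\<lambda>\<epsilon> x. ennreal (\<epsilon> powr (2 - real DIM('a))) * hitting (\<mu> \<bind> H t) (\<lambda>\<nu>. \<nu>) \<epsilon> x)
            (\<lambda>\<epsilon> x. ennreal c * (ennreal t * heat_conv \<mu> t x)))) \<and>
       (DIM('a) = 2 \<longrightarrow>
          unif_close_on B (\<lambda>\<epsilon> x. ennreal \<bar>ln \<epsilon>\<bar> * h \<epsilon> x) (\<lambda>\<epsilon> x. log_norm H \<epsilon> * heat_conv \<mu> t x) \<and>
          unif_close_on B (\<lambda>\<epsilon> x. ennreal \<bar>ln \<epsilon>\<bar> * hitting (\<mu> \<bind> H t) (\<lambda>\<nu>. \<nu>) \<epsilon> x)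
            (\<lambda>\<epsilon> x. log_norm H \<epsilon> * (ennreal t * heat_conv \<mu> t x)))"
    if \<mu>: "sets \<mu> = sets borel" and B: "gaussian_finite_on B \<mu> t"
      and h: "\<And>\<epsilon> y. integrable \<mu> (\<lambda>x. cluster_density H \<epsilon> t (x - y)) \<Longrightarrow>
        h \<epsilon> y = ennreal (1 - exp (- (\<integral>x. cluster_density H \<epsilon> t (x - y) \<partial>\<mu>)))"
    for \<mu> B h
  proof (intro conjI[of "_ \<longrightarrow> _" "_ \<longrightarrow> _"] impI allI)
    fix c assume d3: "3 \<le> DIM('a)" and c: "DIP_constant P \<xi> c"
    have r: "\<epsilon> powr (2 - real DIM('a)) = hit_rate DIM('a) \<epsilon>" for \<epsilon> using d3 by (simp add: hit_rate_def)
    have K: "\<forall>\<^sub>F \<epsilon> in at_right (0::real). 0 \<le> c \<and> ennreal c = ennreal c" using c by (simp add: DIP_constant_def)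
    show "unif_close_on B (\<lambda>\<epsilon> x. ennreal (\<epsilon> powr (2 - real DIM('a))) * h \<epsilon> x) (\<lambda>\<epsilon> x. ennreal c * heat_conv \<mu> t x) \<and>
          unif_close_on B (\<lambda>\<epsilon> x. ennreal (\<epsilon> powr (2 - real DIM('a))) * hitting (\<mu> \<bind> H t) (\<lambda>\<nu>. \<nu>) \<epsilon> x)
            (\<lambda>\<epsilon> x. ennreal c * (ennreal t * heat_conv \<mu> t x))"
      using hitting_limits[OF d A t \<mu> B cluster_mass_tendsto_DIP_constant[OF d3 A c] K h r] by blast
  next
    assume d2: "DIM('a) = 2"
    have r: "\<bar>ln \<epsilon>\<bar> = hit_rate DIM('a) \<epsilon>" for \<epsilon> by (simp add: hit_rate_def d2)
    have k: "((\<lambda>\<epsilon>. cluster_mass H \<epsilon> - cluster_mass H \<epsilon>) \<longlongrightarrow> 0) (at_right 0)" by simp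
    have K: "\<forall>\<^sub>F \<epsilon> in at_right 0. 0 \<le> cluster_mass H \<epsilon> \<and> log_norm H \<epsilon> = ennreal (cluster_mass H \<epsilon>)"
      using eventually_small_radius[OF zero_less_one]
    proof eventually_elim
      case (elim \<epsilon>)
      then show ?case using log_norm_eq[OF A elim d2] cluster_density_integrable(3)[OF A zero_less_one elim]
        by (simp add: cluster_mass_def)
    qed
    show "unif_close_on B (\<lambda>\<epsilon> x. ennreal \<bar>ln \<epsilon>\<bar> * h \<epsilon> x) (\<lambda>\<epsilon> x. log_norm H \<epsilon> * heat_conv \<mu> t x) \<and>
          unif_close_on B (\<lambda>\<epsilon> x. ennreal \<bar>ln \<epsilon>\<bar> * hitting (\<mu> \<bind> H t) (\<lambda>\<nu>. \<nu>) \<epsilon> x)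
            (\<lambda>\<epsilon> x. log_norm H \<epsilon> * (ennreal t * heat_conv \<mu> t x))"
      using hitting_limits[OF d A t \<mu> B k K h r] by blast
  qed
  have bounded: "gaussian_finite_on B \<mu> t" "sets \<mu> = sets borel" if "\<mu> \<in> space fin_measures" for \<mu> :: "'a measure" and B
    using that gaussian_finite_on_finite_measure[OF that t] by (auto simp: space_fin_measures)
  have unbounded: "gaussian_finite_on B (sum_measure \<mu>s) t"
    if "\<And>n. \<mu>s n \<in> space fin_measures" "locally_finite_DW P \<xi> \<mu>s" "bounded B" for \<mu>s B
    using t locally_finite_imp_gaussian_integrable[OF that(1,2), of "32 * t"]
    by (intro gaussian_finite_on_bounded that(3)) auto
  show ?thesis
  proof (rule conjI, goal_cases)
    case 1
    show ?case by (intro ballI main bounded hitting_process t)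
  next
    case 2
    show ?case
    proof (intro allI impI, simp only:, intro main sets_sum_measure unbounded hitting_sum_process t)
    qed blast+
  qed
qed

end
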